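(* Let $\psi:\mathbb{S}\to\mathbb{R}$ be twice continuously differentiable with exactly $N$ critical points $c_1,\dots,c_N$, $0<N<\infty$, all nondegenerate ($\psi''(c_i)\neq 0$). For $L>0$, $a\in[0,1)$ let $\tau_a(x)=a+x+L\psi(x)\pmod 1$, and for $\varepsilon>0$ consider the random map $\tau_a+Y$ with $Y$ uniformly distributed on $[-\varepsilon,\varepsilon]$. There exist sets $A_L\subset[0,1)$, $L>0$ (depending only on $\psi$ and $L$), such that the following holds. Each $A_L$ is a union of at most $N^2$ intervals, where $[0,1)$ is identified with the circle $\mathbb{S}$, and $$\lim_{L\to\infty}\mathrm{m}(A_L)=1 .$$ Moreover, given any function $\varepsilon=\varepsilon(L)>b_2(L)/2$, for every sufficiently large $L$ and every $a\in[0,1)$ the random map $\tau_a+Y$ with noise level $\varepsilon=\varepsilon(L)$ admits a unique ergodic invariant measure $\mu$, and the corresponding Lyapunov exponents $\lambda_a(L)=\int_{\mathbb{S}}\log|\tau_a'|\,d\mu$ satisfy $$\liminf_{L\to\infty}\ \inf_{a\in A_L}\frac{\lambda_a(L)}{\log L}\ \ge\ \frac12 .$$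
   Context: $\mathbb{S}$ is the circle obtained by identifying the endpoints of $[0,1]$, and $\mathrm{m}$ is the uniform (normalized Lebesgue) measure on it (equivalently, Lebesgue measure on $[0,1)$). The parameter $a\in[0,1)$ is regarded as a point of $\mathbb{S}$, so an "interval" of parameters means an arc of the circle. The map $\tau_a$ depends on $L$, although this is not indicated in the notation; $\tau_a'(x)=1+L\psi'(x)$. For $K\ge 1$, $I_K=\{x\in\mathbb{S}: |\tau_a'(x)|\le K\}$, which depends on $L$ but not on $a$. $b_K(L)$ denotes the length of the largest connected component of $I_K$. Random map: $x\mapsto \tau_a(x)+Y \pmod 1$, with independent copies of $Y$ at each time step. For $\omega\in\mathbb{R}$ write $\tau_a^\omega(x)=\tau_a(x)+\omega \pmod 1$, and let $\eta$ be the uniform probability measure on $[-\varepsilon,\varepsilon]$. A Borel probability measure $\mu$ on $\mathbb{S}$ is invariant for $\tau_a+Y$ if $\mu(B)=\int_{[-\varepsilon,\varepsilon]}\mu((\tau_a^\omega)^{-1}B)\,d\eta(\omega)$ for every Borel set $B\subset\mathbb{S}$. An invariant measure $\mu$ is ergodic if, for every Borel set $B$, the condition $\mu(B\bigtriangleup(\tau_a^\omega)^{-1}B)=0$ for $\eta$-a.e. $\omega$ implies $\mu(B)\in\{0,1\}$. Lyapunov exponent: for i.i.d. kicks $(\omega_n)_{n\ge1}$ with law $\eta$, set $x_0=x$ and $x_n=\tau_a(x_{n-1})+\omega_n \pmod 1$. For ergodic invariant $\mu$, the limit $\lim_{n\to\infty}\frac1n\sum_{k=0}^{n-1}\log|\tau_a'(x_k)|$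 is $(\eta^{\mathbb{Z}_+}\times\mu)$-a.s. equal to the constant $\lambda_a(L)=\int_{\mathbb{S}}\log|\tau_a'|\,d\mu$, which is called the Lyapunov exponent. *)

theory Defs
  imports "HOL-Probability.Probability"
begin

text \<open>
  The circle is represented by the fundamental domain \<open>{0..<1}\<close>; functions on the circle are
  \<open>1\<close>-periodic functions on the reals. The topology is the one that identifies the endpoints of
  \<open>{0..1}\<close>, obtained by pulling back the topology of the unit circle along \<open>t \<mapsto> exp (2 pi i t)\<close>;
  it is not the subspace topology of \<open>{0..<1}\<close>. The two topologies have the same Borel sets.
\<close>

definition circle_topology :: "real topology" where
  "circle_topology = pullback_topology {0..<1} (\<lambda>t. cis (2 * pi * t)) euclidean"

definition circle_measure :: "real measure" where
  "circle_measure = restrict_space lborel {0..<1}"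

definition arc_on_circle :: "real set \<Rightarrow> bool" where
  "arc_on_circle J \<longleftrightarrow> connectedin circle_topology J"

definition C2_on_circle :: "(real \<Rightarrow> real) \<Rightarrow> bool" where
  "C2_on_circle \<psi> \<longleftrightarrow>
     (\<forall>x. \<psi> (x + 1) = \<psi> x) \<and>
     (\<forall>x. \<psi> differentiable (at x)) \<and>
     (\<forall>x. deriv \<psi> differentiable (at x)) \<and>
     continuous_on UNIV (deriv (deriv \<psi>))"

definition critical_points :: "(real \<Rightarrow> real) \<Rightarrow> real set" where
  "critical_points \<psi> = {x \<in> {0..<1}. deriv \<psi> x = 0}"

definition tau :: "(real \<Rightarrow> real) \<Rightarrow> real \<Rightarrow> real \<Rightarrow> real \<Rightarrow> real" where
  "tau \<psi> L a x = frac (a + x + L * \<psi> x)"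

definition tau_kick :: "(real \<Rightarrow> real) \<Rightarrow> real \<Rightarrow> real \<Rightarrow> real \<Rightarrow> real \<Rightarrow> real" where
  "tau_kick \<psi> L a \<omega> x = frac (tau \<psi> L a x + \<omega>)"

text \<open>
  The derivative of \<open>tau \<psi> L a\<close> as a map of the circle. It does not depend on \<open>a\<close>, and it is not
  the real derivative of \<open>tau \<psi> L a\<close>, which fails to exist where \<open>frac\<close> jumps.
\<close>

definition dtau :: "(real \<Rightarrow> real) \<Rightarrow> real \<Rightarrow> real \<Rightarrow> real" where
  "dtau \<psi> L x = 1 + L * deriv \<psi> x"

definition I_set :: "(real \<Rightarrow> real) \<Rightarrow> real \<Rightarrow> real \<Rightarrow> real set" where
  "I_set \<psi> K L = {x \<in> {0..<1}. \<bar>dtau \<psi> L x\<bar> \<le> K}"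

definition b_length :: "(real \<Rightarrow> real) \<Rightarrow> real \<Rightarrow> real \<Rightarrow> real" where
  "b_length \<psi> K L =
     (SUP C \<in> connected_components_of (subtopology circle_topology (I_set \<psi> K L)).
        measure circle_measure C)"

definition noise :: "real \<Rightarrow> real measure" where
  "noise \<epsilon> = uniform_measure lborel {-\<epsilon>..\<epsilon>}"

definition kick_preimage ::
    "(real \<Rightarrow> real) \<Rightarrow> real \<Rightarrow> real \<Rightarrow> real \<Rightarrow> real set \<Rightarrow> real set" where
  "kick_preimage \<psi> L a \<omega> B = {x \<in> {0..<1}. tau_kick \<psi> L a \<omega> x \<in> B}"

definition invariant_measure ::
    "(real \<Rightarrow> real) \<Rightarrow> real \<Rightarrow> real \<Rightarrow> real \<Rightarrow> real measure \<Rightarrow> bool" where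
  "invariant_measure \<psi> L a \<epsilon> \<mu> \<longleftrightarrow>
     prob_space \<mu> \<and> sets \<mu> = sets circle_measure \<and>
     (\<forall>B \<in> sets circle_measure.
        emeasure \<mu> B = (\<integral>\<^sup>+\<omega>. emeasure \<mu> (kick_preimage \<psi> L a \<omega> B) \<partial>noise \<epsilon>))"

definition ergodic_invariant_measure ::
    "(real \<Rightarrow> real) \<Rightarrow> real \<Rightarrow> real \<Rightarrow> real \<Rightarrow> real measure \<Rightarrow> bool" where
  "ergodic_invariant_measure \<psi> L a \<epsilon> \<mu> \<longleftrightarrow>
     invariant_measure \<psi> L a \<epsilon> \<mu> \<and>
     (\<forall>B \<in> sets circle_measure.
        (AE \<omega> in noise \<epsilon>.
           emeasure \<mu> ((B - kick_preimage \<psi> L a \<omega> B) \<union> (kick_preimage \<psi> L a \<omega> B - B)) = 0)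
        \<longrightarrow> emeasure \<mu> B \<in> {0, 1})"

definition log_abs :: "real \<Rightarrow> ereal" where
  "log_abs t = (if t = 0 then -\<infinity> else ereal (ln \<bar>t\<bar>))"

text \<open>
  The integral of \<open>log |\<tau>'|\<close> as an extended real, positive part minus negative part
  (\<open>e2ennreal\<close> truncates at \<open>0\<close>), so that a divergent integral has the value \<open>-\<infinity>\<close> and not
  the default value \<open>0\<close> of the Bochner integral. The integrand is bounded above, so the first
  term is finite.
\<close>

definition lyapunov_exponent :: "(real \<Rightarrow> real) \<Rightarrow> real \<Rightarrow> real measure \<Rightarrow> ereal" where
  "lyapunov_exponent \<psi> L \<mu> =
     enn2ereal (\<integral>\<^sup>+x. e2ennreal (log_abs (dtau \<psi> L x)) \<partial>\<mu>)
     - enn2ereal (\<integral>\<^sup>+x. e2ennreal (- log_abs (dtau \<psi> L x)) \<partial>\<mu>)"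

end

theory Submission
  imports Defs "HOL-Real_Asymp.Real_Asymp"
begin

text \<open>
  Lift the map to \<open>T x = a + x + L \<psi>(x)\<close> on the line. Near a critical point of \<open>\<psi>\<close> the second
  difference of \<open>T\<close> bounds its oscillation on an interval of length \<open>l\<close> from below by a multiple of
  \<open>l\<^sup>2\<close>, and \<open>b_length \<psi> 2 L\<close> is at least \<open>4 / (1.1 L \<bar>\<psi>''(c)\<bar>)\<close>. Hence, when \<open>\<epsilon>\<close> exceeds half of it,
  the image of an interval, fattened by \<open>0.95 \<epsilon>\<close> on both sides, is at least \<open>1.2\<close> times longer or covers
  the circle. The transition probabilities after finitely many steps therefore dominate a multiple of
  Lebesgue measure, uniformly in the starting point (Doeblin's condition), which gives a unique
  invariant measure \<open>\<mu>\<close>. It is ergodic because conditioning on an invariant set gives an invariant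
  measure again, and it satisfies \<open>\<mu> \<le> (1 + 1 / (2 \<epsilon>)) m\<close>.

  With \<open>\<delta> = 1 / (1 + \<bar>ln L\<bar>)\<close> the set \<open>A L\<close> consists of the \<open>a\<close> for which every critical point is mapped
  to distance at least \<open>\<delta>\<close> from all critical points. Put \<open>s = \<delta> sqrt L\<close>. The positive part of
  \<open>ln \<bar>\<tau>'\<bar>\<close> has integral at least \<open>ln s (\<mu>{\<bar>\<tau>'\<bar> > s} + \<mu>{\<bar>\<tau>'\<bar> > s\<^sup>2})\<close>. For \<open>\<epsilon> \<le> \<delta> / 4\<close> the bracket
  is at least \<open>1\<close>, as \<open>{\<bar>\<tau>'\<bar> \<le> s}\<close> is mapped into \<open>{\<bar>\<tau>'\<bar> > s\<^sup>2}\<close>; for larger \<open>\<epsilon>\<close> the density bound gives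
  \<open>\<mu>{\<bar>\<tau>'\<bar> \<le> s} = O(1 / sqrt L)\<close>. The integral of the negative part is bounded independently of \<open>L\<close>, again by
  the density bound. As \<open>ln s\<close> is asymptotic to \<open>ln L / 2\<close>, the claim follows.
\<close>

section \<open>Arcs of the circle and points away from a finite set\<close>

text \<open>The map \<open>\<lambda>t. cis (2 * pi * t)\<close> has period 1, so composing it with
  \<open>frac\<close> changes nothing, and continuity into a pullback topology is continuity of this
  composition. Hence intervals that run past an integer still project to arcs.\<close>

lemma continuous_map_frac: "continuous_map euclideanreal circle_topology frac"
  unfolding circle_topology_def
proof (rule continuous_map_pullback')
  have e: "(\<lambda>t. cis (2 * pi * t)) \<circ> frac = (\<lambda>t. cis (2 * pi * t))"
  proof
    fix t :: real
    have "cis (2 * pi * t) = cis (2 * pi * frac t) * cis (2 * pi * of_int \<lfloor>t\<rfloor>)"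
      by (simp add: cis_mult frac_def algebra_simps)
    moreover have "cis (2 * pi * of_int \<lfloor>t\<rfloor>) = 1"
      by (intro cis_multiple_2pi) auto
    ultimately show "((\<lambda>t. cis (2 * pi * t)) \<circ> frac) t = cis (2 * pi * t)" by simp
  qed
  show "continuous_map euclideanreal euclidean ((\<lambda>t. cis (2 * pi * t)) \<circ> frac)"
    unfolding e by (auto intro!: continuous_intros)
  show "topspace euclideanreal \<subseteq> frac -` {0..<1}"
    by (auto simp: frac_lt_1)
qed

lemma arc_on_circle_frac_image:
  assumes "connected S"
  shows "arc_on_circle (frac ` S)"
  unfolding arc_on_circle_def
  using connectedin_continuous_map_image[OF continuous_map_frac] assms by simp

lemma frac_in_unit: "frac x \<in> {0..<1::real}"
  by (simp add: frac_lt_1)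

lemma frac_eqI: "0 \<le> y \<Longrightarrow> y < 1 \<Longrightarrow> x = y + of_int k \<Longrightarrow> frac x = (y::real)"
  by (simp add: frac_unique_iff)

text \<open>Bounding \<open>frac (x - p)\<close> from both sides expresses distance at least
  \<delta> from \<open>p\<close> on the circle, without a case distinction where 0 and 1 are
  glued.\<close>

definition centres_avoided :: "real \<Rightarrow> real set \<Rightarrow> real set" where
  "centres_avoided \<delta> P = {x \<in> {0..<1}. \<forall>p\<in>P. \<delta> \<le> frac (x - p) \<and> frac (x - p) \<le> 1 - \<delta>}"

text \<open>Each centre contributes the arc that separates it from the next centre on the circle.\<close>

lemma centres_avoided_arcs:
  assumes P: "finite P" "P \<noteq> {}" "P \<subseteq> {0..<1}" and \<delta>: "0 < \<delta>"
  shows "\<exists>\<J>. finite \<J> \<and> card \<J> \<le> card P \<and> (\<forall>J\<in>\<J>. arc_on_circle J) \<and>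
             centres_avoided \<delta> P = \<Union>\<J>"
proof -
  \<comment> \<open>The distance from \<open>p\<close> forwards to the next centre. The inserted 1,
    a full turn, takes over when \<open>p\<close> is the only centre.\<close>
  define g where "g p = Min (insert 1 ((\<lambda>q. frac (q - p)) ` (P - {p})))" for p
  \<comment> \<open>If the next centre is closer than 2\<delta>, this set is empty, which still
    counts as an arc.\<close>
  define J where "J p = frac ` {p + \<delta>..p + g p - \<delta>}" for p
  have g_le: "g p \<le> 1" "\<And>q. q \<in> P \<Longrightarrow> q \<noteq> p \<Longrightarrow> g p \<le> frac (q - p)" for p
    using P(1) by (auto simp: g_def)
  have le_g: "z \<le> g p" if "z \<le> 1" "\<And>q. q \<in> P \<Longrightarrow> q \<noteq> p \<Longrightarrow> z \<le> frac (q - p)" for z p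
    using P(1) that by (auto simp: g_def)
  have "centres_avoided \<delta> P \<subseteq> (\<Union>p\<in>P. J p)"
  proof
    fix x assume x: "x \<in> centres_avoided \<delta> P"
    \<comment> \<open>The centre chosen is the closest one behind \<open>x\<close>.\<close>
    obtain p where p: "p \<in> P" and pmin: "\<And>q. q \<in> P \<Longrightarrow> frac (x - p) \<le> frac (x - q)"
      using ex_min_if_finite[of "(\<lambda>q. frac (x - q)) ` P"] P(1,2) by fastforce
    define t where "t = frac (x - p)"
    have t: "\<delta> \<le> t" "t \<le> 1 - \<delta>" using x p by (auto simp: centres_avoided_def t_def)
    have "t + \<delta> \<le> g p"
    proof (rule le_g)
      show "t + \<delta> \<le> 1" using t by simp
      fix q assume q: "q \<in> P" "q \<noteq> p"
      define s where "s = frac (q - p)"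
      have xq: "frac (x - q) \<le> 1 - \<delta>" "t \<le> frac (x - q)"
        using x q pmin by (auto simp: centres_avoided_def t_def)
      have s: "0 < s" "s < 1"
      proof -
        have "q - p \<notin> \<int>"
        proof
          assume "q - p \<in> \<int>"
          moreover have "-1 < q - p" "q - p < 1" using subsetD[OF P(3) p] subsetD[OF P(3) q(1)] by auto
          ultimately have "q - p = 0" using Ints_nonzero_abs_less1 by force
          then show False using q by simp
        qed
        then show "0 < s" "s < 1" by (auto simp: s_def frac_gt_0_iff frac_lt_1)
      qed
      have eq: "x - q = t - s + of_int (\<lfloor>x - p\<rfloor> - \<lfloor>q - p\<rfloor>)"
        by (simp add: t_def s_def frac_def)
      \<comment> \<open>Otherwise \<open>q\<close> would lie behind \<open>x\<close> at distance
        \<open>t - s\<close>, closer than \<open>p\<close>.\<close>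
      have "t < s"
      proof (rule ccontr)
        assume "\<not> t < s"
        then have "frac (x - q) = t - s" using s t \<delta> by (intro frac_eqI[OF _ _ eq]) auto
        then show False using xq s by simp
      qed
      then have "frac (x - q) = 1 + t - s"
        using s t \<delta> eq by (intro frac_eqI[where k = "\<lfloor>x - p\<rfloor> - \<lfloor>q - p\<rfloor> - 1"]) auto
      then show "t + \<delta> \<le> frac (q - p)" using xq by (simp add: s_def)
    qed
    moreover have "x = frac (p + t)"
    proof -
      have "0 \<le> x" "x < 1" using x by (auto simp: centres_avoided_def)
      then show ?thesis
        by (intro frac_eqI[where k = "- \<lfloor>x - p\<rfloor>", symmetric]) (auto simp: t_def frac_def)
    qed
    ultimately have "x \<in> J p" using t by (auto simp: J_def)
    then show "x \<in> (\<Union>p\<in>P. J p)" using p by blast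
  qed
  moreover have "(\<Union>p\<in>P. J p) \<subseteq> centres_avoided \<delta> P"
  proof clarify
    fix p x assume p: "p \<in> P" and "x \<in> J p"
    then obtain y where y: "y \<in> {p + \<delta>..p + g p - \<delta>}" and xy: "x = frac y"
      by (auto simp: J_def)
    define t where "t = y - p"
    have t: "\<delta> \<le> t" "t + \<delta> \<le> g p" "t < 1" using y \<delta> g_le(1)[of p] by (auto simp: t_def)
    have "\<delta> \<le> frac (x - q) \<and> frac (x - q) \<le> 1 - \<delta>" if q: "q \<in> P" for q
    proof (cases "q = p")
      case True
      have "frac (x - q) = t"
        using t \<delta> True by (intro frac_eqI[where k = "- \<lfloor>y\<rfloor>"]) (auto simp: t_def xy frac_def)
      then show ?thesis using t g_le(1)[of p] by auto
    next
      case False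
      define s where "s = frac (q - p)"
      have s: "g p \<le> s" "s < 1" using g_le(2)[of q p] q False by (auto simp: s_def frac_lt_1)
      have "frac (x - q) = 1 + t - s"
        using t s \<delta>
        by (intro frac_eqI[where k = "- \<lfloor>y\<rfloor> - \<lfloor>q - p\<rfloor> - 1"]) (auto simp: t_def s_def xy frac_def)
      then show ?thesis using t s by auto
    qed
    then show "x \<in> centres_avoided \<delta> P"
      using frac_in_unit[of y] by (auto simp: centres_avoided_def xy)
  qed
  ultimately have "centres_avoided \<delta> P = \<Union>(J ` P)" by auto
  moreover have "\<forall>A\<in>J ` P. arc_on_circle A"
    by (auto simp: J_def intro!: arc_on_circle_frac_image)
  ultimately show ?thesis
    using P(1) card_image_le[OF P(1), of J] by (intro exI[of _ "J ` P"]) auto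
qed

lemma centres_avoided_measurable[measurable]:
  assumes "finite P"
  shows "centres_avoided \<delta> P \<in> sets borel"
proof -
  have [measurable]: "(frac :: real \<Rightarrow> real) \<in> borel_measurable borel"
    unfolding frac_def by measurable
  have "centres_avoided \<delta> P = {0..<1} \<inter> (\<Inter>p\<in>P. {x. \<delta> \<le> frac (x - p) \<and> frac (x - p) \<le> 1 - \<delta>}) "
    by (auto simp: centres_avoided_def)
  also have "\<dots> \<in> sets borel"
    using assms by (cases "P = {}") (auto intro!: sets.Int sets.finite_INT)
  finally show ?thesis .
qed

text \<open>The excluded points of the fundamental domain are covered by intervals of length
  2\<delta> around each centre and around its translates by 1 and -1, which account for the gluing.
  This costs 6\<delta> per centre.\<close>

lemma measure_centres_avoided_ge:
  assumes P: "finite P" "P \<subseteq> {0..<1}" and \<delta>: "0 \<le> \<delta>"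
  shows "measure circle_measure (centres_avoided \<delta> P) \<ge> 1 - 6 * \<delta> * card P"
proof -
  have sub: "centres_avoided \<delta> P \<subseteq> {0..<1}" by (auto simp: centres_avoided_def)
  have m: "measure circle_measure (centres_avoided \<delta> P) = measure lborel (centres_avoided \<delta> P)"
    unfolding circle_measure_def using sub by (simp add: measure_restrict_space)
  define V where "V p = {p - \<delta>..p + \<delta>} \<union> {p - 1 - \<delta>..p - 1 + \<delta>} \<union> {p + 1 - \<delta>..p + 1 + \<delta>}" for p
  have V: "V p \<in> fmeasurable lborel" "measure lborel (V p) \<le> 6 * \<delta>" for p
  proof -
    show "V p \<in> fmeasurable lborel"
      unfolding V_def by (intro fmeasurable.Un fmeasurableI) (auto simp: emeasure_lborel_Icc_eq)
    have "measure lborel (V p) \<le> measure lborel ({p - \<delta>..p + \<delta>} \<union> {p - 1 - \<delta>..p - 1 + \<delta>})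
        + measure lborel {p + 1 - \<delta>..p + 1 + \<delta>}"
      unfolding V_def by (rule measure_Un_le) auto
    also have "measure lborel ({p - \<delta>..p + \<delta>} \<union> {p - 1 - \<delta>..p - 1 + \<delta>})
        \<le> measure lborel {p - \<delta>..p + \<delta>} + measure lborel {p - 1 - \<delta>..p - 1 + \<delta>}"
      by (rule measure_Un_le) auto
    finally show "measure lborel (V p) \<le> 6 * \<delta>" using \<delta> by simp
  qed
  have "{0..<1} \<subseteq> centres_avoided \<delta> P \<union> (\<Union>p\<in>P. V p)"
  proof
    fix x :: real assume x: "x \<in> {0..<1}"
    show "x \<in> centres_avoided \<delta> P \<union> (\<Union>p\<in>P. V p)"
    proof (cases "x \<in> centres_avoided \<delta> P")
      case False
      then obtain p where p: "p \<in> P" "\<not> (\<delta> \<le> frac (x - p) \<and> frac (x - p) \<le> 1 - \<delta>)"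
        using x by (auto simp: centres_avoided_def)
      have "0 \<le> p" "p < 1" using p P(2) by auto
      then have "0 \<le> x - p \<and> x - p < 1 \<and> frac (x - p) = x - p \<or>
          -1 < x - p \<and> x - p < 0 \<and> frac (x - p) = x - p + 1"
        using x by (cases "x < p") (auto simp: frac_unique_iff)
      then have "x \<in> V p"
        using p(2) \<delta> unfolding V_def by auto
      then show ?thesis using p by blast
    qed simp
  qed
  moreover have fm: "centres_avoided \<delta> P \<in> fmeasurable lborel"
    by (rule fmeasurableI2[of "{0..<1}"]) (use sub centres_avoided_measurable[OF P(1)] in \<open>auto intro: fmeasurableI\<close>)
  moreover have U: "(\<Union>p\<in>P. V p) \<in> fmeasurable lborel"
    using P(1) V(1) by (intro fmeasurable.finite_UN) auto
  ultimately have "measure lborel {0..<1::real} \<le>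
      measure lborel (centres_avoided \<delta> P \<union> (\<Union>p\<in>P. V p))"
    by (intro measure_mono_fmeasurable) (auto intro: fmeasurable.Un)
  also have "\<dots> \<le> measure lborel (centres_avoided \<delta> P) + measure lborel (\<Union>p\<in>P. V p)"
    using fm U by (intro measure_Un_le) auto
  also have "measure lborel (\<Union>p\<in>P. V p) \<le> (\<Sum>p\<in>P. measure lborel (V p))"
    using P(1) by (intro measure_UNION_le) (auto simp: V_def)
  also have "\<dots> \<le> (\<Sum>p\<in>P. 6 * \<delta>)" by (intro sum_mono V)
  finally show ?thesis by (simp add: m mult.commute)
qed

section \<open>Periodic functions and integration over a period\<close>

lemma periodic_of_int:
  fixes f :: "real \<Rightarrow> 'a"
  assumes "\<And>x. f (x + 1) = f x"
  shows "f (x + of_int k) = f x"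
proof (induction k rule: int_induct[where k = 0])
  case (step1 i)
  then show ?case using assms[of "x + of_int i"] by (simp add: algebra_simps)
next
  case (step2 i)
  then show ?case using assms[of "x + of_int (i - 1)"] by (simp add: algebra_simps)
qed simp

lemma periodic_frac:
  fixes f :: "real \<Rightarrow> 'a"
  assumes "\<And>x. f (x + 1) = f x"
  shows "f (frac x) = f x"
  using periodic_of_int[of f "frac x" "\<lfloor>x\<rfloor>"] assms by (simp add: frac_def)

text \<open>An integer shift replaces \<open>p\<close> by \<open>q = frac p\<close>; then the piece
  of the interval beyond 1 is moved back to \<open>{0..<q}\<close>.\<close>

lemma nn_integral_periodic_unit_interval:
  fixes f :: "real \<Rightarrow> ennreal"
  assumes f[measurable]: "f \<in> borel_measurable borel" and per: "\<And>x. f (x + 1) = f x"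
  shows "(\<integral>\<^sup>+y\<in>{p..<p + 1}. f y \<partial>lborel) = (\<integral>\<^sup>+y\<in>{0..<1}. f y \<partial>lborel)"
proof -
  have shift: "(\<integral>\<^sup>+y\<in>{u + of_int k..<v + of_int k}. f y \<partial>lborel) = (\<integral>\<^sup>+y\<in>{u..<v}. f y \<partial>lborel)"
    for u v :: real and k :: int
  proof -
    have "(\<integral>\<^sup>+y\<in>{u + of_int k..<v + of_int k}. f y \<partial>lborel)
        = (\<integral>\<^sup>+y. f (of_int k + 1 * y) * indicator {u + of_int k..<v + of_int k} (of_int k + 1 * y) \<partial>lborel)"
      by (subst nn_integral_real_affine[where c = 1 and t = "of_int k"]) auto
    also have "\<dots> = (\<integral>\<^sup>+y\<in>{u..<v}. f y \<partial>lborel)"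
      using periodic_of_int[of f, OF per]
      by (intro nn_integral_cong) (auto simp: indicator_def add.commute)
    finally show ?thesis .
  qed
  define q where "q = frac p"
  have q: "0 \<le> q" "q < 1" by (auto simp: q_def frac_lt_1)
  have split: "(\<integral>\<^sup>+y\<in>{u..<w}. f y \<partial>lborel) = (\<integral>\<^sup>+y\<in>{u..<v}. f y \<partial>lborel) + (\<integral>\<^sup>+y\<in>{v..<w}. f y \<partial>lborel)"
    if "u \<le> v" "v \<le> w" for u v w :: real
  proof -
    have "{u..<w} = {u..<v} \<union> {v..<w}" using that by auto
    then show ?thesis
      by (subst nn_integral_add[symmetric]) (auto intro!: nn_integral_cong simp: indicator_def)
  qed
  have "(\<integral>\<^sup>+y\<in>{p..<p + 1}. f y \<partial>lborel) = (\<integral>\<^sup>+y\<in>{q..<q + 1}. f y \<partial>lborel)"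
    using shift[of q "\<lfloor>p\<rfloor>" "q + 1"] by (simp add: q_def frac_def)
  also have "\<dots> = (\<integral>\<^sup>+y\<in>{q..<1}. f y \<partial>lborel) + (\<integral>\<^sup>+y\<in>{1..<q + 1}. f y \<partial>lborel)"
    using q by (intro split) auto
  also have "(\<integral>\<^sup>+y\<in>{1..<q + 1}. f y \<partial>lborel) = (\<integral>\<^sup>+y\<in>{0..<q}. f y \<partial>lborel)"
    using shift[of 0 1 q] by simp
  also have "(\<integral>\<^sup>+y\<in>{q..<1}. f y \<partial>lborel) + \<dots> = (\<integral>\<^sup>+y\<in>{0..<1}. f y \<partial>lborel)"
    using q split[of 0 q 1] by (simp add: add.commute)
  finally show ?thesis .
qed

lemma frac_measurable[measurable]: "(frac :: real \<Rightarrow> real) \<in> borel_measurable borel"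
  unfolding frac_def by measurable

lemma sets_circle_measure: "B \<in> sets circle_measure \<longleftrightarrow> B \<in> sets borel \<and> B \<subseteq> {0..<1}"
  unfolding circle_measure_def by (auto simp: sets_restrict_space_iff)

lemma emeasure_circle_measure:
  "B \<in> sets borel \<Longrightarrow> B \<subseteq> {0..<1} \<Longrightarrow> emeasure circle_measure B = emeasure lborel B"
  unfolding circle_measure_def by (simp add: emeasure_restrict_space)

lemma space_circle_measure: "space circle_measure = {0..<1}"
  by (simp add: circle_measure_def)

interpretation circle: prob_space circle_measure
  by standard (simp add: space_circle_measure emeasure_circle_measure)

text \<open>The base point \<open>p\<close> is free, so that a given arc can be made to lie inside
  one fundamental domain on the line.\<close>

lemma emeasure_circle_eq_unit_interval:
  assumes "B \<in> sets circle_measure"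
  shows "emeasure circle_measure B = (\<integral>\<^sup>+y\<in>{p..<p + 1}. indicator B (frac y) \<partial>lborel)"
proof -
  have B[measurable]: "B \<in> sets borel" "B \<subseteq> {0..<1}" using assms by (auto simp: sets_circle_measure)
  have "(\<integral>\<^sup>+y\<in>{p..<p + 1}. indicator B (frac y) \<partial>lborel) = (\<integral>\<^sup>+y\<in>{0..<1}. indicator B (frac y) \<partial>lborel)"
    by (rule nn_integral_periodic_unit_interval) (auto simp: frac_1_eq)
  also have "\<dots> = (\<integral>\<^sup>+y. indicator B y \<partial>lborel)"
    using B by (intro nn_integral_cong) (auto simp: indicator_def frac_unique_iff)
  finally show ?thesis using B by (simp add: emeasure_circle_measure)
qed

section \<open>Lower bound for the largest component\<close>

text \<open>The projection of \<open>{u..v}\<close> is connected in \<open>I_set \<psi> K L\<close>,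
  hence contained in one component. Being shorter than a full turn, it does not overlap itself, so
  the measure of the component is at least \<open>v - u\<close>.\<close>

lemma b_length_ge:
  assumes per: "\<And>x. deriv \<psi> (x + 1) = deriv \<psi> x" and cont: "continuous_on UNIV (deriv \<psi>)"
    and uv: "u \<le> v" "v - u < 1" and le: "\<And>x. x \<in> {u..v} \<Longrightarrow> \<bar>dtau \<psi> L x\<bar> \<le> K"
  shows "v - u \<le> b_length \<psi> K L"
proof -
  define I where "I = I_set \<psi> K L"
  have [measurable]: "deriv \<psi> \<in> borel_measurable borel"
    using cont by (intro borel_measurable_continuous_onI)
  have I: "I \<in> sets borel" "I \<subseteq> {0..<1}"
    unfolding I_def I_set_def dtau_def by (auto)
  have top: "topspace (subtopology circle_topology I) = I"
    using I by (auto simp: circle_topology_def topspace_pullback_topology)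
  have "frac ` {u..v} \<subseteq> I"
    using le frac_in_unit periodic_frac[of "deriv \<psi>", OF per] by (auto simp: I_def I_set_def dtau_def)
  then have "connectedin (subtopology circle_topology I) (frac ` {u..v})"
    using arc_on_circle_frac_image[of "{u..v}"]
    by (simp add: arc_on_circle_def connectedin_subtopology)
  moreover have "frac ` {u..v} \<noteq> {}" using uv by auto
  ultimately obtain C where C: "C \<in> connected_components_of (subtopology circle_topology I)"
      "frac ` {u..v} \<subseteq> C"
    using connected_component_of_maximal
    by (metis all_not_in_conv connected_component_in_connected_components_of connectedin_subset_topspace
        subset_iff)
  \<comment> \<open>The component has to be shown Borel, since \<open>measure\<close> has the value
    0 outside the sigma-algebra. It is relatively closed in the Borel set \<open>I\<close>.\<close>
  have "closedin (subtopology circle_topology I) C"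
    using C(1) by (rule closedin_connected_components_of)
  then obtain F where F: "closedin circle_topology F" "C = F \<inter> I"
    by (auto simp: closedin_subtopology)
  have "openin circle_topology ({0..<1} - F)"
    using F(1) by (auto simp: closedin_def circle_topology_def topspace_pullback_topology)
  then obtain U where U: "open U" "{0..<1} - F = (\<lambda>t. cis (2 * pi * t)) -` U \<inter> {0..<1}"
    unfolding circle_topology_def openin_pullback_topology by auto
  have "(\<lambda>t. cis (2 * pi * t)) -` U \<in> sets borel"
    using U(1) by (intro borel_open open_vimage continuous_intros) auto
  moreover have "C = I - (\<lambda>t. cis (2 * pi * t)) -` U"
    using F(2) U(2) I(2) by blast
  ultimately have Cm: "C \<in> sets circle_measure"
    using I by (auto simp: sets_circle_measure)
  have "ennreal (v - u) = (\<integral>\<^sup>+y. indicator {u..v} y \<partial>lborel)"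
    using uv by simp
  also have "\<dots> \<le> (\<integral>\<^sup>+y\<in>{u..<u + 1}. indicator C (frac y) \<partial>lborel)"
    using uv C(2) by (intro nn_integral_mono) (auto simp: indicator_def image_subset_iff)
  also have "\<dots> = ennreal (measure circle_measure C)"
    using emeasure_circle_eq_unit_interval[OF Cm, of u] by (simp add: circle.emeasure_eq_measure)
  finally have "v - u \<le> measure circle_measure C"
    by simp
  also have "\<dots> \<le> b_length \<psi> K L"
    unfolding b_length_def using C(1)
    by (intro cSUP_upper) (auto simp: I_def intro!: bdd_aboveI[of _ 1])
  finally show ?thesis .
qed

section \<open>Calculus of smooth periodic functions\<close>

text \<open>Written with \<open>min\<close> and \<open>max\<close> so that it applies to endpoints
  in either order, or equal, as they occur around a critical point.\<close>

lemma real_mean_value: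
  fixes f :: "real \<Rightarrow> real"
  assumes "\<And>x. (f has_real_derivative f' x) (at x)"
  shows "\<exists>\<xi>. min x y \<le> \<xi> \<and> \<xi> \<le> max x y \<and> f y - f x = f' \<xi> * (y - x)"
proof (cases x y rule: linorder_cases)
  case less
  with MVT2[of x y f f'] assms obtain z where "x < z" "z < y" "f y - f x = (y - x) * f' z" by auto
  with less show ?thesis by (intro exI[of _ z]) auto
next
  case greater
  with MVT2[of y x f f'] assms obtain z where "y < z" "z < x" "f x - f y = (x - y) * f' z" by auto
  with greater show ?thesis by (intro exI[of _ z]) (auto simp: algebra_simps)
qed auto

lemma continuous_periodic_bounded:
  fixes f :: "real \<Rightarrow> real"
  assumes cont: "continuous_on UNIV f" and per: "\<And>x. f (x + 1) = f x"
  shows "\<exists>K>0. \<forall>x. \<bar>f x\<bar> \<le> K"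
proof -
  have "compact (f ` {0..1})"
    using cont by (intro compact_continuous_image continuous_on_subset[OF cont]) auto
  then obtain K where K: "K > 0" "\<forall>y\<in>f ` {0..1}. norm y \<le> K"
    using compact_imp_bounded bounded_pos by metis
  have "\<bar>f x\<bar> \<le> K" for x
  proof -
    have "\<bar>f (frac x)\<bar> \<le> K" using K(2) frac_in_unit[of x] by auto
    then show ?thesis using periodic_frac[of f x] per by simp
  qed
  then show ?thesis using K(1) by blast
qed

lemma continuous_periodic_uniform:
  fixes f :: "real \<Rightarrow> real"
  assumes cont: "continuous_on UNIV f" and per: "\<And>x. f (x + 1) = f x" and e: "0 < e"
  shows "\<exists>d>0. \<forall>x y. \<bar>y - x\<bar> \<le> d \<longrightarrow> \<bar>f y - f x\<bar> \<le> e"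
proof -
  \<comment> \<open>After both points are shifted by the same integer, \<open>x\<close> lies in
    \<open>{0..<1}\<close> and \<open>y\<close> at distance at most 1 from it, hence the margin of 1
    on both sides.\<close>
  have "uniformly_continuous_on {-1..2} f"
    by (intro compact_uniformly_continuous continuous_on_subset[OF cont]) auto
  then obtain d where d: "d > 0"
    "\<And>x y. x \<in> {-1..2} \<Longrightarrow> y \<in> {-1..2} \<Longrightarrow> dist y x < d \<Longrightarrow> dist (f y) (f x) < e"
    using e unfolding uniformly_continuous_on_def by meson
  define d' where "d' = min (d / 2) 1"
  have "\<bar>f y - f x\<bar> \<le> e" if "\<bar>y - x\<bar> \<le> d'" for x y
  proof -
    let ?y = "y + of_int (- \<lfloor>x\<rfloor>)"
    have x: "0 \<le> frac x" "frac x < 1" by (simp_all add: frac_lt_1)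
    have yx: "\<bar>?y - frac x\<bar> \<le> 1" "\<bar>?y - frac x\<bar> < d"
      using that d(1) by (auto simp: d'_def frac_def)
    have "frac x \<in> {-1..2}" "?y \<in> {-1..2}" "dist ?y (frac x) < d"
      using x yx(2) abs_le_D1[OF yx(1)] abs_le_D2[OF yx(1)]
      by (simp_all only: dist_real_def atLeastAtMost_iff) linarith+
    then have "dist (f ?y) (f (frac x)) < e" by (intro d(2))
    then show ?thesis
      using periodic_frac[of f x] periodic_of_int[of f y "- \<lfloor>x\<rfloor>"] per by (simp add: dist_real_def)
  qed
  then show ?thesis using d(1) by (intro exI[of _ d']) (auto simp: d'_def)
qed

lemma C2_on_circle_simps:
  assumes "C2_on_circle \<psi>"
  shows "\<psi> (x + 1) = \<psi> x"
    and "(\<psi> has_real_derivative deriv \<psi> x) (at x)"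
    and "(deriv \<psi> has_real_derivative deriv (deriv \<psi>) x) (at x)"
    and "continuous_on UNIV \<psi>" "continuous_on UNIV (deriv \<psi>)" "continuous_on UNIV (deriv (deriv \<psi>))"
    and "deriv \<psi> (x + 1) = deriv \<psi> x" "deriv (deriv \<psi>) (x + 1) = deriv (deriv \<psi>) x"
proof -
  show per: "\<psi> (x + 1) = \<psi> x" for x using assms by (simp add: C2_on_circle_def)
  show d1: "(\<psi> has_real_derivative deriv \<psi> x) (at x)" for x
    using assms by (simp add: C2_on_circle_def DERIV_deriv_iff_real_differentiable)
  show d2: "(deriv \<psi> has_real_derivative deriv (deriv \<psi>) x) (at x)" for x
    using assms by (simp add: C2_on_circle_def DERIV_deriv_iff_real_differentiable)
  show "continuous_on UNIV \<psi>" "continuous_on UNIV (deriv \<psi>)"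
    using d1 d2 DERIV_isCont by (blast intro: continuous_at_imp_continuous_on)+
  show "continuous_on UNIV (deriv (deriv \<psi>))" using assms by (simp add: C2_on_circle_def)
  have shift: "deriv f (x + 1) = deriv f x"
    if "\<And>x. f (x + 1) = f x" "\<And>x. (f has_real_derivative deriv f x) (at x)" for f :: "real \<Rightarrow> real" and x
  proof -
    have "((\<lambda>x. f (x + 1)) has_real_derivative deriv f (x + 1)) (at x)"
      using that(2)[of "x + 1"] by (simp add: DERIV_shift)
    then show ?thesis using that DERIV_unique by (metis (no_types, lifting) ext)
  qed
  show p1: "deriv \<psi> (x + 1) = deriv \<psi> x" for x using shift per d1 by blast
  show "deriv (deriv \<psi>) (x + 1) = deriv (deriv \<psi>) x" using shift p1 d2 by blast
qed

section \<open>Quantitative nondegeneracy\<close>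

text \<open>The constants depend on \<psi> alone, which makes all later thresholds for
  \<open>L\<close> uniform in \<open>a\<close>. The points \<open>c\<close> range over all zeros of
  the derivative on the line, not only those in \<open>{0..<1}\<close>, so that distances can be
  measured on the line.\<close>

locale morse_circle =
  fixes \<psi> :: "real \<Rightarrow> real" and \<kappa> K r m :: real
  assumes C2: "C2_on_circle \<psi>"
    and fin: "finite (critical_points \<psi>)" and ne: "critical_points \<psi> \<noteq> {}"
    and pos: "0 < \<kappa>" "0 < K" "0 < r" "0 < m" and r_le: "r \<le> 1 / 10"
    and curvature: "\<And>c. deriv \<psi> c = 0 \<Longrightarrow> \<kappa> \<le> \<bar>deriv (deriv \<psi>) c\<bar>"
    and bounds: "\<And>x. \<bar>deriv \<psi> x\<bar> \<le> K" "\<And>x. \<bar>deriv (deriv \<psi>) x\<bar> \<le> K"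
    and near: "\<And>c y. deriv \<psi> c = 0 \<Longrightarrow> \<bar>y - c\<bar> \<le> 2 * r \<Longrightarrow>
        \<bar>deriv (deriv \<psi>) y - deriv (deriv \<psi>) c\<bar> \<le> \<bar>deriv (deriv \<psi>) c\<bar> / 10"
    and far: "\<And>x. \<bar>deriv \<psi> x\<bar> < m \<Longrightarrow> \<exists>c. deriv \<psi> c = 0 \<and> \<bar>x - c\<bar> < r"

text \<open>\<kappa> is a minimum over finitely many critical points, \<open>K\<close> comes from
  compactness, \<open>r\<close> from uniform continuity of the second derivative with tolerance
  \<kappa>/10, and \<open>m\<close> is the minimum of the modulus of the derivative on a compact set
  without zeros.\<close>

lemma morse_circle_exists:
  assumes C2: "C2_on_circle \<psi>"
    and fin: "finite (critical_points \<psi>)" and ne: "critical_points \<psi> \<noteq> {}"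
    and nondeg: "\<forall>c\<in>critical_points \<psi>. deriv (deriv \<psi>) c \<noteq> 0"
  shows "\<exists>\<kappa> K r m. morse_circle \<psi> \<kappa> K r m"
proof -
  note C2s = C2_on_circle_simps[OF C2]
  define \<kappa> where "\<kappa> = Min ((\<lambda>c. \<bar>deriv (deriv \<psi>) c\<bar>) ` critical_points \<psi>)"
  have \<kappa>: "\<kappa> > 0" using fin ne nondeg by (auto simp: \<kappa>_def)
  have curv: "\<kappa> \<le> \<bar>deriv (deriv \<psi>) c\<bar>" if "deriv \<psi> c = 0" for c
  proof -
    have "frac c \<in> critical_points \<psi>"
      using that frac_in_unit[of c] periodic_frac[of "deriv \<psi>" c] C2s(7) by (simp add: critical_points_def)
    then have "\<kappa> \<le> \<bar>deriv (deriv \<psi>) (frac c)\<bar>" using fin by (auto simp: \<kappa>_def)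
    then show ?thesis using periodic_frac[of "deriv (deriv \<psi>)" c] C2s(8) by simp
  qed
  obtain K1 where K1: "K1 > 0" "\<And>x. \<bar>deriv \<psi> x\<bar> \<le> K1"
    using continuous_periodic_bounded C2s(5,7) by blast
  obtain K2 where K2: "K2 > 0" "\<And>x. \<bar>deriv (deriv \<psi>) x\<bar> \<le> K2"
    using continuous_periodic_bounded C2s(6,8) by blast
  obtain d where d: "d > 0"
    "\<And>x y. \<bar>y - x\<bar> \<le> d \<Longrightarrow> \<bar>deriv (deriv \<psi>) y - deriv (deriv \<psi>) x\<bar> \<le> \<kappa> / 10"
    using continuous_periodic_uniform[OF C2s(6,8), of "\<kappa> / 10"] \<kappa> by auto
  define r where "r = min (d / 2) (1 / 10)"
  have r: "r > 0" "r \<le> 1 / 10" "2 * r \<le> d" using d(1) by (auto simp: r_def)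
  \<comment> \<open>The points of one period at distance at least \<open>r\<close> from every zero.
    An intersection of closed sets is closed, so the infinitely many zeros on the line do no
    harm.\<close>
  define S where "S = {0..1} \<inter> (\<Inter>c\<in>{c. deriv \<psi> c = 0}. {x. r \<le> \<bar>x - c\<bar>})"
  have "compact S"
    unfolding S_def by (intro compact_Int_closed closed_INT ballI closed_Collect_le continuous_intros) auto
  obtain m where m: "m > 0" "\<And>x. x \<in> S \<Longrightarrow> m \<le> \<bar>deriv \<psi> x\<bar>"
  proof (cases "S = {}")
    case False
    have "continuous_on S (\<lambda>x. \<bar>deriv \<psi> x\<bar>)"
      by (intro continuous_intros continuous_on_subset[OF C2s(5)]) auto
    then obtain z where z: "z \<in> S" "\<And>x. x \<in> S \<Longrightarrow> \<bar>deriv \<psi> z\<bar> \<le> \<bar>deriv \<psi> x\<bar>"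
      using continuous_attains_inf[OF \<open>compact S\<close> False] by blast
    have "deriv \<psi> z \<noteq> 0" using z(1) r(1) by (auto simp: S_def)
    then show ?thesis using z(2) by (intro that[of "\<bar>deriv \<psi> z\<bar>"]) auto
  qed (use that[of 1] in auto)
  have far: "\<exists>c. deriv \<psi> c = 0 \<and> \<bar>x - c\<bar> < r" if "\<bar>deriv \<psi> x\<bar> < m" for x
  proof -
    have "\<bar>deriv \<psi> (frac x)\<bar> < m" using that periodic_frac[of "deriv \<psi>" x] C2s(7) by simp
    then have "frac x \<notin> S" using m(2)[of "frac x"] by auto
    then obtain c where c: "deriv \<psi> c = 0" "\<bar>frac x - c\<bar> < r"
      using frac_in_unit[of x] by (auto simp: S_def not_le)
    then have "deriv \<psi> (c + of_int \<lfloor>x\<rfloor>) = 0" using periodic_of_int[of "deriv \<psi>" c] C2s(7) by simp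
    moreover have "\<bar>x - (c + of_int \<lfloor>x\<rfloor>)\<bar> < r" using c(2) by (simp add: frac_def algebra_simps)
    ultimately show ?thesis by blast
  qed
  have "morse_circle \<psi> \<kappa> (max K1 K2) r m"
  proof
    fix c y assume c: "deriv \<psi> c = 0" and "\<bar>y - c\<bar> \<le> 2 * r"
    then have "\<bar>deriv (deriv \<psi>) y - deriv (deriv \<psi>) c\<bar> \<le> \<kappa> / 10" using r by (intro d(2)) auto
    then show "\<bar>deriv (deriv \<psi>) y - deriv (deriv \<psi>) c\<bar> \<le> \<bar>deriv (deriv \<psi>) c\<bar> / 10"
      using curv[OF c] by simp
  qed (use C2 fin ne \<kappa> K1 K2 r m(1) far curv in \<open>auto intro: le_max_iff_disj[THEN iffD2]\<close>)
  then show ?thesis by blast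
qed

section \<open>Oscillation of the lift and the set of small derivative\<close>

context morse_circle
begin

lemmas C2s = C2_on_circle_simps[OF C2]

text \<open>The lift of \<open>tau \<psi> L a\<close> to the line. It has no jumps, and
  \<open>dtau\<close> is its actual derivative.\<close>

definition T :: "real \<Rightarrow> real \<Rightarrow> real \<Rightarrow> real" where
  "T L a x = a + x + L * \<psi> x"

lemma T_deriv: "(T L a has_real_derivative dtau \<psi> L x) (at x)"
  unfolding T_def[abs_def] dtau_def by (auto intro!: derivative_eq_intros C2s(2))

lemma dtau_deriv: "(dtau \<psi> L has_real_derivative L * deriv (deriv \<psi>) x) (at x)"
  unfolding dtau_def[abs_def] by (auto intro!: derivative_eq_intros C2s(3))

lemma critical_exists: "\<exists>c. deriv \<psi> c = 0"
  using ne by (auto simp: critical_points_def)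

lemma deriv_near_critical:
  assumes "deriv \<psi> c = 0" "\<bar>y - c\<bar> \<le> 2 * r"
  shows "\<exists>q. \<bar>q - deriv (deriv \<psi>) c\<bar> \<le> \<bar>deriv (deriv \<psi>) c\<bar> / 10 \<and> deriv \<psi> y = q * (y - c)"
proof -
  obtain z where "min c y \<le> z" "z \<le> max c y" "deriv \<psi> y - deriv \<psi> c = deriv (deriv \<psi>) z * (y - c)"
    using real_mean_value[of "deriv \<psi>" "deriv (deriv \<psi>)" c y] C2s(3) by blast
  moreover have "\<bar>z - c\<bar> \<le> 2 * r" using assms(2) calculation by (auto simp: min_def max_def split: if_splits)
  ultimately show ?thesis using near[OF assms(1), of z] assms(1) by auto
qed

text \<open>The condition defining \<open>I_set \<psi> 2 L\<close> reads
  \<open>-3 \<le> L * deriv \<psi> y \<le> 1\<close>. Near \<open>c\<close> the derivative of \<psi>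
  grows at most with slope 11/10 of its curvature at \<open>c\<close>, so the condition holds on an
  interval around \<open>c\<close> reaching \<open>3 / k\<close> to one side and
  \<open>1 / k\<close> to the other.\<close>

lemma b_length_ge_curvature:
  assumes c: "deriv \<psi> c = 0" and L: "0 < L" "4 \<le> L * \<kappa> * r"
  shows "4 / (11 / 10 * (L * \<bar>deriv (deriv \<psi>) c\<bar>)) \<le> b_length \<psi> 2 L"
proof -
  define k where "k = 11 / 10 * (L * \<bar>deriv (deriv \<psi>) c\<bar>)"
  define d where "d = 1 / k"
  have "L * \<kappa> \<le> L * \<bar>deriv (deriv \<psi>) c\<bar>" using curvature[OF c] L by simp
  moreover have "0 < L * \<kappa>" using L pos by simp
  ultimately have k: "k > 0" "L * \<kappa> \<le> k" by (auto simp: k_def)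
  have "4 \<le> k * r" using L(2) k(2) pos mult_right_mono[of "L * \<kappa>" k r] by linarith
  then have d: "0 < d" "4 * d \<le> r" using k by (auto simp: d_def field_simps)
  \<comment> \<open>One estimate for both sides of \<open>c\<close>: \<open>e\<close> is the
    distance to \<open>c\<close>, and \<open>q\<close> a mean value of the second derivative, with
    reversed sign to the left of \<open>c\<close>. The bound 1 matters only on the side where the
    product is positive, and there \<open>e \<le> d\<close>.\<close>
  have LQ: "L * q * e \<le> 3" "- 3 \<le> L * q * e"  "e \<le> 0 \<or> q \<le> 0 \<or> e \<le> d \<Longrightarrow> L * q * e \<le> 1"
    if "0 \<le> e" "e \<le> 3 * d" "\<bar>q\<bar> \<le> 11 / 10 * \<bar>deriv (deriv \<psi>) c\<bar>" for q e
  proof -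
    have Lq: "\<bar>L * q\<bar> \<le> k" using that(3) L by (simp add: k_def abs_mult)
    have "\<bar>L * q * e\<bar> \<le> k * (3 * d)"
      unfolding abs_mult[of "L * q"] using that(1,2) Lq k by (intro mult_mono) auto
    then show "L * q * e \<le> 3" "- 3 \<le> L * q * e" using k(1) by (auto simp: d_def)
    show "L * q * e \<le> 1" if h: "e \<le> 0 \<or> q \<le> 0 \<or> e \<le> d"
    proof (cases "e \<le> d")
      case True
      then have "\<bar>L * q * e\<bar> \<le> k * d"
        unfolding abs_mult[of "L * q"] using \<open>0 \<le> e\<close> Lq k by (intro mult_mono) auto
      then show ?thesis using k(1) by (auto simp: d_def)
    next
      case False
      then have "L * q * e \<le> 0" using h d(1) L \<open>0 \<le> e\<close> by (auto simp: mult_le_0_iff zero_le_mult_iff)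
      then show ?thesis by simp
    qed
  qed
  \<comment> \<open>The longer part, of length \<open>3 * d\<close>, lies on the side where the
    derivative of \<psi> is negative.\<close>
  define u v where "u = (if 0 < deriv (deriv \<psi>) c then c - 3 * d else c - d)" and "v = u + 4 * d"
  have "\<bar>dtau \<psi> L y\<bar> \<le> 2" if y: "y \<in> {u..v}" for y
  proof -
    have "\<bar>y - c\<bar> \<le> 2 * r" using y d by (auto simp: u_def v_def split: if_splits)
    then obtain q where q: "\<bar>q - deriv (deriv \<psi>) c\<bar> \<le> \<bar>deriv (deriv \<psi>) c\<bar> / 10" "deriv \<psi> y = q * (y - c)"
      using deriv_near_critical[OF c] by blast
    have q1: "\<bar>q\<bar> \<le> 11 / 10 * \<bar>deriv (deriv \<psi>) c\<bar>" using q(1) by linarith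
    have q2: "0 < deriv (deriv \<psi>) c \<Longrightarrow> 0 \<le> q" "\<not> 0 < deriv (deriv \<psi>) c \<Longrightarrow> q \<le> 0"
      using q(1) by linarith+
    have "- 3 \<le> L * deriv \<psi> y \<and> L * deriv \<psi> y \<le> 1"
    proof (cases "c \<le> y")
      case True
      then show ?thesis
        using LQ[of "y - c" q] q(2) q1 q2 y d(1) by (auto simp: u_def v_def mult.assoc split: if_splits)
    next
      case False
      have eq: "L * deriv \<psi> y = L * (- q) * (c - y)" unfolding q(2) by (simp add: algebra_simps)
      show ?thesis
        unfolding eq using LQ[of "c - y" "- q"] q1 q2 y d(1) False
        by (intro conjI) (simp_all add: u_def v_def split: if_splits)
    qed
    then show ?thesis by (auto simp: dtau_def)
  qed
  then have "v - u \<le> b_length \<psi> 2 L"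
    using d r_le by (intro b_length_ge C2s) (auto simp: v_def)
  then show ?thesis by (simp add: v_def d_def k_def)
qed

text \<open>If the derivative of \<psi> is never smaller than \<open>m\<close> in modulus, the mean
  value theorem between the endpoints suffices. Otherwise the whole interval lies within
  \<open>2 * r\<close> of a critical point; there the second difference of \<open>T\<close> with
  step \<open>l / 2\<close> is \<open>L\<close> times a second derivative of \<psi> times
  \<open>l\<^sup>2 / 4\<close>.\<close>

lemma oscillation_short:
  assumes l: "0 < l" "l \<le> r" and L: "0 < L"
  shows "\<exists>u\<in>{p..p + l}. \<exists>v\<in>{p..p + l}. (L * m - 1) * l \<le> T L a v - T L a u \<or>
           (\<exists>c. deriv \<psi> c = 0 \<and> 9 / 80 * (L * \<bar>deriv (deriv \<psi>) c\<bar>) * l\<^sup>2 \<le> T L a v - T L a u)"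
proof (cases "\<exists>x\<in>{p..p + l}. \<bar>deriv \<psi> x\<bar> < m")
  case True
  then obtain x c where x: "x \<in> {p..p + l}" and c: "deriv \<psi> c = 0" "\<bar>x - c\<bar> < r"
    using far by blast
  define h where "h = l / 2"
  define D where "D = L * \<bar>deriv (deriv \<psi>) c\<bar>"
  have h: "h > 0" using l by (simp add: h_def)
  define g where "g t = T L a (t + h) - T L a t" for t
  have "(g has_real_derivative dtau \<psi> L (t + h) - dtau \<psi> L t) (at t)" for t
    unfolding g_def by (intro derivative_intros T_deriv DERIV_shift[THEN iffD1])
  then obtain z where z: "min p (p + h) \<le> z" "z \<le> max p (p + h)"
      "g (p + h) - g p = (dtau \<psi> L (z + h) - dtau \<psi> L z) * (p + h - p)"
    using real_mean_value[of g "\<lambda>t. dtau \<psi> L (t + h) - dtau \<psi> L t" p "p + h"] by blast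
  obtain w where w: "min z (z + h) \<le> w" "w \<le> max z (z + h)"
      "dtau \<psi> L (z + h) - dtau \<psi> L z = L * deriv (deriv \<psi>) w * (z + h - z)"
    using real_mean_value[of "dtau \<psi> L" "\<lambda>x. L * deriv (deriv \<psi>) x" z "z + h"] dtau_deriv by blast
  have "w \<in> {p..p + l}" using z w h by (auto simp: h_def)
  then have "\<bar>w - c\<bar> \<le> 2 * r" using x c(2) l by auto
  then have "\<bar>deriv (deriv \<psi>) w\<bar> \<ge> 9 / 10 * \<bar>deriv (deriv \<psi>) c\<bar>" using near[OF c(1), of w] by linarith
  then have "9 / 10 * D \<le> \<bar>L * deriv (deriv \<psi>) w\<bar>" using L by (simp add: D_def abs_mult)
  then have "9 / 10 * D * h\<^sup>2 \<le> \<bar>L * deriv (deriv \<psi>) w\<bar> * h\<^sup>2" by (intro mult_right_mono) auto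
  also have "\<dots> = \<bar>g (p + h) - g p\<bar>"
    using z w h by (simp add: abs_mult power2_eq_square)
  also have "\<dots> = \<bar>(T L a (p + l) - T L a (p + h)) + (T L a p - T L a (p + h))\<bar>"
    by (simp add: g_def h_def add.commute)
  finally have "9 / 10 * D * h\<^sup>2 \<le> \<bar>(T L a (p + l) - T L a (p + h)) + (T L a p - T L a (p + h))\<bar>" .
  \<comment> \<open>The second difference is a sum of two first differences, so one of them has at
    least half its modulus. This gives the factor 9/10 * 1/4 * 1/2 = 9/80.\<close>
  moreover have "9 / 10 * D * h\<^sup>2 = 2 * (9 / 80 * D * l\<^sup>2)"
    by (simp add: h_def power2_eq_square)
  moreover have "p \<in> {p..p + l}" "p + l \<in> {p..p + l}" "p + h \<in> {p..p + l}" using l by (auto simp: h_def)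
  ultimately obtain u v where "u \<in> {p..p + l}" "v \<in> {p..p + l}" "9 / 80 * D * l\<^sup>2 \<le> T L a v - T L a u"
    by (smt (verit, ccfv_threshold))
  then show ?thesis using c(1) unfolding D_def by blast
next
  case False
  obtain z where z: "min p (p + l) \<le> z" "z \<le> max p (p + l)"
      "T L a (p + l) - T L a p = dtau \<psi> L z * (p + l - p)"
    using real_mean_value[of "T L a" "dtau \<psi> L" p "p + l"] T_deriv by blast
  have "m \<le> \<bar>deriv \<psi> z\<bar>" using False z l by (force simp: not_less)
  then have "L * m \<le> \<bar>L * deriv \<psi> z\<bar>" using L by (simp add: abs_mult)
  then have "L * m - 1 \<le> \<bar>dtau \<psi> L z\<bar>" by (auto simp: dtau_def)
  then have "(L * m - 1) * l \<le> \<bar>T L a (p + l) - T L a p\<bar>" using z l by (simp add: abs_mult)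
  moreover have "p \<in> {p..p + l}" "p + l \<in> {p..p + l}" using l by auto
  ultimately show ?thesis
    by (smt (verit, ccfv_threshold))
qed

text \<open>The quadratic lower bound is weaker than linear growth only for short intervals, and
  there the noise compensates: \<open>k * \<epsilon>\<close> exceeds 20/11 by
  \<open>b_length_ge_curvature\<close>, where \<open>k\<close> is \<open>L\<close> times the
  curvature. For \<open>l > r\<close> a subinterval of length \<open>r\<close> already oscillates by
  1.\<close>

lemma oscillation:
  assumes l: "0 < l" and L: "0 < L" "4 \<le> L * \<kappa> * r" "9 \<le> L * \<kappa> * r\<^sup>2" "3 \<le> L * m" "2 \<le> L * m * r"
    and \<epsilon>: "b_length \<psi> 2 L / 2 < \<epsilon>"
  shows "\<exists>u\<in>{p..p + l}. \<exists>v\<in>{p..p + l}. min 1 (6 / 5 * l - 19 / 10 * \<epsilon>) \<le> T L a v - T L a u"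
proof -
  have curv: "L * \<kappa> \<le> L * \<bar>deriv (deriv \<psi>) c\<bar>" if "deriv \<psi> c = 0" for c
    using curvature[OF that] L by simp
  have k0: "0 < L * \<kappa>" using L pos by simp
  have "0 < \<epsilon>"
  proof -
    obtain c where c: "deriv \<psi> c = 0" using critical_exists by blast
    have "0 < 4 / (11 / 10 * (L * \<bar>deriv (deriv \<psi>) c\<bar>))" using curv[OF c] k0 by simp
    then show ?thesis using b_length_ge_curvature[OF c L(1,2)] \<epsilon> by linarith
  qed
  show ?thesis
  proof (cases "l \<le> r")
    case True
    have "6 / 5 * l - 19 / 10 * \<epsilon> \<le> 9 / 80 * (L * \<bar>deriv (deriv \<psi>) c\<bar>) * l\<^sup>2" if c: "deriv \<psi> c = 0" for c
    proof -
      define k where "k = L * \<bar>deriv (deriv \<psi>) c\<bar>"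
      have k: "k > 0" using curv[OF c] k0 by (simp add: k_def)
      have "4 / (11 / 10 * k) < 2 * \<epsilon>" using b_length_ge_curvature[OF c L(1,2)] \<epsilon> by (simp add: k_def)
      then have "4 < 11 / 5 * (k * \<epsilon>)" using k by (simp add: field_simps)
      \<comment> \<open>Tangent line of the parabola with slope 6/5, which touches at
        \<open>k * l = 16 / 3\<close>. The constant 16/5 is below 19/10 * 20/11.\<close>
      moreover have "0 \<le> 9 / 80 * (k * l - 16 / 3)\<^sup>2" by simp
      then have "6 / 5 * (k * l) - 16 / 5 \<le> 9 / 80 * (k * l)\<^sup>2"
        by (simp add: power2_eq_square algebra_simps)
      ultimately have "6 / 5 * (k * l) - 19 / 10 * (k * \<epsilon>) \<le> 9 / 80 * (k * l)\<^sup>2" by linarith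
      then have "k * (6 / 5 * l - 19 / 10 * \<epsilon>) \<le> k * (9 / 80 * k * l\<^sup>2)"
        by (simp add: power2_eq_square algebra_simps)
      then show ?thesis using k unfolding k_def by (simp only: mult_le_cancel_left_pos)
    qed
    moreover have "2 * l \<le> (L * m - 1) * l"
      using L l by (intro mult_right_mono) auto
    then have "6 / 5 * l - 19 / 10 * \<epsilon> \<le> (L * m - 1) * l"
      using l \<open>0 < \<epsilon>\<close> by linarith
    ultimately show ?thesis
      using oscillation_short[OF l True L(1), of p a] by (meson min.coboundedI2 order_trans)
  next
    case False
    have "1 \<le> (L * m - 1) * r"
    proof -
      have "1 / 2 * (L * m) \<le> L * m - 1" using L by simp
      then have "1 / 2 * (L * m) * r \<le> (L * m - 1) * r" using pos by (intro mult_right_mono) auto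
      then show ?thesis using L by simp
    qed
    moreover have "1 \<le> 9 / 80 * (L * \<bar>deriv (deriv \<psi>) c\<bar>) * r\<^sup>2" if "deriv \<psi> c = 0" for c
      using mult_right_mono[OF curv[OF that] zero_le_power2[of r]] L(3) by linarith
    moreover have "{p..p + r} \<subseteq> {p..p + l}" using False by auto
    ultimately show ?thesis
      using oscillation_short[OF pos(3) order_refl L(1), of p a]
      by (meson min.coboundedI1 order_trans subsetD)
  qed
qed

text \<open>Cut the period into pieces of length \<open>r\<close>. If \<open>s / L\<close> is small,
  a piece meeting the set lies within \<open>2 * r\<close> of a critical point, where
  \<open>dtau\<close> has slope at least \<open>9 / 10 * \<kappa> * L\<close> in modulus; so the set
  has width of order \<open>s / L\<close> in each piece. If \<open>s / L\<close> is not small, total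
  mass 1 is a sufficient bound.\<close>

lemma measure_small_dtau:
  "\<exists>C>0. \<forall>L s. 0 < L \<longrightarrow> 4 \<le> L * m \<longrightarrow> 0 \<le> s \<longrightarrow>
      emeasure lborel {x \<in> {0..<1}. \<bar>dtau \<psi> L x\<bar> \<le> s} \<le> ennreal (C * s / L)"
proof -
  define n where "n = nat \<lceil>1 / r\<rceil>"
  define C where "C = real n * (4 / (9 / 10 * \<kappa>)) + 2 / m"
  have C: "C > 0" "2 / m \<le> C" "real n * (4 / (9 / 10 * \<kappa>)) \<le> C"
    using pos by (auto simp: C_def add_nonneg_pos)
  have "emeasure lborel {x \<in> {0..<1}. \<bar>dtau \<psi> L x\<bar> \<le> s} \<le> ennreal (C * s / L)"
    if L: "0 < L" "4 \<le> L * m" and s: "0 \<le> s" for L s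
  proof (cases "m / 2 \<le> s / L")
    case True
    have "emeasure lborel {x \<in> {0..<1}. \<bar>dtau \<psi> L x\<bar> \<le> s} \<le> emeasure lborel {0..<1::real}"
      by (intro emeasure_mono) auto
    also have "\<dots> = ennreal (2 / m * (m / 2))" using pos by simp
    also have "\<dots> \<le> ennreal (C * (s / L))"
      using True C pos s L by (intro ennreal_leI mult_mono) auto
    finally show ?thesis by simp
  next
    case False
    define w where "w = 2 * s / (9 / 10 * \<kappa> * L)"
    have w: "w \<ge> 0" using s L pos by (simp add: w_def)
    define S where "S = {x \<in> {0..<1}. \<bar>dtau \<psi> L x\<bar> \<le> s}"
    have S_m: "S \<in> sets borel"
      unfolding S_def dtau_def using C2s(5)[THEN borel_measurable_continuous_onI] by measurable
    have piece: "emeasure lborel (S \<inter> {p..p + r}) \<le> ennreal (2 * w)" for p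
    proof (cases "S \<inter> {p..p + r} = {}")
      case False
      then obtain x where x: "x \<in> S" "x \<in> {p..p + r}" by blast
      have "\<bar>L * deriv \<psi> x\<bar> \<le> s + 1" using x(1) by (auto simp: S_def dtau_def)
      also have "\<dots> < L * m" using \<open>\<not> m / 2 \<le> s / L\<close> L by (auto simp: field_simps)
      finally have "\<bar>deriv \<psi> x\<bar> < m" using L by (simp add: abs_mult)
      then obtain c where c: "deriv \<psi> c = 0" "\<bar>x - c\<bar> < r" using far by blast
      have "S \<inter> {p..p + r} \<subseteq> {x - w..x + w}"
      proof
        \<comment> \<open>Two points of the set in the same piece have values of \<open>dtau\<close>
          differing by at most \<open>2 * s\<close>, and the mean value theorem bounds their
          distance.\<close>
        fix y assume y: "y \<in> S \<inter> {p..p + r}"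
        obtain z where z: "min x y \<le> z" "z \<le> max x y"
            "dtau \<psi> L y - dtau \<psi> L x = L * deriv (deriv \<psi>) z * (y - x)"
          using real_mean_value[of "dtau \<psi> L" "\<lambda>x. L * deriv (deriv \<psi>) x" x y] dtau_deriv by blast
        have "\<bar>z - c\<bar> \<le> 2 * r" using z x y c by auto
        then have "\<kappa> * (9 / 10) \<le> \<bar>deriv (deriv \<psi>) z\<bar>"
          using near[OF c(1), of z] curvature[OF c(1)] by linarith
        then have "L * (\<kappa> * (9 / 10)) * \<bar>y - x\<bar> \<le> L * \<bar>deriv (deriv \<psi>) z\<bar> * \<bar>y - x\<bar>"
          using L by (intro mult_right_mono mult_left_mono) auto
        also have "\<dots> = \<bar>dtau \<psi> L y - dtau \<psi> L x\<bar>" using z L by (simp add: abs_mult)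
        also have "\<dots> \<le> 2 * s" using x y by (auto simp: S_def)
        finally have "\<bar>y - x\<bar> \<le> w"
          using L pos by (simp add: w_def field_simps)
        then show "y \<in> {x - w..x + w}" by auto
      qed
      then have "emeasure lborel (S \<inter> {p..p + r}) \<le> emeasure lborel {x - w..x + w}"
        by (intro emeasure_mono) auto
      also have "\<dots> = ennreal (2 * w)" using w by simp
      finally show ?thesis .
    qed simp
    have "S \<subseteq> (\<Union>i<n. S \<inter> {real i * r..real i * r + r})"
    proof
      fix x assume x: "x \<in> S"
      then have x01: "0 \<le> x" "x < 1" by (auto simp: S_def)
      define i where "i = nat \<lfloor>x / r\<rfloor>"
      have i: "real i = of_int \<lfloor>x / r\<rfloor>" using x01 pos by (simp add: i_def)
      have "real i \<le> x / r" "x / r < real i + 1" using i by linarith+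
      then have "real i * r \<le> x" "x \<le> real i * r + r" using pos by (auto simp: field_simps)
      moreover have "i < n"
      proof -
        have "real i \<le> x / r" using i by linarith
        also have "\<dots> < 1 / r" using x01 pos by (simp add: divide_strict_right_mono)
        also have "\<dots> \<le> real n" using pos unfolding n_def by (simp add: real_nat_ceiling_ge)
        finally show ?thesis by simp
      qed
      ultimately show "x \<in> (\<Union>i<n. S \<inter> {real i * r..real i * r + r})" using x by auto
    qed
    then have "emeasure lborel S \<le> emeasure lborel (\<Union>i<n. S \<inter> {real i * r..real i * r + r})"
      using S_m by (intro emeasure_mono) auto
    also have "\<dots> \<le> (\<Sum>i<n. emeasure lborel (S \<inter> {real i * r..real i * r + r}))"
      using S_m by (intro emeasure_subadditive_finite) auto
    also have "\<dots> \<le> (\<Sum>i<n. ennreal (2 * w))" by (intro sum_mono piece)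
    also have "\<dots> = ennreal (real n * (2 * w))"
      using w by (simp add: ennreal_mult' ennreal_of_nat_eq_real_of_nat)
    also have "real n * (2 * w) = real n * (4 / (9 / 10 * \<kappa>)) * (s / L)" by (simp add: w_def)
    also have "ennreal \<dots> \<le> ennreal (C * (s / L))"
      using C s L by (intro ennreal_leI mult_right_mono) auto
    finally show ?thesis by (simp add: S_def)
  qed
  then show ?thesis using C(1) by blast
qed

end

section \<open>Bounded Borel functions on the circle\<close>

definition circle_fun :: "(real \<Rightarrow> real) \<Rightarrow> bool" where
  "circle_fun f \<longleftrightarrow> f \<in> borel_measurable borel \<and> (\<forall>x. f (x + 1) = f x) \<and> (\<exists>C. \<forall>x. \<bar>f x\<bar> \<le> C)"

lemma circle_funI:
  "f \<in> borel_measurable borel \<Longrightarrow> (\<And>x. f (x + 1) = f x) \<Longrightarrow> (\<And>x. \<bar>f x\<bar> \<le> C) \<Longrightarrow> circle_fun f"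
  by (auto simp: circle_fun_def)

lemma circle_fun_measurable[measurable_dest]: "circle_fun f \<Longrightarrow> f \<in> borel_measurable borel"
  by (simp add: circle_fun_def)

lemma circle_fun_bounded: "circle_fun f \<Longrightarrow> \<exists>C. \<forall>x. \<bar>f x\<bar> \<le> C"
  by (simp add: circle_fun_def)

lemma circle_fun_frac: "circle_fun f \<Longrightarrow> f (frac x) = f x"
  by (intro periodic_frac) (simp add: circle_fun_def)

lemma circle_fun_const: "circle_fun (\<lambda>x. c)"
  by (auto simp: circle_fun_def)

lemma circle_fun_cmult: assumes "circle_fun f" shows "circle_fun (\<lambda>x. c * f x)"
proof -
  obtain C where "\<And>x. \<bar>f x\<bar> \<le> C" using circle_fun_bounded[OF assms] by blast
  then show ?thesis
    using assms
    by (intro circle_funI[where C = "\<bar>c\<bar> * C"]) (auto simp: circle_fun_def abs_mult mult_left_mono)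
qed

lemma circle_fun_add: assumes "circle_fun f" "circle_fun g" shows "circle_fun (\<lambda>x. f x + g x)"
proof -
  obtain C D where "\<And>x. \<bar>f x\<bar> \<le> C" "\<And>x. \<bar>g x\<bar> \<le> D"
    using circle_fun_bounded[OF assms(1)] circle_fun_bounded[OF assms(2)] by blast
  then have "\<bar>f x + g x\<bar> \<le> C + D" for x by (meson abs_triangle_ineq add_mono order_trans)
  then show ?thesis using assms by (intro circle_funI[where C = "C + D"]) (auto simp: circle_fun_def)
qed

lemma circle_fun_sum: "finite I \<Longrightarrow> (\<And>i. i \<in> I \<Longrightarrow> circle_fun (f i)) \<Longrightarrow> circle_fun (\<lambda>x. \<Sum>i\<in>I. f i x)"
  by (induction I rule: finite_induct) (auto intro: circle_fun_const circle_fun_add)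

text \<open>The periodic extension of the indicator, which lets sets be tested by functions on the
  line.\<close>

definition on_circle :: "real set \<Rightarrow> real \<Rightarrow> real" where
  "on_circle E x = indicator E (frac x)"

lemma circle_fun_on_circle: "E \<in> sets circle_measure \<Longrightarrow> circle_fun (on_circle E)"
  unfolding on_circle_def[abs_def]
  by (intro circle_funI[where C = 1]) (auto simp: frac_1_eq sets_circle_measure indicator_def)

lemma on_circle_eq: "E \<in> sets circle_measure \<Longrightarrow> x \<in> {0..<1} \<Longrightarrow> on_circle E x = indicator E x"
  by (simp add: on_circle_def frac_unique_iff indicator_def)

lemma nn_integral_circle_measure:
  "f \<in> borel_measurable borel \<Longrightarrow> (\<integral>\<^sup>+x. f x \<partial>circle_measure) = (\<integral>\<^sup>+x\<in>{0..<1}. f x \<partial>lborel)"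
  unfolding circle_measure_def by (subst nn_integral_restrict_space) auto

lemma measurable_circle: "f \<in> borel_measurable borel \<Longrightarrow> f \<in> borel_measurable circle_measure"
  unfolding circle_measure_def by (auto intro: measurable_restrict_space1)

lemma integrable_circle_fun:
  assumes "circle_fun f" and M: "finite_measure M" "sets M = sets circle_measure \<or> sets M = sets borel"
    and g: "g \<in> borel_measurable M"
  shows "integrable M (\<lambda>x. f (g x))"
proof -
  obtain C where C: "\<And>x. \<bar>f x\<bar> \<le> C" using circle_fun_bounded[OF assms(1)] by blast
  have "(\<lambda>x. f (g x)) \<in> borel_measurable M"
    using circle_fun_measurable[OF assms(1)] g by (rule measurable_compose_rev)
  then show ?thesis
    using C by (intro finite_measure.integrable_const_bound[OF M(1), where B = C]) auto
qed

section \<open>The transition operator of a noisy circle map\<close>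

locale noisy_circle_map =
  fixes T :: "real \<Rightarrow> real" and \<epsilon> \<Lambda> :: real
  assumes T_shift: "T (x + 1) = T x + 1"
    and T_lipschitz: "\<bar>T y - T x\<bar> \<le> \<Lambda> * \<bar>y - x\<bar>"
    and \<Lambda>_pos: "0 < \<Lambda>" and \<epsilon>_pos: "0 < \<epsilon>"
begin

lemma T_continuous: "continuous_on S T"
proof -
  have "\<Lambda>-lipschitz_on UNIV T"
    using T_lipschitz \<Lambda>_pos by (intro lipschitz_onI) (auto simp: dist_real_def)
  then show ?thesis using lipschitz_on_continuous_on continuous_on_subset by blast
qed

lemma T_measurable[measurable]: "T \<in> borel_measurable borel"
  by (intro borel_measurable_continuous_onI T_continuous)

lemma noise_sets[measurable_cong, simp]: "sets (noise \<epsilon>) = sets borel"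
  by (simp add: noise_def)

lemma noise_space[simp]: "space (noise \<epsilon>) = UNIV"
  by (simp add: noise_def)

sublocale noise: prob_space "noise \<epsilon>"
  unfolding noise_def using \<epsilon>_pos by (intro prob_space_uniform_measure) auto

lemma nn_integral_noise:
  assumes [measurable]: "f \<in> borel_measurable borel"
  shows "(\<integral>\<^sup>+\<omega>. f (t + \<omega>) \<partial>noise \<epsilon>) = (\<integral>\<^sup>+y\<in>{t - \<epsilon>..t + \<epsilon>}. f y \<partial>lborel) / ennreal (2 * \<epsilon>)"
proof -
  have "(\<integral>\<^sup>+\<omega>. f (t + \<omega>) \<partial>noise \<epsilon>)
      = (\<integral>\<^sup>+\<omega>\<in>{-\<epsilon>..\<epsilon>}. f (t + \<omega>) \<partial>lborel) / emeasure lborel {-\<epsilon>..\<epsilon>}"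
    unfolding noise_def by (subst nn_integral_uniform_measure) auto
  also have "emeasure lborel {-\<epsilon>..\<epsilon>} = ennreal (2 * \<epsilon>)" using \<epsilon>_pos by simp
  also have "(\<integral>\<^sup>+\<omega>\<in>{-\<epsilon>..\<epsilon>}. f (t + \<omega>) \<partial>lborel)
      = (\<integral>\<^sup>+\<omega>. f (t + 1 * \<omega>) * indicator {t - \<epsilon>..t + \<epsilon>} (t + 1 * \<omega>) \<partial>lborel)"
    by (intro nn_integral_cong) (auto simp: indicator_def)
  also have "\<dots> = (\<integral>\<^sup>+y\<in>{t - \<epsilon>..t + \<epsilon>}. f y \<partial>lborel)"
    by (subst nn_integral_real_affine[where c = 1 and t = t]) auto
  finally show ?thesis .
qed

text \<open>The Markov operator of the random map: the expected value of \<open>f\<close> after one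
  step from \<open>x\<close>. The variant \<open>Unn\<close> for nonnegative functions permits
  Tonelli arguments without integrability conditions; \<open>ennreal_U\<close> connects the
  two.\<close>

definition U :: "(real \<Rightarrow> real) \<Rightarrow> real \<Rightarrow> real" where
  "U f x = (\<integral>\<omega>. f (T x + \<omega>) \<partial>noise \<epsilon>)"

definition Unn :: "(real \<Rightarrow> ennreal) \<Rightarrow> real \<Rightarrow> ennreal" where
  "Unn f x = (\<integral>\<^sup>+\<omega>. f (T x + \<omega>) \<partial>noise \<epsilon>)"

lemma Unn_measurable[measurable]:
  assumes [measurable]: "f \<in> borel_measurable borel"
  shows "Unn f \<in> borel_measurable borel"
  unfolding Unn_def[abs_def] by (intro noise.borel_measurable_nn_integral) simp

lemma U_integrable: "circle_fun f \<Longrightarrow> integrable (noise \<epsilon>) (\<lambda>\<omega>. f (t + \<omega>))"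
  by (rule integrable_circle_fun) (auto intro: noise.finite_measure_axioms)

lemma U_add: "circle_fun f \<Longrightarrow> circle_fun g \<Longrightarrow> U (\<lambda>x. f x + g x) = (\<lambda>x. U f x + U g x)"
  by (rule ext) (simp add: U_def U_integrable)

lemma U_cmult: "U (\<lambda>x. c * f x) = (\<lambda>x. c * U f x)"
  by (rule ext) (simp add: U_def)

lemma U_const: "U (\<lambda>x. c) = (\<lambda>x. c)"
  using noise.prob_space by (intro ext) (simp add: U_def)

lemma U_mono: "circle_fun f \<Longrightarrow> circle_fun g \<Longrightarrow> (\<And>x. f x \<le> g x) \<Longrightarrow> U f x \<le> U g x"
  unfolding U_def by (intro integral_mono U_integrable)

lemma circle_fun_U:
  assumes f: "circle_fun f" shows "circle_fun (U f)"
proof -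
  note [measurable] = circle_fun_measurable[OF f]
  obtain C where C: "\<And>x. \<bar>f x\<bar> \<le> C" using circle_fun_bounded[OF f] by blast
  have "\<bar>U f x\<bar> \<le> C" for x
  proof -
    have "\<And>x. f x \<le> C" "\<And>x. - C \<le> f x" using C by (auto simp: abs_le_iff minus_le_iff)
    then show ?thesis
      using U_mono[of f "\<lambda>x. C" x] U_mono[of "\<lambda>x. - C" f x] f circle_fun_const
      by (auto simp: U_const abs_le_iff)
  qed
  moreover have "U f (x + 1) = U f x" for x
  proof -
    have "f (T x + 1 + \<omega>) = f (T x + \<omega>)" for \<omega>
      using f unfolding circle_fun_def by (metis add.assoc add.commute)
    then show ?thesis by (simp add: U_def T_shift)
  qed
  moreover have "U f \<in> borel_measurable borel"
    unfolding U_def[abs_def] by (intro noise.borel_measurable_lebesgue_integral) simp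
  ultimately show ?thesis by (intro circle_funI)
qed

lemma circle_fun_funpow: "circle_fun f \<Longrightarrow> circle_fun ((U ^^ n) f)"
  by (induction n) (auto intro: circle_fun_U)

lemma ennreal_U: "circle_fun f \<Longrightarrow> (\<And>x. 0 \<le> f x) \<Longrightarrow> ennreal (U f x) = Unn (\<lambda>x. ennreal (f x)) x"
  unfolding U_def Unn_def by (subst nn_integral_eq_integral) (auto intro: U_integrable)

lemma U_funpow_bounds:
  assumes "circle_fun f" "\<And>x. \<alpha> \<le> f x" "\<And>x. f x \<le> \<beta>"
  shows "\<alpha> \<le> (U ^^ n) f x \<and> (U ^^ n) f x \<le> \<beta>"
proof (induction n arbitrary: x)
  case (Suc n)
  then show ?case
    using U_mono[of "\<lambda>x. \<alpha>" "(U ^^ n) f" x] U_mono[of "(U ^^ n) f" "\<lambda>x. \<beta>" x]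
      circle_fun_funpow[OF assms(1)] circle_fun_const by (simp add: U_const)
qed (use assms in auto)

lemma U_funpow_add:
  assumes "circle_fun f" "circle_fun g"
  shows "(U ^^ n) (\<lambda>x. f x + g x) = (\<lambda>x. (U ^^ n) f x + (U ^^ n) g x)"
  by (induction n) (auto simp: U_add circle_fun_funpow assms)

lemma U_funpow_cmult: "(U ^^ n) (\<lambda>x. c * f x) = (\<lambda>x. c * (U ^^ n) f x)"
  by (induction n) (auto simp: U_cmult)

lemma U_funpow_const: "(U ^^ n) (\<lambda>x. c) = (\<lambda>x. c)"
  by (induction n) (auto simp: U_const)

lemma ennreal_U_funpow:
  assumes "circle_fun f" "\<And>x. 0 \<le> f x"
  shows "(\<lambda>x. ennreal ((U ^^ n) f x)) = (Unn ^^ n) (\<lambda>x. ennreal (f x))"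
proof (induction n)
  case (Suc n)
  have "0 \<le> (U ^^ n) f x" for x
    using U_funpow_bounds[of f 0] assms circle_fun_bounded[OF assms(1)]
    by (meson abs_le_D1)
  then show ?case
    using Suc by (auto simp: ennreal_U circle_fun_funpow assms)
qed simp

definition dens_bound :: real where "dens_bound = 1 + 1 / (2 * \<epsilon>)"

lemma nn_integral_periodic_interval:
  fixes F :: "real \<Rightarrow> ennreal"
  assumes [measurable]: "F \<in> borel_measurable borel" and per: "\<And>x. F (x + 1) = F x"
  shows "(\<integral>\<^sup>+y\<in>{p..<p + real n}. F y \<partial>lborel) = of_nat n * (\<integral>\<^sup>+y. F y \<partial>circle_measure)"
proof (induction n)
  case (Suc n)
  have "(\<integral>\<^sup>+y\<in>{p..<p + real (Suc n)}. F y \<partial>lborel)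
      = (\<integral>\<^sup>+y. F y * indicator {p..<p + real n} y + F y * indicator {p + real n..<p + real n + 1} y \<partial>lborel)"
    by (intro nn_integral_cong) (auto simp: indicator_def)
  also have "\<dots> = (\<integral>\<^sup>+y\<in>{p..<p + real n}. F y \<partial>lborel) + (\<integral>\<^sup>+y\<in>{p + real n..<p + real n + 1}. F y \<partial>lborel)"
    by (subst nn_integral_add) auto
  also have "(\<integral>\<^sup>+y\<in>{p + real n..<p + real n + 1}. F y \<partial>lborel) = (\<integral>\<^sup>+y. F y \<partial>circle_measure)"
    using nn_integral_periodic_unit_interval[of F] per by (simp add: nn_integral_circle_measure)
  finally show ?case by (simp add: Suc.IH distrib_right add.commute)
qed simp

text \<open>One step has the uniform law on an interval of length 2\<epsilon>, wrapped around the
  circle. This interval is covered by \<open>n\<close> periods with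
  \<open>n \<le> 2 * \<epsilon> + 1\<close>, so the transition density is at most
  \<open>n / (2 * \<epsilon>)\<close>.\<close>

lemma Unn_le:
  fixes F :: "real \<Rightarrow> ennreal"
  assumes [measurable]: "F \<in> borel_measurable borel" and per: "\<And>x. F (x + 1) = F x"
  shows "Unn F x \<le> ennreal dens_bound * (\<integral>\<^sup>+y. F y \<partial>circle_measure)"
proof -
  define n where "n = nat \<lfloor>2 * \<epsilon>\<rfloor> + 1"
  have n: "2 * \<epsilon> < real n" "real n \<le> 2 * \<epsilon> + 1"
    using \<epsilon>_pos unfolding n_def by linarith+
  have "Unn F x = (\<integral>\<^sup>+y\<in>{T x - \<epsilon>..T x + \<epsilon>}. F y \<partial>lborel) / ennreal (2 * \<epsilon>)"
    unfolding Unn_def by (rule nn_integral_noise) simp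
  also have "\<dots> \<le> (\<integral>\<^sup>+y\<in>{T x - \<epsilon>..<T x - \<epsilon> + real n}. F y \<partial>lborel) / ennreal (2 * \<epsilon>)"
    using n by (intro divide_right_mono_ennreal nn_integral_mono) (auto simp: indicator_def)
  also have "\<dots> = ennreal (real n) * (\<integral>\<^sup>+y. F y \<partial>circle_measure) / ennreal (2 * \<epsilon>)"
    by (subst nn_integral_periodic_interval) (auto simp: per ennreal_of_nat_eq_real_of_nat)
  also have "\<dots> = ennreal (real n / (2 * \<epsilon>)) * (\<integral>\<^sup>+y. F y \<partial>circle_measure)"
    using \<epsilon>_pos by (simp add: divide_ennreal[symmetric] ennreal_times_divide mult.commute)
  also have "\<dots> \<le> ennreal dens_bound * (\<integral>\<^sup>+y. F y \<partial>circle_measure)"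
    using n \<epsilon>_pos by (intro mult_right_mono ennreal_leI) (auto simp: dens_bound_def field_simps)
  finally show ?thesis .
qed

section \<open>Spreading of intervals and Doeblin's condition\<close>

text \<open>Every \<open>y\<close> of the longer interval is within 19/20 \<epsilon> of some value
  \<open>T z0\<close>. The remaining \<epsilon>/20 absorbs the change of \<open>T\<close> on a
  neighbourhood of \<open>z0\<close>, by the Lipschitz bound, so \<open>y\<close> is reached from a
  set of starting points of length at least \<rho>. Tonelli turns this into the integral
  inequality.\<close>

lemma interval_spreads:
  assumes l: "0 < l" and uv: "u \<in> {p..p + l}" "v \<in> {p..p + l}"
      and grow: "min 1 (6 / 5 * l - 19 / 10 * \<epsilon>) \<le> T v - T u"
      and F[measurable]: "F \<in> borel_measurable borel"
  shows "ennreal (min (\<epsilon> / (20 * \<Lambda>)) l / (2 * \<epsilon>)) *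
        (\<integral>\<^sup>+y\<in>{T u - 19 / 20 * \<epsilon>..T u - 19 / 20 * \<epsilon> + min 1 (6 / 5 * l)}. F y \<partial>lborel)
      \<le> (\<integral>\<^sup>+z\<in>{p..p + l}. Unn F z \<partial>lborel)"
proof -
  define \<rho> where "\<rho> = min (\<epsilon> / (20 * \<Lambda>)) l"
  define J where "J = {T u - 19 / 20 * \<epsilon>..T u - 19 / 20 * \<epsilon> + min 1 (6 / 5 * l)}"
  have \<rho>: "\<rho> > 0" using \<epsilon>_pos \<Lambda>_pos l by (auto simp: \<rho>_def)
  \<comment> \<open>The kernel to which Tonelli is applied: \<open>z\<close> lies in the interval
    and one kick can bring it to \<open>y\<close>.\<close>
  define H where "H z y = (indicator {p..p + l} z * indicator {T z - \<epsilon>..T z + \<epsilon>} y :: ennreal)" for z y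
  have H[measurable]: "(\<lambda>(z, y). H z y) \<in> borel_measurable (lborel \<Otimes>\<^sub>M lborel)"
  proof -
    have "(\<lambda>(z, y). H z y) = (\<lambda>w. if p \<le> fst w \<and> fst w \<le> p + l \<and> T (fst w) - \<epsilon> \<le> snd w \<and> snd w \<le> T (fst w) + \<epsilon>
        then 1 else 0)"
      by (auto simp: H_def indicator_def fun_eq_iff)
    also have "\<dots> \<in> borel_measurable (lborel \<Otimes>\<^sub>M lborel)" by measurable
    finally show ?thesis .
  qed
  have spread: "ennreal \<rho> \<le> (\<integral>\<^sup>+z. H z y \<partial>lborel)" if y: "y \<in> J" for y
  proof -
    \<comment> \<open>Near \<open>T u\<close> take \<open>u\<close>, above \<open>T v\<close> take
      \<open>v\<close>; in between \<open>y\<close> itself is a value of \<open>T\<close>, by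
      connectedness.\<close>
    obtain z0 where z0: "z0 \<in> {p..p + l}" "\<bar>T z0 - y\<bar> \<le> 19 / 20 * \<epsilon>"
    proof (cases "y \<le> T u + 19 / 20 * \<epsilon>")
      case True
      then have "\<bar>T u - y\<bar> \<le> 19 / 20 * \<epsilon>" using y unfolding J_def abs_le_iff by simp
      then show ?thesis using that uv(1) by blast
    next
      case False
      have "min 1 (6 / 5 * l) \<le> min 1 (6 / 5 * l - 19 / 10 * \<epsilon>) + 19 / 10 * \<epsilon>"
        using \<epsilon>_pos by (auto simp: min_def)
      then have y2: "y \<le> T v + 19 / 20 * \<epsilon>" using y grow by (simp add: J_def)
      show ?thesis
      proof (cases "T v \<le> y")
        case True
        then show ?thesis using that[of v] uv y2 \<epsilon>_pos by (auto simp: abs_le_iff)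
      next
        case inner: False
        have "connected (T ` {p..p + l})" by (intro connected_continuous_image T_continuous) auto
        moreover have "T u \<in> T ` {p..p + l}" "T v \<in> T ` {p..p + l}" using uv by auto
        ultimately have "{T u..T v} \<subseteq> T ` {p..p + l}" by (rule connected_contains_Icc)
        moreover have "y \<in> {T u..T v}" using False inner \<epsilon>_pos by auto
        ultimately have "y \<in> T ` {p..p + l}" by blast
        then obtain z where "z \<in> {p..p + l}" "T z = y" by auto
        then show ?thesis using that[of z] \<epsilon>_pos by auto
      qed
    qed
    \<comment> \<open>The window around \<open>z0\<close> is clipped to the interval. Since
      \<open>\<rho> \<le> l\<close>, at least a length \<rho> of it survives even if
      \<open>z0\<close> is an endpoint.\<close>
    define A B where "A = max p (z0 - \<rho>)" and "B = min (p + l) (z0 + \<rho>)"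
    have "\<rho> \<le> l" by (simp add: \<rho>_def)
    then have AB: "\<rho> \<le> B - A" using z0 \<rho> by (auto simp: A_def B_def min_def max_def)
    have "indicator {A..B} z \<le> H z y" for z
    proof (cases "z \<in> {A..B}")
      case True
      then have z: "z \<in> {p..p + l}" "\<bar>z - z0\<bar> \<le> \<rho>" by (auto simp: A_def B_def)
      have "\<rho> \<le> \<epsilon> / (20 * \<Lambda>)" by (simp add: \<rho>_def)
      then have "\<Lambda> * \<bar>z - z0\<bar> \<le> \<Lambda> * (\<epsilon> / (20 * \<Lambda>))"
        using z(2) \<Lambda>_pos by (intro mult_left_mono) auto
      moreover have "\<Lambda> * (\<epsilon> / (20 * \<Lambda>)) = \<epsilon> / 20" using \<Lambda>_pos by simp
      ultimately have "\<bar>T z - T z0\<bar> \<le> \<epsilon> / 20" using T_lipschitz[of z z0] by linarith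
      then have "y \<in> {T z - \<epsilon>..T z + \<epsilon>}" using z0(2) unfolding atLeastAtMost_iff by linarith
      then show ?thesis using z(1) by (simp add: H_def indicator_def)
    qed simp
    then have "(\<integral>\<^sup>+z. indicator {A..B} z \<partial>lborel) \<le> (\<integral>\<^sup>+z. H z y \<partial>lborel)" by (intro nn_integral_mono)
    moreover have "ennreal \<rho> \<le> (\<integral>\<^sup>+z. indicator {A..B} z \<partial>lborel)" using AB \<rho> by (simp add: ennreal_leI)
    ultimately show ?thesis by simp
  qed
  have Unn_eq: "Unn F z * indicator {p..p + l} z = (\<integral>\<^sup>+y. H z y * F y \<partial>lborel) / ennreal (2 * \<epsilon>)" for z
  proof (cases "z \<in> {p..p + l}")
    case True
    then show ?thesis by (simp add: Unn_def nn_integral_noise H_def mult.commute)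
  qed (simp add: H_def)
  have "(\<integral>\<^sup>+z\<in>{p..p + l}. Unn F z \<partial>lborel)
      = (\<integral>\<^sup>+z. (\<integral>\<^sup>+y. H z y * F y \<partial>lborel) / ennreal (2 * \<epsilon>) \<partial>lborel)"
    by (simp only: Unn_eq)
  also have "\<dots> = (\<integral>\<^sup>+z. (\<integral>\<^sup>+y. H z y * F y \<partial>lborel) \<partial>lborel) / ennreal (2 * \<epsilon>)"
    by (intro nn_integral_divide) simp
  finally have eq: "(\<integral>\<^sup>+z\<in>{p..p + l}. Unn F z \<partial>lborel)
      = (\<integral>\<^sup>+z. (\<integral>\<^sup>+y. H z y * F y \<partial>lborel) \<partial>lborel) / ennreal (2 * \<epsilon>)" .
  have "ennreal \<rho> * (\<integral>\<^sup>+y\<in>J. F y \<partial>lborel) = (\<integral>\<^sup>+y. ennreal \<rho> * (F y * indicator J y) \<partial>lborel)"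
    by (intro nn_integral_cmult[symmetric]) (simp add: J_def)
  also have "\<dots> \<le> (\<integral>\<^sup>+y. (\<integral>\<^sup>+z. H z y \<partial>lborel) * F y \<partial>lborel)"
    using spread by (intro nn_integral_mono) (auto simp: indicator_def intro!: mult_right_mono)
  also have "\<dots> = (\<integral>\<^sup>+y. (\<integral>\<^sup>+z. H z y * F y \<partial>lborel) \<partial>lborel)"
    by (intro nn_integral_cong nn_integral_multc[symmetric]) simp
  also have "\<dots> = (\<integral>\<^sup>+z. (\<integral>\<^sup>+y. H z y * F y \<partial>lborel) \<partial>lborel)"
    by (intro lborel_pair.Fubini') simp
  finally have "ennreal \<rho> * (\<integral>\<^sup>+y\<in>J. F y \<partial>lborel) / ennreal (2 * \<epsilon>)
      \<le> (\<integral>\<^sup>+z\<in>{p..p + l}. Unn F z \<partial>lborel)"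
    unfolding eq by (rule divide_right_mono_ennreal)
  moreover have "ennreal \<rho> * (\<integral>\<^sup>+y\<in>J. F y \<partial>lborel) / ennreal (2 * \<epsilon>)
      = ennreal (\<rho> / (2 * \<epsilon>)) * (\<integral>\<^sup>+y\<in>J. F y \<partial>lborel)"
    using \<epsilon>_pos \<rho> by (simp add: divide_ennreal[symmetric] ennreal_times_divide mult.commute)
  ultimately show ?thesis by (simp add: \<rho>_def J_def)
qed

end

text \<open>The assumption is the conclusion of \<open>oscillation\<close>. Fattening by 19/20
  \<epsilon> on both sides restores the subtracted term, and \<open>min 1\<close> stops the growth
  at a full turn.\<close>

locale spreading_circle_map = noisy_circle_map +
  assumes grow: "\<And>p l. 0 < l \<Longrightarrow>
      \<exists>u\<in>{p..p + l}. \<exists>v\<in>{p..p + l}. min 1 (6 / 5 * l - 19 / 10 * \<epsilon>) \<le> T v - T u"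
begin

text \<open>After the first step the law is uniform on an interval of length 2\<epsilon>; every
  further step multiplies the length of a dominated interval by 6/5, up to 1. The position
  \<open>p\<close> depends on the starting point, the constant \<open>c\<close> does not.\<close>

lemma minorization_interval:
  "\<exists>c>0. \<forall>x. \<exists>p. \<forall>F\<in>borel_measurable borel.
     ennreal c * (\<integral>\<^sup>+y\<in>{p..p + min 1 ((6 / 5) ^ n * (2 * \<epsilon>))}. F y \<partial>lborel) \<le> (Unn ^^ Suc n) F x"
proof (induction n)
  case 0
  have "ennreal (1 / (2 * \<epsilon>)) * (\<integral>\<^sup>+y\<in>{T x - \<epsilon>..T x - \<epsilon> + min 1 ((6 / 5) ^ 0 * (2 * \<epsilon>))}. F y \<partial>lborel)
      \<le> (Unn ^^ Suc 0) F x" if [measurable]: "F \<in> borel_measurable borel" for x F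
  proof -
    have "(\<integral>\<^sup>+y\<in>{T x - \<epsilon>..T x - \<epsilon> + min 1 ((6 / 5) ^ 0 * (2 * \<epsilon>))}. F y \<partial>lborel)
        \<le> (\<integral>\<^sup>+y\<in>{T x - \<epsilon>..T x + \<epsilon>}. F y \<partial>lborel)"
      by (intro nn_integral_mono) (auto simp: indicator_def)
    also have "ennreal (1 / (2 * \<epsilon>)) * \<dots> = (Unn ^^ Suc 0) F x"
      using \<epsilon>_pos
      by (simp add: Unn_def nn_integral_noise divide_ennreal_def inverse_ennreal inverse_eq_divide mult.commute)
    finally show ?thesis by (simp add: mult_left_mono)
  qed
  then show ?case using \<epsilon>_pos by (intro exI[of _ "1 / (2 * \<epsilon>)"]) auto
next
  case (Suc n)
  then obtain c where c: "c > 0" "\<And>x. \<exists>p. \<forall>F\<in>borel_measurable borel.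
     ennreal c * (\<integral>\<^sup>+y\<in>{p..p + min 1 ((6 / 5) ^ n * (2 * \<epsilon>))}. F y \<partial>lborel) \<le> (Unn ^^ Suc n) F x"
    by blast
  define l where "l = min 1 ((6 / 5) ^ n * (2 * \<epsilon>))"
  define c' where "c' = min (\<epsilon> / (20 * \<Lambda>)) l / (2 * \<epsilon>)"
  have l: "l > 0" using \<epsilon>_pos by (auto simp: l_def)
  then have c': "c' > 0" using \<epsilon>_pos \<Lambda>_pos by (auto simp: c'_def)
  have l': "min 1 (6 / 5 * l) = min 1 ((6 / 5) ^ Suc n * (2 * \<epsilon>))"
    by (auto simp: l_def min_def)
  have "\<exists>p. \<forall>F\<in>borel_measurable borel.
     ennreal (c * c') * (\<integral>\<^sup>+y\<in>{p..p + min 1 ((6 / 5) ^ Suc n * (2 * \<epsilon>))}. F y \<partial>lborel)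
       \<le> (Unn ^^ Suc (Suc n)) F x" for x
  proof -
    obtain p where p: "\<And>F. F \<in> borel_measurable borel \<Longrightarrow>
        ennreal c * (\<integral>\<^sup>+y\<in>{p..p + l}. F y \<partial>lborel) \<le> (Unn ^^ Suc n) F x"
      using c(2)[of x] unfolding l_def by blast
    obtain u v where uv: "u \<in> {p..p + l}" "v \<in> {p..p + l}" "min 1 (6 / 5 * l - 19 / 10 * \<epsilon>) \<le> T v - T u"
      using grow[OF l] by blast
    have "ennreal (c * c') * (\<integral>\<^sup>+y\<in>{T u - 19 / 20 * \<epsilon>..T u - 19 / 20 * \<epsilon> + min 1 (6 / 5 * l)}. F y \<partial>lborel)
        \<le> (Unn ^^ Suc (Suc n)) F x" if F: "F \<in> borel_measurable borel" for F
    proof -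
      have "ennreal (c * c') * (\<integral>\<^sup>+y\<in>{T u - 19 / 20 * \<epsilon>..T u - 19 / 20 * \<epsilon> + min 1 (6 / 5 * l)}. F y \<partial>lborel)
          \<le> ennreal c * (\<integral>\<^sup>+z\<in>{p..p + l}. Unn F z \<partial>lborel)"
        using interval_spreads[OF l uv F, folded c'_def] c(1) c'
        by (simp only: ennreal_mult' less_imp_le mult.assoc mult_left_mono zero_le)
      \<comment> \<open>The induction hypothesis is applied to \<open>Unn F\<close>, which appends
        the new step at the end of the trajectory.\<close>
      also have "\<dots> \<le> (Unn ^^ Suc n) (Unn F) x" using F by (intro p) simp
      also have "\<dots> = (Unn ^^ Suc (Suc n)) F x" by (simp only: funpow_Suc_right o_apply)
      finally show ?thesis .
    qed
    then show ?thesis unfolding l' by blast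
  qed
  then show ?case using c(1) c' by (intro exI[of _ "c * c'"]) auto
qed

text \<open>With \<open>n\<close> so large that the dominated interval has length 1, it covers the
  circle, and by periodicity its position no longer matters.\<close>

lemma minorization:
  "\<exists>n c. 0 < c \<and> (\<forall>f x. circle_fun f \<longrightarrow> (\<forall>y. 0 \<le> f y) \<longrightarrow> c * (\<integral>y. f y \<partial>circle_measure) \<le> (U ^^ n) f x)"
proof -
  obtain n where n: "1 / (2 * \<epsilon>) < (6 / 5 :: real) ^ n" using real_arch_pow[of "6 / 5" "1 / (2 * \<epsilon>)"] by auto
  then have "1 \<le> (6 / 5) ^ n * (2 * \<epsilon>)" using \<epsilon>_pos by (simp add: field_simps)
  then have l: "min 1 ((6 / 5) ^ n * (2 * \<epsilon>)) = 1" by simp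
  obtain c where c: "c > 0" "\<And>x. \<exists>p. \<forall>F\<in>borel_measurable borel.
     ennreal c * (\<integral>\<^sup>+y\<in>{p..p + 1}. F y \<partial>lborel) \<le> (Unn ^^ Suc n) F x"
    using minorization_interval[of n] unfolding l by blast
  have "c * (\<integral>y. f y \<partial>circle_measure) \<le> (U ^^ Suc n) f x"
    if f: "circle_fun f" and nonneg: "\<And>y. 0 \<le> f y" for f x
  proof -
    note [measurable] = circle_fun_measurable[OF f]
    obtain p where p: "\<And>F. F \<in> borel_measurable borel \<Longrightarrow>
        ennreal c * (\<integral>\<^sup>+y\<in>{p..p + 1}. F y \<partial>lborel) \<le> (Unn ^^ Suc n) F x"
      using c(2)[of x] by blast
    have "ennreal (c * (\<integral>y. f y \<partial>circle_measure)) = ennreal c * (\<integral>\<^sup>+y. f y \<partial>circle_measure)"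
      using c(1) nonneg f
      by (subst nn_integral_eq_integral)
         (auto intro!: integrable_circle_fun[where g = "\<lambda>x. x"] circle.finite_measure_axioms measurable_circle simp: ennreal_mult')
    also have "\<dots> = ennreal c * (\<integral>\<^sup>+y\<in>{p..<p + 1}. f y \<partial>lborel)"
      using f by (subst nn_integral_periodic_unit_interval) (auto simp: nn_integral_circle_measure circle_fun_def)
    also have "\<dots> \<le> ennreal c * (\<integral>\<^sup>+y\<in>{p..p + 1}. f y \<partial>lborel)"
      by (intro mult_left_mono nn_integral_mono) (auto simp: indicator_def)
    also have "\<dots> \<le> (Unn ^^ Suc n) (\<lambda>x. ennreal (f x)) x" by (intro p) simp
    also have "\<dots> = ennreal ((U ^^ Suc n) f x)"
      using ennreal_U_funpow[OF f nonneg, of "Suc n"] by metis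
    finally show ?thesis
      using U_funpow_bounds[OF f nonneg, of _ "Suc n" x] circle_fun_bounded[OF f]
      by (subst (asm) ennreal_le_iff) (meson abs_le_D1)+
  qed
  then show ?thesis using c(1) by blast
qed

end

section \<open>Properties of invariant measures\<close>

context noisy_circle_map
begin

text \<open>The notion \<open>invariant_measure\<close> expressed through the lift;
  \<open>invariant_measure_iff\<close> identifies the two.\<close>

definition invariant :: "real measure \<Rightarrow> bool" where
  "invariant \<nu> \<longleftrightarrow> prob_space \<nu> \<and> sets \<nu> = sets circle_measure \<and>
     (\<forall>B \<in> sets circle_measure.
        emeasure \<nu> B = (\<integral>\<^sup>+\<omega>. emeasure \<nu> {x \<in> {0..<1}. frac (T x + \<omega>) \<in> B} \<partial>noise \<epsilon>))"

lemma pair_sigma_finite_noise: "prob_space \<nu> \<Longrightarrow> pair_sigma_finite \<nu> (noise \<epsilon>)"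
  by (intro pair_sigma_finite.intro prob_space_imp_sigma_finite noise.sigma_finite_measure_axioms)

lemma space_eq_unit: "sets \<nu> = sets circle_measure \<Longrightarrow> space \<nu> = {0..<1}"
  using sets_eq_imp_space_eq[of \<nu> circle_measure] by (simp add: space_circle_measure)

lemma borel_measurable_circle:
  "sets \<nu> = sets circle_measure \<Longrightarrow> f \<in> borel_measurable borel \<Longrightarrow> f \<in> borel_measurable \<nu>"
  using measurable_circle[of f] measurable_cong_sets[of \<nu> circle_measure] by blast

lemma preimage_sets:
  assumes "B \<in> sets circle_measure"
  shows "{x \<in> {0..<1}. frac (T x + \<omega>) \<in> B} \<in> sets circle_measure"
proof -
  have [measurable]: "B \<in> sets borel" using assms by (simp add: sets_circle_measure)
  show ?thesis by (auto simp: sets_circle_measure)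
qed

text \<open>Tonelli exchanges the average over kicks with the integral over \<nu>, which turns the
  averaged preimages of the definition into the transition operator.\<close>

lemma nn_integral_kick:
  assumes \<nu>: "prob_space \<nu>" "sets \<nu> = sets circle_measure" and B: "B \<in> sets circle_measure"
  shows "(\<integral>\<^sup>+\<omega>. emeasure \<nu> {x \<in> {0..<1}. frac (T x + \<omega>) \<in> B} \<partial>noise \<epsilon>)
    = (\<integral>\<^sup>+x. Unn (\<lambda>x. ennreal (on_circle B x)) x \<partial>\<nu>)"
proof -
  interpret \<nu>: prob_space \<nu> by fact
  note pair = pair_sigma_finite_noise[OF \<nu>(1)]
  have [measurable]: "B \<in> sets borel" using B by (simp add: sets_circle_measure)
  have id[measurable]: "(\<lambda>x. x) \<in> borel_measurable \<nu>" by (rule borel_measurable_circle[OF \<nu>(2)]) simp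
  have T[measurable]: "T \<in> borel_measurable \<nu>" by (rule borel_measurable_circle[OF \<nu>(2)]) simp
  have "(\<integral>\<^sup>+x. Unn (\<lambda>x. ennreal (on_circle B x)) x \<partial>\<nu>)
      = (\<integral>\<^sup>+x. (\<integral>\<^sup>+\<omega>. indicator B (frac (T x + \<omega>)) \<partial>noise \<epsilon>) \<partial>\<nu>)"
    by (simp add: Unn_def on_circle_def ennreal_indicator)
  also have "\<dots> = (\<integral>\<^sup>+\<omega>. (\<integral>\<^sup>+x. indicator B (frac (T x + \<omega>)) \<partial>\<nu>) \<partial>noise \<epsilon>)"
    by (intro pair_sigma_finite.Fubini'[OF pair, symmetric]) measurable
  also have "\<dots> = (\<integral>\<^sup>+\<omega>. emeasure \<nu> {x \<in> {0..<1}. frac (T x + \<omega>) \<in> B} \<partial>noise \<epsilon>)"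
  proof (intro nn_integral_cong)
    fix \<omega>
    have "(\<integral>\<^sup>+x. indicator B (frac (T x + \<omega>)) \<partial>\<nu>) = (\<integral>\<^sup>+x. indicator {x \<in> {0..<1}. frac (T x + \<omega>) \<in> B} x \<partial>\<nu>)"
      using space_eq_unit[OF \<nu>(2)] by (intro nn_integral_cong) (auto simp: indicator_def)
    also have "\<dots> = emeasure \<nu> {x \<in> {0..<1}. frac (T x + \<omega>) \<in> B}"
      using preimage_sets[OF B] \<nu>(2) by (intro nn_integral_indicator) simp
    finally show "(\<integral>\<^sup>+x. indicator B (frac (T x + \<omega>)) \<partial>\<nu>) = emeasure \<nu> {x \<in> {0..<1}. frac (T x + \<omega>) \<in> B}" .
  qed
  finally show ?thesis by simp
qed

text \<open>Invariance says that \<nu> is the image of the product of \<nu> and the noise under one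
  step. The transformation rule then extends the identity from sets to periodic functions.\<close>

lemma invariant_nn_integral:
  assumes inv: "invariant \<nu>" and F[measurable]: "F \<in> borel_measurable borel" and per: "\<And>x. F (x + 1) = F x"
  shows "(\<integral>\<^sup>+x. F x \<partial>\<nu>) = (\<integral>\<^sup>+x. Unn F x \<partial>\<nu>)"
proof -
  have \<nu>: "prob_space \<nu>" "sets \<nu> = sets circle_measure" using inv by (auto simp: invariant_def)
  interpret \<nu>: prob_space \<nu> by fact
  note pair = pair_sigma_finite_noise[OF \<nu>(1)]
  have T[measurable]: "T \<in> borel_measurable \<nu>" by (rule borel_measurable_circle[OF \<nu>(2)]) simp
  define step where "step = (\<lambda>w. frac (T (fst w) + snd w))"
  have s0: "step \<in> borel_measurable (\<nu> \<Otimes>\<^sub>M noise \<epsilon>)" unfolding step_def by measurable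
  have step[measurable]: "step \<in> \<nu> \<Otimes>\<^sub>M noise \<epsilon> \<rightarrow>\<^sub>M \<nu>"
  proof -
    have "step \<in> \<nu> \<Otimes>\<^sub>M noise \<epsilon> \<rightarrow>\<^sub>M circle_measure"
      unfolding circle_measure_def using s0 frac_in_unit
      by (intro measurable_restrict_space2) (auto simp: step_def)
    then show ?thesis using \<nu>(2) measurable_cong_sets[of _ _ circle_measure \<nu>] by blast
  qed
  have "\<nu> = distr (\<nu> \<Otimes>\<^sub>M noise \<epsilon>) \<nu> step"
  proof (rule measure_eqI)
    fix B assume B: "B \<in> sets \<nu>"
    have "emeasure (distr (\<nu> \<Otimes>\<^sub>M noise \<epsilon>) \<nu> step) B
        = emeasure (\<nu> \<Otimes>\<^sub>M noise \<epsilon>) (step -` B \<inter> space (\<nu> \<Otimes>\<^sub>M noise \<epsilon>))"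
      using B by (intro emeasure_distr step)
    also have "\<dots> = (\<integral>\<^sup>+\<omega>. emeasure \<nu> ((\<lambda>x. (x, \<omega>)) -` (step -` B \<inter> space (\<nu> \<Otimes>\<^sub>M noise \<epsilon>))) \<partial>noise \<epsilon>)"
      using B by (intro pair_sigma_finite.emeasure_pair_measure_alt2[OF pair] measurable_sets[OF step])
    also have "\<dots> = (\<integral>\<^sup>+\<omega>. emeasure \<nu> {x \<in> {0..<1}. frac (T x + \<omega>) \<in> B} \<partial>noise \<epsilon>)"
    proof -
      have "(\<lambda>x. (x, \<omega>)) -` (step -` B \<inter> space (\<nu> \<Otimes>\<^sub>M noise \<epsilon>)) = {x \<in> {0..<1}. frac (T x + \<omega>) \<in> B}" for \<omega>
        unfolding space_pair_measure space_eq_unit[OF \<nu>(2)] noise_space step_def by auto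
      then show ?thesis by (simp only:)
    qed
    also have "\<dots> = emeasure \<nu> B" using inv B \<nu>(2) by (simp add: invariant_def)
    finally show "emeasure \<nu> B = emeasure (distr (\<nu> \<Otimes>\<^sub>M noise \<epsilon>) \<nu> step) B" by simp
  qed simp
  then have "(\<integral>\<^sup>+x. F x \<partial>\<nu>) = (\<integral>\<^sup>+x. F x \<partial>distr (\<nu> \<Otimes>\<^sub>M noise \<epsilon>) \<nu> step)" by simp
  also have "\<dots> = (\<integral>\<^sup>+w. F (step w) \<partial>(\<nu> \<Otimes>\<^sub>M noise \<epsilon>))"
    by (rule nn_integral_distr[OF step borel_measurable_circle[OF _ F]]) (use \<nu> in simp)
  also have "\<dots> = (\<integral>\<^sup>+w. F (T (fst w) + snd w) \<partial>(\<nu> \<Otimes>\<^sub>M noise \<epsilon>))"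
    using periodic_frac[of F] per by (simp add: step_def)
  also have "\<dots> = (\<integral>\<^sup>+x. (\<integral>\<^sup>+\<omega>. F (T x + \<omega>) \<partial>noise \<epsilon>) \<partial>\<nu>)"
    by (subst noise.nn_integral_fst[symmetric]) auto
  finally show ?thesis by (simp add: Unn_def)
qed

text \<open>An invariant measure is an average of one-step laws, each of which has density at most
  \<open>dens_bound\<close>.\<close>

lemma invariant_le_density:
  assumes inv: "invariant \<nu>" and B: "B \<in> sets circle_measure"
  shows "emeasure \<nu> B \<le> ennreal dens_bound * emeasure circle_measure B"
proof -
  have \<nu>: "prob_space \<nu>" "sets \<nu> = sets circle_measure" using inv by (auto simp: invariant_def)
  interpret \<nu>: prob_space \<nu> by fact
  note f = circle_fun_on_circle[OF B]
  note [measurable] = circle_fun_measurable[OF f]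
  have "emeasure \<nu> B = (\<integral>\<^sup>+x. Unn (\<lambda>x. ennreal (on_circle B x)) x \<partial>\<nu>)"
    using inv B nn_integral_kick[OF \<nu> B] by (simp add: invariant_def)
  also have "\<dots> \<le> (\<integral>\<^sup>+x. ennreal dens_bound * (\<integral>\<^sup>+y. on_circle B y \<partial>circle_measure) \<partial>\<nu>)"
    using f by (intro nn_integral_mono Unn_le) (auto simp: circle_fun_def)
  also have "(\<integral>\<^sup>+y. on_circle B y \<partial>circle_measure) = (\<integral>\<^sup>+y. indicator B y \<partial>circle_measure)"
    using B by (intro nn_integral_cong) (auto simp: on_circle_eq space_circle_measure indicator_def)
  also have "\<dots> = emeasure circle_measure B" using B by simp
  finally show ?thesis by (simp add: \<nu>.emeasure_space_1)
qed

lemma AE_noise_range: "AE \<omega> in noise \<epsilon>. \<bar>\<omega>\<bar> \<le> \<epsilon>"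
  unfolding noise_def by (rule AE_uniform_measureI) auto

text \<open>For almost every kick \<open>B\<close> is contained in the preimage of
  \<open>B'\<close>. It serves to compare the mass of small derivatives with that of very large
  ones.\<close>

lemma invariant_transport:
  assumes inv: "invariant \<nu>" and B: "B \<in> sets circle_measure" and B': "B' \<in> sets circle_measure"
    and maps: "\<And>x \<omega>. x \<in> B \<Longrightarrow> \<bar>\<omega>\<bar> \<le> \<epsilon> \<Longrightarrow> frac (T x + \<omega>) \<in> B'"
  shows "emeasure \<nu> B \<le> emeasure \<nu> B'"
proof -
  have \<nu>: "sets \<nu> = sets circle_measure" using inv by (auto simp: invariant_def)
  have "emeasure \<nu> B = (\<integral>\<^sup>+\<omega>. emeasure \<nu> B \<partial>noise \<epsilon>)"
    using noise.emeasure_space_1 by simp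
  also have "\<dots> \<le> (\<integral>\<^sup>+\<omega>. emeasure \<nu> {x \<in> {0..<1}. frac (T x + \<omega>) \<in> B'} \<partial>noise \<epsilon>)"
  proof (rule nn_integral_mono_AE, use AE_noise_range in eventually_elim)
    fix \<omega> :: real assume "\<bar>\<omega>\<bar> \<le> \<epsilon>"
    then have "B \<subseteq> {x \<in> {0..<1}. frac (T x + \<omega>) \<in> B'}"
      using maps B by (auto simp: sets_circle_measure)
    then show "emeasure \<nu> B \<le> emeasure \<nu> {x \<in> {0..<1}. frac (T x + \<omega>) \<in> B'}"
      using preimage_sets[OF B'] \<nu> by (intro emeasure_mono) auto
  qed
  also have "\<dots> = emeasure \<nu> B'" using inv B' by (simp add: invariant_def)
  finally show ?thesis .
qed

text \<open>In the invariance equation for \<open>B \<inter> A\<close> the preimage of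
  \<open>B\<close> may be replaced by \<open>B\<close>, for almost every kick and up to a null set;
  division by the mass of \<open>B\<close> follows. It reduces ergodicity to uniqueness.\<close>

lemma invariant_uniform_measure:
  assumes inv: "invariant \<nu>" and B: "B \<in> sets circle_measure" and pos: "emeasure \<nu> B \<noteq> 0"
    and AE: "AE \<omega> in noise \<epsilon>. emeasure \<nu> ((B - {x \<in> {0..<1}. frac (T x + \<omega>) \<in> B})
                 \<union> ({x \<in> {0..<1}. frac (T x + \<omega>) \<in> B} - B)) = 0"
  shows "invariant (uniform_measure \<nu> B)"
  unfolding invariant_def
proof (intro conjI ballI)
  have \<nu>: "prob_space \<nu>" "sets \<nu> = sets circle_measure" using inv by (auto simp: invariant_def)
  interpret \<nu>: prob_space \<nu> by fact
  show "prob_space (uniform_measure \<nu> B)"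
    using pos \<nu>.emeasure_finite by (intro prob_space_uniform_measure) auto
  show "sets (uniform_measure \<nu> B) = sets circle_measure" using \<nu> by simp
  fix A assume A: "A \<in> sets circle_measure"
  let ?pre = "\<lambda>\<omega> A. {x \<in> {0..<1}. frac (T x + \<omega>) \<in> A}"
  note pre = preimage_sets[OF A] preimage_sets[OF B]
  have "emeasure \<nu> (B \<inter> A) = (\<integral>\<^sup>+\<omega>. emeasure \<nu> (?pre \<omega> (B \<inter> A)) \<partial>noise \<epsilon>)"
    using inv A B by (simp add: invariant_def)
  also have "\<dots> = (\<integral>\<^sup>+\<omega>. emeasure \<nu> (B \<inter> ?pre \<omega> A) \<partial>noise \<epsilon>)"
  proof (rule nn_integral_cong_AE, use AE in eventually_elim)
    fix \<omega> assume null: "emeasure \<nu> ((B - ?pre \<omega> B) \<union> (?pre \<omega> B - B)) = 0"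
    have "(B - ?pre \<omega> B) \<union> (?pre \<omega> B - B) \<in> null_sets \<nu>"
      using null pre B \<nu>(2) by (intro null_setsI) auto
    then have "AE x in \<nu>. x \<notin> (B - ?pre \<omega> B) \<union> (?pre \<omega> B - B)" by (rule AE_not_in)
    then have "AE x in \<nu>. x \<in> ?pre \<omega> (B \<inter> A) \<longleftrightarrow> x \<in> B \<inter> ?pre \<omega> A"
      by eventually_elim auto
    then show "emeasure \<nu> (?pre \<omega> (B \<inter> A)) = emeasure \<nu> (B \<inter> ?pre \<omega> A)"
    proof (rule emeasure_eq_AE)
      show "?pre \<omega> (B \<inter> A) \<in> sets \<nu>" using preimage_sets[OF sets.Int[OF B A]] \<nu>(2) by simp
      show "B \<inter> ?pre \<omega> A \<in> sets \<nu>" using sets.Int[OF B pre(1)] \<nu>(2) by simp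
    qed
  qed
  finally have "emeasure (uniform_measure \<nu> B) A
      = (\<integral>\<^sup>+\<omega>. emeasure \<nu> (B \<inter> ?pre \<omega> A) \<partial>noise \<epsilon>) / emeasure \<nu> B"
    using A B \<nu> by simp
  also have "\<dots> = (\<integral>\<^sup>+\<omega>. emeasure \<nu> (B \<inter> ?pre \<omega> A) / emeasure \<nu> B \<partial>noise \<epsilon>)"
  proof (rule nn_integral_divide[symmetric])
    note pair = pair_sigma_finite_noise[OF \<nu>(1)]
    have T[measurable]: "T \<in> borel_measurable \<nu>" by (rule borel_measurable_circle[OF \<nu>(2)]) simp
    define step where "step = (\<lambda>w. frac (T (fst w) + snd w))"
    have step: "step \<in> borel_measurable (\<nu> \<Otimes>\<^sub>M noise \<epsilon>)" unfolding step_def by measurable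
    \<comment> \<open>The sections of this product-measurable set are the sets
      \<open>B \<inter> ?pre \<omega> A\<close>, which shows that their mass is measurable in
      \<omega>, as pulling out the divisor requires.\<close>
    define Q where "Q = (fst -` B \<inter> space (\<nu> \<Otimes>\<^sub>M noise \<epsilon>)) \<inter> (step -` A \<inter> space (\<nu> \<Otimes>\<^sub>M noise \<epsilon>))"
    have Q: "Q \<in> sets (\<nu> \<Otimes>\<^sub>M noise \<epsilon>)"
      unfolding Q_def using B \<nu>(2) A
      by (intro sets.Int measurable_sets[OF measurable_fst] measurable_sets[OF step])
         (auto simp: sets_circle_measure)
    have eq: "(\<lambda>\<omega>. emeasure \<nu> ((\<lambda>x. (x, \<omega>)) -` Q)) = (\<lambda>\<omega>. emeasure \<nu> (B \<inter> ?pre \<omega> A))"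
    proof -
      have "(\<lambda>x. (x, \<omega>)) -` Q = B \<inter> ?pre \<omega> A" for \<omega>
        using B unfolding Q_def space_pair_measure space_eq_unit[OF \<nu>(2)] noise_space step_def
        by (auto simp: sets_circle_measure)
      then show ?thesis by (simp only:)
    qed
    show "(\<lambda>\<omega>. emeasure \<nu> (B \<inter> ?pre \<omega> A)) \<in> borel_measurable (noise \<epsilon>)"
      using pair_sigma_finite.measurable_emeasure_Pair2[OF pair Q] unfolding eq .
  qed
  also have "\<dots> = (\<integral>\<^sup>+\<omega>. emeasure (uniform_measure \<nu> B) (?pre \<omega> A) \<partial>noise \<epsilon>)"
    using pre B \<nu>(2) by (intro nn_integral_cong) simp
  finally show "emeasure (uniform_measure \<nu> B) A
      = (\<integral>\<^sup>+\<omega>. emeasure (uniform_measure \<nu> B) (?pre \<omega> A) \<partial>noise \<epsilon>)" .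
qed

end

section \<open>Existence, uniqueness and ergodicity of the invariant measure\<close>

context spreading_circle_map
begin

text \<open>If \<open>f\<close> takes values between \<alpha> and \<beta>, minorization applied to
  \<open>f - \<alpha>\<close> and \<open>\<beta> - f\<close> shrinks the range by the factor
  \<open>1 - c\<close> after \<open>n\<close> steps. Further steps preserve bounds, so all later
  iterates stay in the small range reached.\<close>

lemma U_funpow_uniformly_constant:
  assumes f: "circle_fun f" and e: "0 < e"
  shows "\<exists>J. \<forall>i\<ge>J. \<forall>j\<ge>J. \<forall>x y. \<bar>(U ^^ i) f x - (U ^^ j) f y\<bar> \<le> e"
proof -
  obtain n c where c: "0 < c" and minor:
    "\<And>f x. circle_fun f \<Longrightarrow> (\<And>y. 0 \<le> f y) \<Longrightarrow> c * (\<integral>y. f y \<partial>circle_measure) \<le> (U ^^ n) f x"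
    using minorization by blast
  \<comment> \<open>Testing with the constant 1 keeps \<open>1 - c\<close> nonnegative, so that its
    powers contract.\<close>
  have "c \<le> 1" using minor[of "\<lambda>x. 1"] circle.prob_space by (simp add: circle_fun_const U_funpow_const)
  have int: "integrable circle_measure f" if "circle_fun f" for f
    using integrable_circle_fun[OF that, of circle_measure "\<lambda>x. x"]
    by (simp add: circle.finite_measure_axioms measurable_circle)
  have contract: "\<exists>\<alpha>' \<beta>'. \<beta>' - \<alpha>' \<le> (1 - c) * (\<beta> - \<alpha>) \<and> (\<forall>x. \<alpha>' \<le> (U ^^ n) f x \<and> (U ^^ n) f x \<le> \<beta>')"
    if f: "circle_fun f" and bd: "\<And>x. \<alpha> \<le> f x" "\<And>x. f x \<le> \<beta>" for f \<alpha> \<beta>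
  proof -
    define I where "I = (\<integral>y. f y \<partial>circle_measure)"
    have "circle_fun (\<lambda>x. - \<alpha> + f x)" using f by (intro circle_fun_add circle_fun_const)
    then have minor_low: "c * (\<integral>y. - \<alpha> + f y \<partial>circle_measure) \<le> (U ^^ n) (\<lambda>x. - \<alpha> + f x) x" for x
      using bd by (intro minor) (auto simp: algebra_simps)
    have I_low: "(\<integral>y. - \<alpha> + f y \<partial>circle_measure) = I - \<alpha>"
      using int[OF f] circle.prob_space by (simp add: I_def)
    have U_low: "(U ^^ n) (\<lambda>x. - \<alpha> + f x) = (\<lambda>x. - \<alpha> + (U ^^ n) f x)"
      by (simp only: U_funpow_add[OF circle_fun_const f] U_funpow_const)
    have low: "\<alpha> + c * (I - \<alpha>) \<le> (U ^^ n) f x" for x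
      using minor_low[of x] unfolding I_low U_low by (simp add: algebra_simps)
    have g: "circle_fun (\<lambda>x. - 1 * f x)" using f by (rule circle_fun_cmult)
    then have "circle_fun (\<lambda>x. \<beta> + - 1 * f x)" by (intro circle_fun_add circle_fun_const)
    then have minor_up: "c * (\<integral>y. \<beta> + - 1 * f y \<partial>circle_measure) \<le> (U ^^ n) (\<lambda>x. \<beta> + - 1 * f x) x" for x
      using bd by (intro minor) (auto simp: algebra_simps)
    have I_up: "(\<integral>y. \<beta> + - 1 * f y \<partial>circle_measure) = \<beta> - I"
      using int[OF f] circle.prob_space by (simp add: I_def)
    have U_up: "(U ^^ n) (\<lambda>x. \<beta> + - 1 * f x) = (\<lambda>x. \<beta> + - 1 * (U ^^ n) f x)"
      by (simp only: U_funpow_add[OF circle_fun_const g] U_funpow_const U_funpow_cmult)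
    have up: "(U ^^ n) f x \<le> \<beta> - c * (\<beta> - I)" for x
      using minor_up[of x] unfolding I_up U_up by (simp add: algebra_simps)
    show ?thesis
      using low up by (intro exI[of _ "\<alpha> + c * (I - \<alpha>)"] exI[of _ "\<beta> - c * (\<beta> - I)"])
        (auto simp: algebra_simps)
  qed
  obtain C where C: "\<And>x. \<bar>f x\<bar> \<le> C" using circle_fun_bounded[OF f] by blast
  have iter: "\<exists>\<alpha> \<beta>. \<beta> - \<alpha> \<le> (1 - c) ^ k * (2 * C) \<and> (\<forall>x. \<alpha> \<le> (U ^^ (k * n)) f x \<and> (U ^^ (k * n)) f x \<le> \<beta>)" for k
  proof (induction k)
    case 0
    show ?case using C by (intro exI[of _ "- C"] exI[of _ C]) (auto simp: abs_le_iff minus_le_iff)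
  next
    case (Suc k)
    then obtain \<alpha> \<beta> where ab: "\<beta> - \<alpha> \<le> (1 - c) ^ k * (2 * C)"
        "\<And>x. \<alpha> \<le> (U ^^ (k * n)) f x" "\<And>x. (U ^^ (k * n)) f x \<le> \<beta>" by blast
    obtain \<alpha>' \<beta>' where ab': "\<beta>' - \<alpha>' \<le> (1 - c) * (\<beta> - \<alpha>)"
        "\<And>x. \<alpha>' \<le> (U ^^ n) ((U ^^ (k * n)) f) x \<and> (U ^^ n) ((U ^^ (k * n)) f) x \<le> \<beta>'"
      using contract[OF circle_fun_funpow[OF f] ab(2,3)] by blast
    have "(1 - c) * (\<beta> - \<alpha>) \<le> (1 - c) * ((1 - c) ^ k * (2 * C))"
      using ab(1) \<open>c \<le> 1\<close> by (intro mult_left_mono) auto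
    then show ?case using ab' by (intro exI[of _ \<alpha>'] exI[of _ \<beta>']) (auto simp: funpow_add)
  qed
  have "(\<lambda>k. (1 - c) ^ k * (2 * C)) \<longlonglongrightarrow> 0 * (2 * C)"
    using c \<open>c \<le> 1\<close> by (intro tendsto_intros LIMSEQ_power_zero) auto
  then have "\<forall>\<^sub>F k in sequentially. (1 - c) ^ k * (2 * C) < e" using e by (intro order_tendstoD) auto
  then obtain k where k: "(1 - c) ^ k * (2 * C) < e" by (auto simp: eventually_sequentially)
  obtain \<alpha> \<beta> where ab: "\<beta> - \<alpha> \<le> (1 - c) ^ k * (2 * C)"
        "\<And>x. \<alpha> \<le> (U ^^ (k * n)) f x" "\<And>x. (U ^^ (k * n)) f x \<le> \<beta>" using iter[of k] by blast
  have "\<alpha> \<le> (U ^^ i) f x \<and> (U ^^ i) f x \<le> \<beta>" if "i \<ge> k * n" for i x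
  proof -
    have "(U ^^ i) f x = (U ^^ (i - k * n)) ((U ^^ (k * n)) f) x"
      using that funpow_add[of "i - k * n" "k * n" U] by simp
    then show ?thesis using U_funpow_bounds[OF circle_fun_funpow[OF f] ab(2,3)] by simp
  qed
  then have "\<bar>(U ^^ i) f x - (U ^^ j) f y\<bar> \<le> e" if "i \<ge> k * n" "j \<ge> k * n" for i j x y
    using that ab(1) k by (smt (verit))
  then show ?thesis by blast
qed

text \<open>The limit from the base point 0; \<open>U_funpow_tendsto_M\<close> shows that every
  starting point has the same limit. On functions with values between 0 and 1 it is the integral
  against the invariant measure, by \<open>integral_\<mu>\<close>.\<close>

definition M :: "(real \<Rightarrow> real) \<Rightarrow> real" where
  "M f = lim (\<lambda>j. (U ^^ j) f 0)"

lemma U_funpow_tendsto_M: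
  assumes f: "circle_fun f" shows "(\<lambda>j. (U ^^ j) f x) \<longlonglongrightarrow> M f"
proof -
  have "Cauchy (\<lambda>j. (U ^^ j) f 0)"
  proof (rule metric_CauchyI)
    fix e :: real assume "0 < e"
    then obtain J where J: "\<forall>i\<ge>J. \<forall>j\<ge>J. \<forall>x y. \<bar>(U ^^ i) f x - (U ^^ j) f y\<bar> \<le> e / 2"
      using U_funpow_uniformly_constant[OF f, of "e / 2"] by auto
    show "\<exists>J. \<forall>i\<ge>J. \<forall>j\<ge>J. dist ((U ^^ i) f 0) ((U ^^ j) f 0) < e"
    proof (intro exI[of _ J] allI impI)
      fix i j assume "J \<le> i" "J \<le> j"
      then have "\<bar>(U ^^ i) f 0 - (U ^^ j) f 0\<bar> \<le> e / 2" using J by blast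
      then show "dist ((U ^^ i) f 0) ((U ^^ j) f 0) < e" using \<open>0 < e\<close> by (simp add: dist_real_def)
    qed
  qed
  then have lim0: "(\<lambda>j. (U ^^ j) f 0) \<longlonglongrightarrow> M f"
    unfolding M_def using Cauchy_convergent convergent_LIMSEQ_iff by blast
  have "(\<lambda>j. (U ^^ j) f x - (U ^^ j) f 0) \<longlonglongrightarrow> 0"
  proof (rule LIMSEQ_I)
    fix e :: real assume "0 < e"
    then obtain J where J: "\<forall>i\<ge>J. \<forall>j\<ge>J. \<forall>x y. \<bar>(U ^^ i) f x - (U ^^ j) f y\<bar> \<le> e / 2"
      using U_funpow_uniformly_constant[OF f, of "e / 2"] by auto
    show "\<exists>J. \<forall>j\<ge>J. norm ((U ^^ j) f x - (U ^^ j) f 0 - 0) < e"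
    proof (intro exI[of _ J] allI impI)
      fix j assume "J \<le> j"
      then have "\<bar>(U ^^ j) f x - (U ^^ j) f 0\<bar> \<le> e / 2" using J by blast
      then show "norm ((U ^^ j) f x - (U ^^ j) f 0 - 0) < e" using \<open>0 < e\<close> by simp
    qed
  qed
  from tendsto_add[OF this lim0] show ?thesis by simp
qed

lemma M_eqI:
  assumes "circle_fun f" "\<And>j. (U ^^ j) f 0 = X j" "X \<longlonglongrightarrow> a"
  shows "M f = a"
proof (rule LIMSEQ_unique)
  show "X \<longlonglongrightarrow> M f" using U_funpow_tendsto_M[OF assms(1), of 0] by (simp add: assms(2))
qed fact

lemma M_add:
  assumes f: "circle_fun f" and g: "circle_fun g"
  shows "M (\<lambda>x. f x + g x) = M f + M g"
  by (rule M_eqI[OF circle_fun_add[OF f g] _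
      tendsto_add[OF U_funpow_tendsto_M[OF f, of 0] U_funpow_tendsto_M[OF g, of 0]]]) (simp add: U_funpow_add f g)

lemma M_cmult:
  assumes f: "circle_fun f" shows "M (\<lambda>x. c * f x) = c * M f"
  by (rule M_eqI[OF circle_fun_cmult[OF f] _ tendsto_mult_left[OF U_funpow_tendsto_M[OF f, of 0]]]) (simp add: U_funpow_cmult)

lemma M_const: "M (\<lambda>x. c) = c"
  by (rule M_eqI[OF circle_fun_const _ tendsto_const]) (simp add: U_funpow_const)

lemma M_U:
  assumes f: "circle_fun f" shows "M (U f) = M f"
  by (rule M_eqI[OF circle_fun_U[OF f] _ LIMSEQ_Suc[OF U_funpow_tendsto_M[OF f, of 0]]]) (simp add: funpow_Suc_right del: funpow.simps)

lemma M_sum: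
  assumes "finite I" "\<And>i. i \<in> I \<Longrightarrow> circle_fun (f i)"
  shows "M (\<lambda>x. \<Sum>i\<in>I. f i x) = (\<Sum>i\<in>I. M (f i))"
  using assms
proof (induction I rule: finite_induct)
  case (insert i I)
  then have "M (\<lambda>x. f i x + (\<Sum>i\<in>I. f i x)) = M (f i) + M (\<lambda>x. \<Sum>i\<in>I. f i x)"
    by (intro M_add circle_fun_sum) auto
  with insert show ?case by simp
qed (simp add: M_const)

lemma M_bounds:
  assumes f: "circle_fun f" and bd: "\<And>x. \<alpha> \<le> f x" "\<And>x. f x \<le> \<beta>"
  shows "\<alpha> \<le> M f" "M f \<le> \<beta>"
proof -
  note b = U_funpow_bounds[OF f bd]
  show "\<alpha> \<le> M f" using U_funpow_tendsto_M[OF f, of 0] by (rule LIMSEQ_le_const) (use b in blast)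
  show "M f \<le> \<beta>" using U_funpow_tendsto_M[OF f, of 0] by (rule LIMSEQ_le_const2) (use b in blast)
qed

text \<open>\<open>M\<close> does not change under one application of \<open>U\<close>, after which
  the function is bounded by the transition density times the size of \<open>B\<close>. This
  domination provides countable additivity.\<close>

lemma M_on_circle_le:
  assumes B: "B \<in> sets circle_measure"
  shows "ennreal (M (on_circle B)) \<le> ennreal dens_bound * emeasure circle_measure B"
proof -
  note f = circle_fun_on_circle[OF B]
  have nn: "0 \<le> on_circle B x" for x by (simp add: on_circle_def)
  define b where "b = dens_bound * measure circle_measure B"
  have b: "b \<ge> 0" using \<epsilon>_pos by (simp add: b_def dens_bound_def)
  have eb: "ennreal b = ennreal dens_bound * emeasure circle_measure B"
    using \<epsilon>_pos by (simp add: b_def circle.emeasure_eq_measure ennreal_mult dens_bound_def)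
  have "U (on_circle B) x \<le> b" for x
  proof -
    have "ennreal (U (on_circle B) x) = Unn (\<lambda>x. ennreal (on_circle B x)) x"
      using ennreal_U[OF f nn] by simp
    also have "\<dots> \<le> ennreal dens_bound * (\<integral>\<^sup>+y. on_circle B y \<partial>circle_measure)"
      using f by (intro Unn_le) (auto simp: circle_fun_def)
    also have "(\<integral>\<^sup>+y. on_circle B y \<partial>circle_measure) = (\<integral>\<^sup>+y. indicator B y \<partial>circle_measure)"
      using B by (intro nn_integral_cong) (auto simp: on_circle_eq space_circle_measure indicator_def)
    also have "\<dots> = emeasure circle_measure B" using B by simp
    finally show ?thesis using b by (simp add: eb[symmetric])
  qed
  moreover have "0 \<le> U (on_circle B) x" for x
    unfolding U_def using nn by (intro integral_nonneg_AE) simp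
  ultimately have "M (U (on_circle B)) \<le> b"
    using circle_fun_U[OF f] by (intro M_bounds)
  then show ?thesis using M_U[OF f] eb b by (simp add: ennreal_leI flip: eb)
qed

definition \<mu> :: "real measure" where
  "\<mu> = measure_of {0..<1} (sets circle_measure) (\<lambda>B. ennreal (M (on_circle B)))"

lemma sets_\<mu>: "sets \<mu> = sets circle_measure"
  unfolding \<mu>_def using sets.sets_measure_of_eq[of circle_measure] by (simp add: space_circle_measure)

text \<open>Since \<open>measure_of\<close> yields this value only for countably additive set
  functions, that property has to be proved. Finite additivity is linearity of \<open>M\<close>;
  along sets decreasing to the empty set, \<open>M_on_circle_le\<close> forces the values to
  0.\<close>

lemma emeasure_\<mu>:
  assumes B: "B \<in> sets circle_measure" shows "emeasure \<mu> B = ennreal (M (on_circle B))"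
proof -
  have M0: "0 \<le> M (on_circle B)" if "B \<in> sets circle_measure" for B
    using circle_fun_on_circle[OF that]
    by (rule M_bounds(1)[where \<beta> = 1]) (auto simp: on_circle_def indicator_def)
  have pos: "positive (sets circle_measure) (\<lambda>B. ennreal (M (on_circle B)))"
    by (auto simp: positive_def on_circle_def[abs_def] M_const)
  have add: "additive (sets circle_measure) (\<lambda>B. ennreal (M (on_circle B)))"
    unfolding additive_def
  proof (intro ballI impI)
    fix A B assume AB: "A \<in> sets circle_measure" "B \<in> sets circle_measure" "A \<inter> B = {}"
    have "on_circle (A \<union> B) = (\<lambda>x. on_circle A x + on_circle B x)"
      using AB(3) by (auto simp: on_circle_def indicator_def fun_eq_iff)
    then show "ennreal (M (on_circle (A \<union> B))) = ennreal (M (on_circle A)) + ennreal (M (on_circle B))"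
      using AB by (simp add: M_add circle_fun_on_circle M0)
  qed
  interpret S: ring_of_sets "{0..<1::real}" "sets circle_measure"
    using sets.ring_of_sets_axioms[of circle_measure] by (simp add: space_circle_measure)
  have "countably_additive (sets circle_measure) (\<lambda>B. ennreal (M (on_circle B)))"
  proof (rule S.empty_continuous_imp_countably_additive[OF pos add])
    fix A :: "nat \<Rightarrow> real set" assume A: "range A \<subseteq> sets circle_measure" "decseq A" "(\<Inter>i. A i) = {}"
    have "(\<lambda>i. emeasure circle_measure (A i)) \<longlonglongrightarrow> emeasure circle_measure (\<Inter>i. A i)"
      using A by (intro Lim_emeasure_decseq) auto
    then have "(\<lambda>i. ennreal dens_bound * emeasure circle_measure (A i)) \<longlonglongrightarrow> ennreal dens_bound * 0"
      using A(3) by (intro ennreal_tendsto_cmult) auto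
    then have lim: "(\<lambda>i. ennreal dens_bound * emeasure circle_measure (A i)) \<longlonglongrightarrow> 0" by simp
    have "ennreal (M (on_circle (A i))) \<le> ennreal dens_bound * emeasure circle_measure (A i)" for i
      using A(1) by (intro M_on_circle_le) auto
    then show "(\<lambda>i. ennreal (M (on_circle (A i)))) \<longlonglongrightarrow> 0"
      by (intro tendsto_sandwich[OF _ _ tendsto_const lim] always_eventually allI) simp_all
  qed auto
  then show ?thesis
    using pos B unfolding \<mu>_def
    by (intro emeasure_measure_of_sigma sets.sigma_algebra_axioms[of circle_measure, unfolded space_circle_measure])
qed

lemma prob_space_\<mu>: "prob_space \<mu>"
proof
  have "on_circle {0..<1} = (\<lambda>x. 1)" by (auto simp: on_circle_def frac_lt_1)
  moreover have "{0..<1} \<in> sets circle_measure" by (simp add: sets_circle_measure)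
  ultimately show "emeasure \<mu> (space \<mu>) = 1"
    using emeasure_\<mu> space_eq_unit[OF sets_\<mu>] by (simp add: M_const)
qed

text \<open>The sum counts the positive \<open>j\<close> with \<open>j \<le> k * t\<close>, so it is
  the floor of \<open>k * t\<close> divided by \<open>k\<close>.\<close>

lemma floor_as_indicator_sum:
  assumes "0 \<le> t" "t \<le> 1" "0 < k"
  shows "\<bar>t - (\<Sum>j=1..k. 1 / real k * indicator {real j / real k..} t)\<bar> \<le> 1 / real k"
proof -
  have kt: "0 \<le> real k * t" "real k * t \<le> real k" using assms by (auto simp: mult_left_le)
  define n where "n = nat \<lfloor>real k * t\<rfloor>"
  have n: "real n \<le> real k * t" "real k * t < real n + 1" using kt unfolding n_def by linarith+
  have "n \<le> k"
  proof -
    have "real n \<le> real k" using n(1) kt(2) by linarith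
    then show ?thesis by simp
  qed
  have "(\<Sum>j=1..k. 1 / real k * indicator {real j / real k..} t) = (\<Sum>j=1..k. if j \<le> n then 1 / real k else 0)"
  proof (intro sum.cong refl)
    fix j
    have "real j / real k \<le> t \<longleftrightarrow> j \<le> n"
    proof
      assume "real j / real k \<le> t"
      then have "real j < real n + 1" using n(2) assms(3) by (simp add: field_simps)
      then show "j \<le> n" by simp
    next
      assume "j \<le> n"
      then have "real j \<le> real k * t" using n(1) by linarith
      then show "real j / real k \<le> t" using assms(3) by (simp add: field_simps)
    qed
    then show "1 / real k * indicator {real j / real k..} t = (if j \<le> n then 1 / real k else 0)"
      by (simp add: indicator_def)
  qed
  also have "\<dots> = (\<Sum>j\<in>{1..n}. 1 / real k)"
    using \<open>n \<le> k\<close> by (intro sum.mono_neutral_cong_right) auto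
  also have "\<dots> = real n / real k" by simp
  finally have eq: "(\<Sum>j=1..k. 1 / real k * indicator {real j / real k..} t) = real n / real k" .
  have "real n / real k \<le> t" "t \<le> real n / real k + 1 / real k"
    using n assms(3) by (simp_all add: field_simps)
  then show ?thesis unfolding eq by simp
qed

text \<open>Both sides agree on indicators by construction, hence on the step function
  \<open>h\<close> built from the level sets of \<open>g\<close>. As \<open>h\<close> is uniformly
  within \<open>1 / k\<close> of \<open>g\<close>, each side changes by at most
  \<open>1 / k\<close>.\<close>

lemma integral_\<mu>:
  assumes g: "circle_fun g" and bd: "\<And>x. 0 \<le> g x" "\<And>x. g x \<le> 1"
  shows "(\<integral>x. g x \<partial>\<mu>) = M g"
proof -
  interpret \<mu>: prob_space \<mu> by (rule prob_space_\<mu>)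
  note [measurable] = circle_fun_measurable[OF g]
  have int: "integrable \<mu> f" if "circle_fun f" for f
    using integrable_circle_fun[OF that, of \<mu> "\<lambda>x. x"] sets_\<mu>
    by (simp add: \<mu>.finite_measure_axioms borel_measurable_circle)
  have close: "\<bar>(\<integral>x. g x \<partial>\<mu>) - M g\<bar> \<le> 2 / real k" if k: "0 < k" for k
  proof -
    define E where "E j = {x \<in> {0..<1}. real j / real k \<le> g x}" for j
    define h where "h x = (\<Sum>j=1..k. 1 / real k * on_circle (E j) x)" for x
    have E: "E j \<in> sets circle_measure" for j
      unfolding E_def by (auto simp: sets_circle_measure)
    have cf: "circle_fun (\<lambda>x. 1 / real k * on_circle (E j) x)" for j
      by (intro circle_fun_cmult circle_fun_on_circle E)
    have h: "circle_fun h" unfolding h_def[abs_def] using cf by (intro circle_fun_sum) auto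
    have E_on: "on_circle (E j) x = indicator {real j / real k..} (g x)" for j x
      using circle_fun_frac[OF g, of x] frac_in_unit[of x] by (auto simp: on_circle_def E_def indicator_def)
    have gh: "\<bar>g x - h x\<bar> \<le> 1 / real k" for x
      unfolding h_def E_on using bd k by (intro floor_as_indicator_sum) auto
    have "(\<integral>x. h x \<partial>\<mu>) = (\<Sum>j=1..k. (\<integral>x. 1 / real k * on_circle (E j) x \<partial>\<mu>))"
      unfolding h_def using cf int by (intro Bochner_Integration.integral_sum) auto
    also have "\<dots> = (\<Sum>j=1..k. M (\<lambda>x. 1 / real k * on_circle (E j) x))"
    proof (intro sum.cong refl)
      fix j
      have "(\<integral>x. on_circle (E j) x \<partial>\<mu>) = (\<integral>x. indicator (E j) x \<partial>\<mu>)"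
        using E space_eq_unit[OF sets_\<mu>] by (intro Bochner_Integration.integral_cong) (auto simp: on_circle_eq)
      also have "\<dots> = measure \<mu> (E j)" using E sets_\<mu> by simp
      also have "\<dots> = M (on_circle (E j))"
      proof -
        have "0 \<le> M (on_circle (E j))"
          by (rule M_bounds(1)[where \<beta> = 1, OF circle_fun_on_circle[OF E]])
             (auto simp: on_circle_def indicator_def)
        then show ?thesis using emeasure_\<mu>[OF E[of j]] by (simp add: measure_def)
      qed
      finally show "(\<integral>x. 1 / real k * on_circle (E j) x \<partial>\<mu>) = M (\<lambda>x. 1 / real k * on_circle (E j) x)"
        using M_cmult[OF circle_fun_on_circle[OF E], of "1 / real k" j] by simp
    qed
    also have "\<dots> = M h" unfolding h_def[abs_def] using cf by (intro M_sum[symmetric]) auto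
    finally have eq: "(\<integral>x. h x \<partial>\<mu>) = M h" .
    have neg: "circle_fun (\<lambda>x. - 1 * h x)" by (intro circle_fun_cmult h)
    have d: "circle_fun (\<lambda>x. g x + - 1 * h x)" using g neg by (rule circle_fun_add)
    have dbd: "- (1 / real k) \<le> g x + - 1 * h x" "g x + - 1 * h x \<le> 1 / real k" for x
      using gh[of x] by (auto simp: abs_le_iff)
    have "\<bar>M (\<lambda>x. g x + - 1 * h x)\<bar> \<le> 1 / real k"
      using M_bounds[OF d dbd] by (simp add: abs_le_iff)
    moreover have "M (\<lambda>x. g x + - 1 * h x) = M g - M h"
      using M_add[OF g neg] M_cmult[OF h, of "-1"] by simp
    moreover have "\<bar>\<integral>x. g x + - 1 * h x \<partial>\<mu>\<bar> \<le> 1 / real k"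
      using \<mu>.integral_le_const[OF int[OF d], of "1 / real k"] \<mu>.integral_ge_const[OF int[OF d], of "- (1 / real k)"] dbd
      by (simp add: abs_le_iff)
    moreover have "(\<integral>x. g x + - 1 * h x \<partial>\<mu>) = (\<integral>x. g x \<partial>\<mu>) - (\<integral>x. h x \<partial>\<mu>)"
      using int[OF g] int[OF h] by simp
    ultimately show ?thesis using eq by (simp add: abs_le_iff)
  qed
  have "(\<lambda>k. 2 / real (Suc k)) \<longlonglongrightarrow> 0"
    using LIMSEQ_Suc[OF lim_const_over_n[of 2]] by simp
  then have "\<bar>(\<integral>x. g x \<partial>\<mu>) - M g\<bar> \<le> 0"
    by (rule LIMSEQ_le_const) (use close[of "Suc _"] in blast)
  then show ?thesis by simp
qed

text \<open>By \<open>nn_integral_kick\<close> the averaged preimages have mass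
  \<open>M (U (on_circle B))\<close>, and \<open>M\<close> absorbs the \<open>U\<close>.\<close>

lemma invariant_\<mu>: "invariant \<mu>"
  unfolding invariant_def
proof (intro conjI ballI prob_space_\<mu> sets_\<mu>)
  interpret \<mu>: prob_space \<mu> by (rule prob_space_\<mu>)
  fix B assume B: "B \<in> sets circle_measure"
  note f = circle_fun_on_circle[OF B]
  have bd: "0 \<le> on_circle B x" "on_circle B x \<le> 1" for x by (auto simp: on_circle_def indicator_def)
  have Ubd: "0 \<le> U (on_circle B) x" "U (on_circle B) x \<le> 1" for x
    using U_funpow_bounds[OF f bd, of 1 x] by auto
  have "(\<integral>\<^sup>+\<omega>. emeasure \<mu> {x \<in> {0..<1}. frac (T x + \<omega>) \<in> B} \<partial>noise \<epsilon>)
      = (\<integral>\<^sup>+x. ennreal (U (on_circle B) x) \<partial>\<mu>)"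
    using nn_integral_kick[OF prob_space_\<mu> sets_\<mu> B] ennreal_U[OF f bd(1)] by simp
  also have "\<dots> = ennreal (\<integral>x. U (on_circle B) x \<partial>\<mu>)"
    using Ubd integrable_circle_fun[OF circle_fun_U[OF f], of \<mu> "\<lambda>x. x"] sets_\<mu>
    by (intro nn_integral_eq_integral) (auto simp: \<mu>.finite_measure_axioms borel_measurable_circle)
  also have "(\<integral>x. U (on_circle B) x \<partial>\<mu>) = M (on_circle B)"
    using integral_\<mu>[OF circle_fun_U[OF f] Ubd] M_U[OF f] by simp
  finally show "emeasure \<mu> B = (\<integral>\<^sup>+\<omega>. emeasure \<mu> {x \<in> {0..<1}. frac (T x + \<omega>) \<in> B} \<partial>noise \<epsilon>)"
    using emeasure_\<mu>[OF B] by simp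
qed

text \<open>For any invariant \<nu> the integral of \<open>(U ^^ j) (on_circle B)\<close> does not
  depend on \<open>j\<close>, while by dominated convergence it tends to the constant
  \<open>M (on_circle B)\<close>.\<close>

lemma invariant_unique:
  assumes inv: "invariant \<nu>" shows "\<nu> = \<mu>"
proof (rule measure_eqI)
  have \<nu>: "prob_space \<nu>" "sets \<nu> = sets circle_measure" using inv by (auto simp: invariant_def)
  interpret \<nu>: prob_space \<nu> by fact
  show "sets \<nu> = sets \<mu>" using \<nu> sets_\<mu> by simp
  fix B assume "B \<in> sets \<nu>"
  then have B: "B \<in> sets circle_measure" using \<nu> by simp
  note f = circle_fun_on_circle[OF B]
  have bd: "0 \<le> on_circle B x" "on_circle B x \<le> 1" for x by (auto simp: on_circle_def indicator_def)
  note Ubd = U_funpow_bounds[OF f bd]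
  have int: "integrable \<nu> ((U ^^ j) (on_circle B))" for j
    using integrable_circle_fun[OF circle_fun_funpow[OF f], of \<nu> "\<lambda>x. x"] \<nu>(2)
    by (simp add: \<nu>.finite_measure_axioms borel_measurable_circle)
  have step: "(\<integral>x. (U ^^ Suc j) (on_circle B) x \<partial>\<nu>) = (\<integral>x. (U ^^ j) (on_circle B) x \<partial>\<nu>)" for j
  proof -
    note fj = circle_fun_funpow[OF f, of j]
    have "ennreal (\<integral>x. (U ^^ j) (on_circle B) x \<partial>\<nu>) = (\<integral>\<^sup>+x. ennreal ((U ^^ j) (on_circle B) x) \<partial>\<nu>)"
      using int Ubd by (intro nn_integral_eq_integral[symmetric]) auto
    also have "\<dots> = (\<integral>\<^sup>+x. Unn (\<lambda>x. ennreal ((U ^^ j) (on_circle B) x)) x \<partial>\<nu>)"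
      using fj by (intro invariant_nn_integral inv) (auto simp: circle_fun_def)
    also have "\<dots> = (\<integral>\<^sup>+x. ennreal ((U ^^ Suc j) (on_circle B) x) \<partial>\<nu>)"
      using ennreal_U[OF fj] Ubd by simp
    also have "\<dots> = ennreal (\<integral>x. (U ^^ Suc j) (on_circle B) x \<partial>\<nu>)"
      by (intro nn_integral_eq_integral int AE_I2) (use Ubd in blast)
    finally have "ennreal (\<integral>x. (U ^^ j) (on_circle B) x \<partial>\<nu>) = ennreal (\<integral>x. (U ^^ Suc j) (on_circle B) x \<partial>\<nu>)" .
    moreover have "0 \<le> (\<integral>x. (U ^^ i) (on_circle B) x \<partial>\<nu>)" for i
      by (intro integral_nonneg_AE AE_I2) (use Ubd in blast)
    ultimately show ?thesis by (metis ennreal_inj)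
  qed
  have "(\<integral>x. (U ^^ j) (on_circle B) x \<partial>\<nu>) = (\<integral>x. on_circle B x \<partial>\<nu>)" for j
  proof (induction j)
    case (Suc j)
    then show ?case using step[of j] by simp
  qed simp
  moreover have "(\<lambda>j. (\<integral>x. (U ^^ j) (on_circle B) x \<partial>\<nu>)) \<longlonglongrightarrow> (\<integral>x. M (on_circle B) \<partial>\<nu>)"
  proof (rule integral_dominated_convergence[where w = "\<lambda>x. 1"])
    show "AE x in \<nu>. (\<lambda>j. (U ^^ j) (on_circle B) x) \<longlonglongrightarrow> M (on_circle B)"
      using U_funpow_tendsto_M[OF f] by simp
    show "AE x in \<nu>. norm ((U ^^ j) (on_circle B) x) \<le> 1" for j using Ubd by (auto simp: abs_le_iff intro: order_trans[of _ 0])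
  qed (use int in auto)
  ultimately have "(\<integral>x. on_circle B x \<partial>\<nu>) = M (on_circle B)"
    by (simp add: \<nu>.prob_space LIMSEQ_const_iff)
  moreover have "(\<integral>x. on_circle B x \<partial>\<nu>) = (\<integral>x. indicator B x \<partial>\<nu>)"
    using B space_eq_unit[OF \<nu>(2)] by (intro Bochner_Integration.integral_cong) (auto simp: on_circle_eq)
  moreover have "(\<integral>x. indicator B x \<partial>\<nu>) = measure \<nu> B" using B \<nu> by simp
  ultimately show "emeasure \<nu> B = emeasure \<mu> B"
    using emeasure_\<mu>[OF B] by (simp add: \<nu>.emeasure_eq_measure)
qed

text \<open>Conditioning on an invariant set of positive mass gives an invariant measure, which by
  uniqueness is \<mu> itself; evaluating at \<open>B\<close> gives mass 1.\<close>

lemma \<mu>_ergodic: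
  assumes B: "B \<in> sets circle_measure"
    and AE: "AE \<omega> in noise \<epsilon>. emeasure \<mu> ((B - {x \<in> {0..<1}. frac (T x + \<omega>) \<in> B})
                 \<union> ({x \<in> {0..<1}. frac (T x + \<omega>) \<in> B} - B)) = 0"
  shows "emeasure \<mu> B \<in> {0, 1}"
proof (cases "emeasure \<mu> B = 0")
  case False
  interpret \<mu>: prob_space \<mu> by (rule prob_space_\<mu>)
  have "uniform_measure \<mu> B = \<mu>"
    using invariant_uniform_measure[OF invariant_\<mu> B False AE] by (rule invariant_unique)
  moreover have "emeasure (uniform_measure \<mu> B) B = 1"
    using False \<mu>.emeasure_finite B sets_\<mu> by (simp add: ennreal_divide_self less_top[symmetric])
  ultimately show ?thesis by simp
qed simp

end

section \<open>Layer estimates for the logarithm\<close>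

text \<open>The series counts the \<open>j\<close> from 0 on that are at most
  \<open>- ln \<bar>t\<bar>\<close>, so it is no smaller than the rounded-up value. At
  \<open>t = 0\<close> all terms are 1 and both sides are infinite.\<close>

lemma log_abs_neg_le_suminf:
  "e2ennreal (- log_abs t) \<le> (\<Sum>j. indicator {t. \<bar>t\<bar> \<le> exp (- real j)} t)"
proof -
  define S :: ennreal where "S = (\<Sum>j. indicator {t. \<bar>t\<bar> \<le> exp (- real j)} t)"
  have S: "of_nat n \<le> S" if "\<And>j. j < n \<Longrightarrow> \<bar>t\<bar> \<le> exp (- real j)" for n
  proof -
    have "of_nat n = (\<Sum>j<n. indicator {t. \<bar>t\<bar> \<le> exp (- real j)} t :: ennreal)"
      using that by (simp add: indicator_def)
    also have "\<dots> \<le> S" unfolding S_def by (intro sum_le_suminf summableI) auto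
    finally show ?thesis .
  qed
  show ?thesis
  proof (cases "t = 0")
    case True
    have "S = top"
    proof (rule ccontr)
      assume "S \<noteq> top"
      then obtain n where "S < of_nat n" using ennreal_Ex_less_of_nat[of S] by (auto simp: less_top)
      then show False using S[of n] True by simp
    qed
    then show ?thesis by (simp add: S_def)
  next
    case False
    define n where "n = nat \<lceil>- ln \<bar>t\<bar>\<rceil>"
    have "\<bar>t\<bar> \<le> exp (- real j)" if "j < n" for j
    proof -
      have "real j \<le> - ln \<bar>t\<bar>" using that unfolding n_def by linarith
      then have "exp (ln \<bar>t\<bar>) \<le> exp (- real j)" by simp
      then show ?thesis using False by simp
    qed
    then have "of_nat n \<le> S" by (rule S)
    moreover have "ennreal (- ln \<bar>t\<bar>) \<le> of_nat n"
      unfolding n_def ennreal_of_nat_eq_real_of_nat by (intro ennreal_leI) linarith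
    ultimately have "ennreal (- ln \<bar>t\<bar>) \<le> S" by (rule order_trans[rotated])
    then show ?thesis
      using False by (simp add: log_abs_def S_def e2ennreal_ereal)
  qed
qed

text \<open>Each threshold passed contributes one \<open>ln s\<close>, as the logarithm of
  \<open>s\<^sup>2\<close> is \<open>2 * ln s\<close>.\<close>

lemma log_abs_pos_ge:
  assumes "1 \<le> s"
  shows "ennreal (ln s) * (indicator {t. s < \<bar>t\<bar>} t + indicator {t. s\<^sup>2 < \<bar>t\<bar>} t) \<le> e2ennreal (log_abs t)"
proof -
  have ss: "s \<le> s\<^sup>2" using assms by (simp add: power2_eq_square)
  have ln: "0 \<le> ln s" using assms by simp
  consider "\<bar>t\<bar> \<le> s" | "s < \<bar>t\<bar>" "\<bar>t\<bar> \<le> s\<^sup>2" | "s\<^sup>2 < \<bar>t\<bar>" by linarith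
  then show ?thesis
  proof cases
    case 1
    then show ?thesis using ss by (simp add: indicator_def)
  next
    case 2
    then have "ln s \<le> ln \<bar>t\<bar>" "t \<noteq> 0" using assms by auto
    then show ?thesis using 2 by (simp add: indicator_def log_abs_def e2ennreal_ereal ennreal_leI)
  next
    case 3
    then have "ln (s\<^sup>2) \<le> ln \<bar>t\<bar>" "t \<noteq> 0" using assms ss by (auto intro!: ln_mono simp del: ln_realpow)
    moreover have "ln (s\<^sup>2) = 2 * ln s" using assms by (simp add: ln_realpow)
    moreover have "ennreal (ln s) * (1 + 1) = ennreal (2 * ln s)"
      by (simp only: distrib_left mult_1_right mult_2 ennreal_plus[OF ln ln])
    moreover have "indicator {t. s < \<bar>t\<bar>} t = (1 :: ennreal)" "indicator {t. s\<^sup>2 < \<bar>t\<bar>} t = (1 :: ennreal)"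
      using 3 ss by (auto simp: indicator_def)
    moreover have "e2ennreal (log_abs t) = ennreal (ln \<bar>t\<bar>)"
      using \<open>t \<noteq> 0\<close> by (simp add: log_abs_def e2ennreal_ereal)
    ultimately show ?thesis by (simp only: ennreal_leI)
  qed
qed

section \<open>The Lyapunov exponent for admissible parameters\<close>

context morse_circle
begin

text \<open>Collects the lower bounds on \<open>L\<close> required by
  \<open>b_length_ge_curvature\<close>, \<open>oscillation\<close> and
  \<open>measure_small_dtau\<close>.\<close>

definition large :: "real \<Rightarrow> bool" where
  "large L \<longleftrightarrow> 1 \<le> L \<and> 4 \<le> L * \<kappa> * r \<and> 9 \<le> L * \<kappa> * r\<^sup>2 \<and> 4 \<le> L * m \<and> 2 \<le> L * m * r"

lemma T_spreading:
  assumes L: "large L" and \<epsilon>: "b_length \<psi> 2 L / 2 < \<epsilon>"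
  shows "spreading_circle_map (T L a) \<epsilon> (1 + L * K)"
proof
  note L' = L[unfolded large_def]
  have LK: "0 < L * K" using L' pos by simp
  show "T L a (x + 1) = T L a x + 1" for x by (simp add: T_def C2s(1))
  show "\<bar>T L a y - T L a x\<bar> \<le> (1 + L * K) * \<bar>y - x\<bar>" for x y
  proof -
    obtain z where z: "T L a y - T L a x = dtau \<psi> L z * (y - x)"
      using real_mean_value[of "T L a" "dtau \<psi> L" x y] T_deriv by blast
    have "\<bar>L * deriv \<psi> z\<bar> \<le> L * K" using L' bounds(1)[of z] by (simp add: abs_mult)
    then have "\<bar>dtau \<psi> L z\<bar> \<le> 1 + L * K" by (simp add: dtau_def)
    then show ?thesis unfolding z abs_mult by (rule mult_right_mono) simp
  qed
  show "0 < 1 + L * K" using LK by simp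
  show "0 < \<epsilon>"
  proof -
    obtain c where c: "deriv \<psi> c = 0" using critical_exists by blast
    have "0 \<le> 4 / (11 / 10 * (L * \<bar>deriv (deriv \<psi>) c\<bar>))" using L' by simp
    also have "\<dots> \<le> b_length \<psi> 2 L" using L' by (intro b_length_ge_curvature c) auto
    finally show ?thesis using \<epsilon> by simp
  qed
  show "\<exists>u\<in>{p..p + l}. \<exists>v\<in>{p..p + l}. min 1 (6 / 5 * l - 19 / 10 * \<epsilon>) \<le> T L a v - T L a u"
    if "0 < l" for p l
    using L' by (intro oscillation that \<epsilon>) auto
qed

text \<open>The lower bound on the component length makes 2\<epsilon> larger than the inverse of
  \<open>L\<close> times a curvature. Densities of invariant measures are therefore at most of order
  \<open>L\<close>.\<close>

lemma inverse_noise_le: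
  assumes L: "large L" and \<epsilon>: "b_length \<psi> 2 L / 2 < \<epsilon>"
  shows "1 / (2 * \<epsilon>) \<le> L * K"
proof -
  note L' = L[unfolded large_def]
  obtain c where c: "deriv \<psi> c = 0" using critical_exists by blast
  define k where "k = L * \<bar>deriv (deriv \<psi>) c\<bar>"
  have k: "0 < k" "k \<le> L * K"
    using L' bounds(2)[of c] curvature[OF c] pos by (auto simp: k_def)
  have "4 / (11 / 10 * k) < 2 * \<epsilon>"
    using b_length_ge_curvature[OF c, of L] L' \<epsilon> by (simp add: k_def)
  moreover have "1 / k \<le> 4 / (11 / 10 * k)" using k by (simp add: field_simps)
  ultimately have "1 / k < 2 * \<epsilon>" by linarith
  moreover have "0 < 1 / k" using k by simp
  ultimately have "0 < \<epsilon>" by linarith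
  have "1 < k * (2 * \<epsilon>)" using \<open>1 / k < 2 * \<epsilon>\<close> k by (simp add: field_simps)
  with \<open>0 < \<epsilon>\<close> have "1 / (2 * \<epsilon>) \<le> k" by (simp add: field_simps)
  then show ?thesis using k by simp
qed

lemma tau_kick_eq: "tau_kick \<psi> L a \<omega> x = frac (T L a x + \<omega>)"
proof -
  have eq: "frac (T L a x) + \<omega> = T L a x + \<omega> + of_int (- \<lfloor>T L a x\<rfloor>)" by (simp add: frac_def)
  have "frac (frac (T L a x) + \<omega>) = frac (T L a x + \<omega>)"
    unfolding eq by (rule periodic_of_int[of frac]) (simp add: frac_1_eq)
  then show ?thesis by (simp add: tau_kick_def tau_def T_def)
qed

lemma kick_preimage_eq: "kick_preimage \<psi> L a \<omega> B = {x \<in> {0..<1}. frac (T L a x + \<omega>) \<in> B}"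
  by (simp add: kick_preimage_def tau_kick_eq)

lemma invariant_measure_iff:
  assumes "noisy_circle_map (T L a) \<epsilon> \<Lambda>"
  shows "invariant_measure \<psi> L a \<epsilon> \<nu> \<longleftrightarrow> noisy_circle_map.invariant (T L a) \<epsilon> \<nu>"
  by (simp add: invariant_measure_def noisy_circle_map.invariant_def[OF assms] kick_preimage_eq)

lemma unique_ergodic_measure:
  assumes L: "large L" and \<epsilon>: "b_length \<psi> 2 L / 2 < \<epsilon>"
  shows "\<exists>\<mu>. ergodic_invariant_measure \<psi> L a \<epsilon> \<mu> \<and>
    (\<forall>\<nu>. ergodic_invariant_measure \<psi> L a \<epsilon> \<nu> \<longrightarrow> \<nu> = \<mu>)"
proof -
  interpret spreading_circle_map "T L a" \<epsilon> "1 + L * K" by (rule T_spreading[OF L \<epsilon>])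
  have iff: "invariant_measure \<psi> L a \<epsilon> \<nu> \<longleftrightarrow> invariant \<nu>" for \<nu>
    by (rule invariant_measure_iff) (rule noisy_circle_map_axioms)
  have "ergodic_invariant_measure \<psi> L a \<epsilon> \<mu>"
    unfolding ergodic_invariant_measure_def iff kick_preimage_eq
    by (intro conjI ballI impI invariant_\<mu>) (rule \<mu>_ergodic)
  moreover have "\<nu> = \<mu>" if "ergodic_invariant_measure \<psi> L a \<epsilon> \<nu>" for \<nu>
    using that invariant_unique unfolding ergodic_invariant_measure_def iff by blast
  ultimately show ?thesis by blast
qed

text \<open>The parameters for which the critical point \<open>c\<close> is mapped exactly to
  \<open>c'\<close>. There is one for each ordered pair, which is the source of the bound by the
  square of the number of critical points.\<close>

definition avoided_parameters :: "real \<Rightarrow> real set" where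
  "avoided_parameters L =
     (\<lambda>(c, c'). frac (c' - c - L * \<psi> c)) ` (critical_points \<psi> \<times> critical_points \<psi>)"

lemma avoided_parameters:
  "finite (avoided_parameters L)" "avoided_parameters L \<noteq> {}" "avoided_parameters L \<subseteq> {0..<1}"
  "card (avoided_parameters L) \<le> (card (critical_points \<psi>))\<^sup>2"
proof -
  show "finite (avoided_parameters L)" "avoided_parameters L \<noteq> {}"
    using fin ne by (auto simp: avoided_parameters_def)
  show "avoided_parameters L \<subseteq> {0..<1}" by (auto simp: avoided_parameters_def frac_lt_1)
  show "card (avoided_parameters L) \<le> (card (critical_points \<psi>))\<^sup>2"
    unfolding avoided_parameters_def power2_eq_square card_cartesian_product[symmetric]
    using fin by (intro card_image_le finite_cartesian_product)
qed

text \<open>Modulo 1 the difference \<open>T L a c - c'\<close> equals \<open>a - p\<close> for the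
  avoided parameter \<open>p\<close> of the pair. The conclusion holds for all lifts
  \<open>c'\<close>, so it bounds the distance on the circle.\<close>

lemma critical_image_far:
  assumes a: "a \<in> centres_avoided \<delta> (avoided_parameters L)" and c: "deriv \<psi> c = 0" "deriv \<psi> c' = 0"
    and \<delta>: "\<delta> \<le> 1"
  shows "\<delta> \<le> \<bar>T L a c - c'\<bar>"
proof (rule ccontr)
  assume less: "\<not> \<delta> \<le> \<bar>T L a c - c'\<bar>"
  have crit: "frac c \<in> critical_points \<psi>" if "deriv \<psi> c = 0" for c
    using that frac_in_unit[of c] periodic_frac[of "deriv \<psi>" c] C2s(7) by (simp add: critical_points_def)
  define p where "p = frac (frac c' - frac c - L * \<psi> (frac c))"
  have "p \<in> avoided_parameters L"
    using crit[OF c(1)] crit[OF c(2)] unfolding avoided_parameters_def p_def by force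
  then have ap: "\<delta> \<le> frac (a - p)" "frac (a - p) \<le> 1 - \<delta>" using a by (auto simp: centres_avoided_def)
  have eq: "a - p = (T L a c - c') + of_int (\<lfloor>c'\<rfloor> - \<lfloor>c\<rfloor> + \<lfloor>frac c' - frac c - L * \<psi> (frac c)\<rfloor>)"
    using periodic_frac[of \<psi> c] C2s(1) by (simp add: p_def T_def frac_def)
  have z: "frac (a - p) = frac (T L a c - c')"
    unfolding eq by (rule periodic_of_int[of frac]) (simp add: frac_1_eq)
  show False
  proof (cases "0 \<le> T L a c - c'")
    case True
    then have "frac (T L a c - c') = T L a c - c'" using less \<delta> by (intro frac_eqI[where k = 0]) auto
    then show False using ap(1) z less True by simp
  next
    case False
    then have "frac (T L a c - c') = T L a c - c' + 1" using less \<delta> by (intro frac_eqI[where k = "-1"]) auto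
    then show False using ap(2) z less False by simp
  qed
qed

text \<open>
  A point with small derivative lies near a critical point, whose image is \<open>\<delta>\<close>-far from the
  critical set; one more step therefore meets a derivative of size \<open>s\<^sup>2\<close>.
\<close>

lemma small_dtau_maps_to_large_dtau:
  assumes a: "a \<in> centres_avoided \<delta> (avoided_parameters L)" and L: "1 \<le> L"
    and \<delta>: "0 < \<delta>" "\<delta> \<le> 1" "9 / 20 * \<kappa> * \<delta> \<le> m" "\<delta> \<le> \<kappa> / 5" "6 * K * \<delta> \<le> \<kappa>\<^sup>2 / 8"
    and s: "s = \<delta> * sqrt L" "1 \<le> s" "s + 1 < L * m"
    and sL: "18 \<le> \<kappa> * sqrt L"
    and x: "\<bar>dtau \<psi> L x\<bar> \<le> s" and \<omega>: "\<bar>\<omega>\<bar> \<le> \<delta> / 4"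
  shows "s\<^sup>2 < \<bar>dtau \<psi> L (frac (T L a x + \<omega>))\<bar>"
proof -
  have s2: "s\<^sup>2 = \<delta>\<^sup>2 * L" using L s by (simp add: power_mult_distrib)
  have sq: "sqrt L * sqrt L = L" "0 < sqrt L" using L by simp_all
  have lower: "9 / 10 * \<kappa> * \<bar>y - c\<bar> \<le> \<bar>deriv \<psi> y\<bar>" if cy: "deriv \<psi> c = 0" "\<bar>y - c\<bar> < r" for y c
  proof -
    obtain q where q: "\<bar>q - deriv (deriv \<psi>) c\<bar> \<le> \<bar>deriv (deriv \<psi>) c\<bar> / 10" "deriv \<psi> y = q * (y - c)"
    proof -
      have "\<bar>y - c\<bar> \<le> 2 * r" using cy(2) pos by linarith
      then show ?thesis using deriv_near_critical[OF cy(1), of y] that by blast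
    qed
    have "9 / 10 * \<kappa> \<le> \<bar>q\<bar>" using q(1) curvature[OF cy(1)] by linarith
    then show ?thesis unfolding q(2) abs_mult by (rule mult_right_mono) simp
  qed
  have "\<bar>L * deriv \<psi> x\<bar> \<le> s + 1" using x by (simp add: dtau_def)
  then have Lx: "L * \<bar>deriv \<psi> x\<bar> \<le> s + 1" using L by (simp add: abs_mult)
  then have "L * \<bar>deriv \<psi> x\<bar> < L * m" using s(3) by linarith
  then have "\<bar>deriv \<psi> x\<bar> < m" using L by simp
  then obtain c where c: "deriv \<psi> c = 0" "\<bar>x - c\<bar> < r" using far by blast
  \<comment> \<open>Since \<open>L\<close> times the derivative is at most \<open>2 * s\<close>, the
    distance \<open>d\<close> to the critical point is of order \<delta> divided by \<kappa> and
    \<open>sqrt L\<close>.\<close>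
  define d where "d = \<bar>x - c\<bar>"
  have "L * (9 / 10 * \<kappa> * d) \<le> 2 * s"
  proof -
    have "L * (9 / 10 * \<kappa> * \<bar>x - c\<bar>) \<le> L * \<bar>deriv \<psi> x\<bar>"
      using lower[OF c] L by (intro mult_left_mono) auto
    then show ?thesis using Lx s(2) unfolding d_def by linarith
  qed
  moreover have "sqrt L * (sqrt L * (\<kappa> * d)) = L * (\<kappa> * d)"
    by (simp only: mult.assoc[symmetric] sq(1))
  moreover have "sqrt L * (20 / 9 * \<delta>) = 20 / 9 * s" by (simp add: s(1))
  moreover have "L * (9 / 10 * \<kappa> * d) = 9 / 10 * (L * (\<kappa> * d))" by (simp only: mult_ac)
  ultimately have "sqrt L * (sqrt L * (\<kappa> * d)) \<le> sqrt L * (20 / 9 * \<delta>)" by linarith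
  then have d: "sqrt L * (\<kappa> * d) \<le> 20 / 9 * \<delta>" using sq by simp
  have d0: "0 \<le> d" by (simp add: d_def)
  have "18 * d \<le> \<kappa> * sqrt L * d" using sL d0 by (intro mult_right_mono)
  then have d1: "d \<le> \<delta> / 8" using d \<delta>(1) by (simp add: mult_ac)
  have "(sqrt L * (\<kappa> * d))\<^sup>2 \<le> (20 / 9 * \<delta>)\<^sup>2" using d d0 pos sq(2) by (intro power_mono mult_nonneg_nonneg) auto
  then have Ld: "\<kappa>\<^sup>2 * (L * d\<^sup>2) \<le> 400 / 81 * \<delta>\<^sup>2"
    using L by (simp add: power_mult_distrib power_divide mult_ac)
  \<comment> \<open>The derivative of \<open>T L a\<close> between \<open>c\<close> and
    \<open>x\<close> is at most 1 plus a multiple of \<open>L * d\<close>, so the images differ by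
    at most \<open>d\<close> plus a multiple of \<open>L * d\<^sup>2\<close>, which is quadratic in
    \<delta>.\<close>
  obtain \<xi> where \<xi>: "min c x \<le> \<xi>" "\<xi> \<le> max c x" "T L a x - T L a c = dtau \<psi> L \<xi> * (x - c)"
    using real_mean_value[of "T L a" "dtau \<psi> L" c x] T_deriv by blast
  have \<xi>d: "\<bar>\<xi> - c\<bar> \<le> d" using \<xi> by (auto simp: d_def)
  obtain q where q: "\<bar>q - deriv (deriv \<psi>) c\<bar> \<le> \<bar>deriv (deriv \<psi>) c\<bar> / 10" "deriv \<psi> \<xi> = q * (\<xi> - c)"
  proof -
    have "\<bar>\<xi> - c\<bar> \<le> 2 * r" using \<xi>d c(2) pos unfolding d_def by linarith
    then show ?thesis using deriv_near_critical[OF c(1), of \<xi>] that by blast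
  qed
  have "\<bar>q\<bar> \<le> 11 / 10 * K" using q(1) bounds(2)[of c] by linarith
  then have "\<bar>q\<bar> * \<bar>\<xi> - c\<bar> \<le> 11 / 10 * K * d" using \<xi>d pos by (intro mult_mono) auto
  then have "L * \<bar>deriv \<psi> \<xi>\<bar> \<le> L * (11 / 10 * K * d)" using L unfolding q(2) abs_mult by simp
  then have "\<bar>L * deriv \<psi> \<xi>\<bar> \<le> L * (11 / 10 * K * d)" using L by (simp add: abs_mult)
  then have "\<bar>dtau \<psi> L \<xi>\<bar> \<le> 1 + L * (11 / 10 * K * d)" unfolding dtau_def by linarith
  then have "\<bar>T L a x - T L a c\<bar> \<le> (1 + L * (11 / 10 * K * d)) * d"
    unfolding \<xi>(3) abs_mult d_def by (rule mult_right_mono) simp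
  also have "\<dots> = d + 11 / 10 * K * (L * d\<^sup>2)" by (simp add: power2_eq_square algebra_simps)
  also have "11 / 10 * K * (L * d\<^sup>2) \<le> \<delta> / 8"
  proof -
    have "\<kappa>\<^sup>2 * (11 / 10 * K * (L * d\<^sup>2)) \<le> 11 / 10 * K * (400 / 81 * \<delta>\<^sup>2)"
      using mult_left_mono[OF Ld, of "11 / 10 * K"] pos by (simp add: mult_ac)
    \<comment> \<open>The product 11/10 * 400/81 is below 6, which explains the constant in the
      hypothesis on \<delta>.\<close>
    also have "\<dots> \<le> (6 * K * \<delta>) * \<delta>" using pos \<delta>(1) by (simp add: power2_eq_square)
    also have "\<dots> \<le> \<kappa>\<^sup>2 / 8 * \<delta>" using \<delta> by (intro mult_right_mono) auto
    finally have "\<kappa>\<^sup>2 * (11 / 10 * K * (L * d\<^sup>2)) \<le> \<kappa>\<^sup>2 * (\<delta> / 8)" by simp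
    then show ?thesis using pos by (subst (asm) mult_le_cancel_left_pos) auto
  qed
  finally have Tx: "\<bar>T L a x - T L a c\<bar> \<le> \<delta> / 4" using d1 by simp
  define y where "y = T L a x + \<omega>"
  \<comment> \<open>The image of \<open>c\<close> is \<delta>-far from \<open>c'\<close>; the
    displacement of the image and the kick use up at most \<delta>/4 each.\<close>
  have yc: "\<delta> / 2 \<le> \<bar>y - c'\<bar>" if "deriv \<psi> c' = 0" for c'
    using critical_image_far[OF a c(1) that \<delta>(2)] Tx \<omega> unfolding y_def by linarith
  have "9 / 20 * \<kappa> * \<delta> \<le> \<bar>deriv \<psi> y\<bar>"
  proof (cases "\<bar>deriv \<psi> y\<bar> < m")
    case True
    then obtain c' where c': "deriv \<psi> c' = 0" "\<bar>y - c'\<bar> < r" using far by blast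
    have "9 / 10 * \<kappa> * (\<delta> / 2) \<le> 9 / 10 * \<kappa> * \<bar>y - c'\<bar>"
      using yc[OF c'(1)] pos by (intro mult_left_mono) auto
    moreover have "9 / 10 * \<kappa> * (\<delta> / 2) = 9 / 20 * \<kappa> * \<delta>" by simp
    ultimately show ?thesis using lower[OF c'] by linarith
  qed (use \<delta>(3) in linarith)
  then have "L * (9 / 20 * \<kappa> * \<delta>) \<le> \<bar>L * deriv \<psi> y\<bar>" using L by (simp add: abs_mult)
  then have low: "9 / 20 * (L * \<kappa> * \<delta>) - 1 \<le> \<bar>dtau \<psi> L y\<bar>" unfolding dtau_def by (simp add: mult_ac)
  \<comment> \<open>With \<open>L * \<kappa> * \<delta>\<close> at least 18, the difference between
    the factors 9/20 and 1/5 outweighs the 1 lost in \<open>low\<close>.\<close>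
  have "18 * 1 \<le> \<kappa> * sqrt L * s" using sL s(2) by (intro mult_mono) auto
  also have "\<kappa> * sqrt L * s = (sqrt L * sqrt L) * \<kappa> * \<delta>" by (simp add: s(1) mult_ac)
  finally have k18: "18 \<le> L * \<kappa> * \<delta>" unfolding sq by simp
  have "\<delta>\<^sup>2 * L = L * \<delta> * \<delta>" by (simp add: power2_eq_square)
  also have "\<dots> \<le> L * \<delta> * (\<kappa> / 5)" using \<delta> L by (intro mult_left_mono) auto
  finally have "s\<^sup>2 \<le> 1 / 5 * (L * \<kappa> * \<delta>)" unfolding s2 by (simp add: mult_ac)
  then have "s\<^sup>2 < \<bar>dtau \<psi> L y\<bar>" using low k18 by linarith
  moreover have "dtau \<psi> L (frac y) = dtau \<psi> L y"
    using C2s(7) by (intro periodic_frac) (simp add: dtau_def)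
  ultimately show ?thesis by (simp add: y_def)
qed

text \<open>One constant serves all \<open>L\<close>, \<open>a\<close> and \<epsilon>. The term
  \<open>C / sqrt L\<close> is the mass that may be missing in the positive part when the noise is
  large; the subtracted \<open>C\<close> bounds the negative part.\<close>

lemma lyapunov_bound:
  "\<exists>C>0. \<forall>L a \<epsilon> \<nu> s \<delta>. large L \<longrightarrow> b_length \<psi> 2 L / 2 < \<epsilon> \<longrightarrow> invariant_measure \<psi> L a \<epsilon> \<nu> \<longrightarrow>
     a \<in> centres_avoided \<delta> (avoided_parameters L) \<longrightarrow>
     0 < \<delta> \<and> \<delta> \<le> 1 \<and> 9 / 20 * \<kappa> * \<delta> \<le> m \<and> \<delta> \<le> \<kappa> / 5 \<and> 6 * K * \<delta> \<le> \<kappa>\<^sup>2 / 8 \<longrightarrow>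
     s = \<delta> * sqrt L \<and> 1 \<le> s \<and> s + 1 < L * m \<and> 18 \<le> \<kappa> * sqrt L \<longrightarrow> C \<le> sqrt L \<longrightarrow>
     ereal (ln s * (1 - C / sqrt L) - C) \<le> lyapunov_exponent \<psi> L \<nu>"
proof -
  obtain C where C: "C > 0" "\<And>L s. 0 < L \<Longrightarrow> 4 \<le> L * m \<Longrightarrow> 0 \<le> s \<Longrightarrow>
      emeasure lborel {x \<in> {0..<1}. \<bar>dtau \<psi> L x\<bar> \<le> s} \<le> ennreal (C * s / L)"
    using measure_small_dtau by blast
  define G where "G = 1 / (1 - exp (- 1 :: real))"
  have G: "G > 0" by (simp add: G_def)
  define C' where "C' = max (5 * C) ((1 + K) * C * G)"
  have C': "C' > 0" "5 * C \<le> C'" "(1 + K) * C * G \<le> C'" using C(1) by (auto simp: C'_def)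
  have bound: "ereal (ln s * (1 - C' / sqrt L) - C') \<le> lyapunov_exponent \<psi> L \<nu>"
    if L: "large L" and \<epsilon>: "b_length \<psi> 2 L / 2 < \<epsilon>" and inv: "invariant_measure \<psi> L a \<epsilon> \<nu>"
      and a: "a \<in> centres_avoided \<delta> (avoided_parameters L)"
      and \<delta>: "0 < \<delta>" "\<delta> \<le> 1" "9 / 20 * \<kappa> * \<delta> \<le> m" "\<delta> \<le> \<kappa> / 5" "6 * K * \<delta> \<le> \<kappa>\<^sup>2 / 8"
      and s: "s = \<delta> * sqrt L" "1 \<le> s" "s + 1 < L * m" "18 \<le> \<kappa> * sqrt L" and C'L: "C' \<le> sqrt L"
    for L a \<epsilon> \<nu> s \<delta>
  proof -
    interpret spreading_circle_map "T L a" \<epsilon> "1 + L * K" by (rule T_spreading[OF L \<epsilon>])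
    have inv': "invariant \<nu>" using inv invariant_measure_iff[OF noisy_circle_map_axioms] by simp
    then have \<nu>: "prob_space \<nu>" "sets \<nu> = sets circle_measure" by (auto simp: invariant_def)
    interpret \<nu>: prob_space \<nu> by fact
    have L1: "1 \<le> L" "4 \<le> L * m" using L by (auto simp: large_def)
    define E where "E t = {x \<in> {0..<1}. \<bar>dtau \<psi> L x\<bar> \<le> t}" for t
    define F where "F t = {x \<in> {0..<1}. t < \<bar>dtau \<psi> L x\<bar>}" for t
    have [measurable]: "dtau \<psi> L \<in> borel_measurable borel"
      unfolding dtau_def[abs_def] using C2s(5)[THEN borel_measurable_continuous_onI] by measurable
    have Ec: "E t \<in> sets circle_measure" and Fc: "F t \<in> sets circle_measure" for t
      unfolding E_def F_def by (auto simp: sets_circle_measure)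
    have Em: "E t \<in> sets \<nu>" and Fm: "F t \<in> sets \<nu>" for t using Ec Fc \<nu>(2) by auto
    have D0: "0 \<le> dens_bound" using \<epsilon>_pos by (simp add: dens_bound_def)
    have mE: "measure \<nu> (E t) \<le> dens_bound * (C * t / L)" if "0 \<le> t" for t
    proof -
      have "emeasure \<nu> (E t) \<le> ennreal dens_bound * emeasure circle_measure (E t)"
        using inv' Ec by (rule invariant_le_density)
      also have "emeasure circle_measure (E t) = emeasure lborel (E t)"
        using Ec[of t] by (intro emeasure_circle_measure) (auto simp: sets_circle_measure)
      also have "ennreal dens_bound * \<dots> \<le> ennreal dens_bound * ennreal (C * t / L)"
        unfolding E_def using C(2)[of L t] L1 that by (intro mult_left_mono) auto
      also have "\<dots> = ennreal (dens_bound * (C * t / L))"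
        using D0 by (intro ennreal_mult'[symmetric])
      finally show ?thesis
        using D0 C(1) L1 that by (simp add: \<nu>.emeasure_eq_measure)
    qed
    have D_le: "dens_bound \<le> (1 + K) * L"
      using inverse_noise_le[OF L \<epsilon>] L1 pos by (simp add: dens_bound_def algebra_simps)
    have neg: "(\<integral>\<^sup>+x. e2ennreal (- log_abs (dtau \<psi> L x)) \<partial>\<nu>) \<le> ennreal C'"
    proof -
      have "(\<integral>\<^sup>+x. e2ennreal (- log_abs (dtau \<psi> L x)) \<partial>\<nu>)
          \<le> (\<integral>\<^sup>+x. (\<Sum>j. indicator (E (exp (- real j))) x) \<partial>\<nu>)"
      proof (rule nn_integral_mono)
        fix x assume "x \<in> space \<nu>"
        then have x: "x \<in> {0..<1}" using space_eq_unit[OF \<nu>(2)] by simp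
        have "indicator {t. \<bar>t\<bar> \<le> exp (- real j)} (dtau \<psi> L x) = (indicator (E (exp (- real j))) x :: ennreal)" for j
          using x by (auto simp: E_def indicator_def)
        then show "e2ennreal (- log_abs (dtau \<psi> L x)) \<le> (\<Sum>j. indicator (E (exp (- real j))) x)"
          using log_abs_neg_le_suminf[of "dtau \<psi> L x"] by simp
      qed
      also have "\<dots> = (\<Sum>j. emeasure \<nu> (E (exp (- real j))))"
        using Em by (subst nn_integral_suminf) auto
      \<comment> \<open>The density bound is at most \<open>(1 + K) * L\<close>, which cancels the
        factor \<open>1 / L\<close> from \<open>measure_small_dtau\<close>; a geometric series with
        sum \<open>G\<close> remains.\<close>
      also have "\<dots> \<le> (\<Sum>j. ennreal ((1 + K) * C * exp (- 1) ^ j))"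
      proof (intro suminf_le summableI)
        fix j
        have "measure \<nu> (E (exp (- real j))) \<le> dens_bound * (C * exp (- real j) / L)" by (rule mE) simp
        also have "\<dots> \<le> ((1 + K) * L) * (C * exp (- real j) / L)"
          using D_le C(1) L1 by (intro mult_right_mono) auto
        also have "\<dots> = (1 + K) * C * exp (- 1) ^ j"
          using L1 exp_of_nat_mult[of j "- 1 :: real"] by simp
        finally show "emeasure \<nu> (E (exp (- real j))) \<le> ennreal ((1 + K) * C * exp (- 1) ^ j)"
          by (simp add: \<nu>.emeasure_eq_measure ennreal_leI)
      qed
      also have "\<dots> = ennreal (\<Sum>j. (1 + K) * C * exp (- 1) ^ j)"
        using C(1) pos by (intro suminf_ennreal2 summable_mult summable_geometric) auto
      also have "(\<Sum>j. (1 + K) * C * exp (- 1 :: real) ^ j) = (1 + K) * C * G"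
        unfolding G_def by (subst suminf_mult) (auto simp: suminf_geometric summable_geometric)
      also have "ennreal \<dots> \<le> ennreal C'" using C' by (intro ennreal_leI)
      finally show ?thesis .
    qed
    have compl: "measure \<nu> (F s) = 1 - measure \<nu> (E s)"
    proof -
      have "F s = space \<nu> - E s" unfolding space_eq_unit[OF \<nu>(2)] F_def E_def by auto
      then show ?thesis by (simp only: \<nu>.prob_compl[OF Em])
    qed
    \<comment> \<open>For weak noise, the mass missing in \<open>F s\<close> is that of
      \<open>E s\<close>, which is carried into \<open>F (s\<^sup>2)\<close> by one step. For
      stronger noise, \<open>E s\<close> itself has small mass.\<close>
    have mass: "1 - C' / sqrt L \<le> measure \<nu> (F s) + measure \<nu> (F (s\<^sup>2))"
    proof (cases "\<epsilon> \<le> \<delta> / 4")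
      case True
      have "emeasure \<nu> (E s) \<le> emeasure \<nu> (F (s\<^sup>2))"
      proof (rule invariant_transport[OF inv' Ec Fc])
        fix x \<omega> assume x: "x \<in> E s" and \<omega>: "\<bar>\<omega>\<bar> \<le> \<epsilon>"
        have "s\<^sup>2 < \<bar>dtau \<psi> L (frac (T L a x + \<omega>))\<bar>"
          using x \<omega> True by (intro small_dtau_maps_to_large_dtau[OF a L1(1) \<delta> s]) (auto simp: E_def)
        then show "frac (T L a x + \<omega>) \<in> F (s\<^sup>2)" by (simp add: F_def frac_lt_1)
      qed
      then have "measure \<nu> (E s) \<le> measure \<nu> (F (s\<^sup>2))" by (simp add: \<nu>.emeasure_eq_measure)
      moreover have "0 \<le> C' / sqrt L" using C' L1 by simp
      ultimately show ?thesis unfolding compl by linarith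
    next
      case False
      have "1 / (2 * \<epsilon>) \<le> 1 / (\<delta> / 2)" using False \<delta>(1) by (intro divide_left_mono) auto
      moreover have "1 \<le> 1 / \<delta>" using \<delta> by simp
      ultimately have "dens_bound \<le> 3 / \<delta>" by (simp add: dens_bound_def)
      \<comment> \<open>As \<open>s\<close> is \<delta> times \<open>sqrt L\<close>, the factor
        \<delta> cancels and a bound of order \<open>1 / sqrt L\<close> is left.\<close>
      then have "dens_bound * (C * s / L) \<le> 3 / \<delta> * (C * s / L)"
        using C(1) s(2) L1 by (intro mult_right_mono) auto
      also have "\<dots> = 3 * C * (sqrt L / L)" using \<delta>(1) by (simp add: s(1))
      also have "sqrt L / L = 1 / sqrt L" using L1 by (simp add: field_simps)
      also have "3 * C * (1 / sqrt L) = 3 * C / sqrt L" by simp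
      also have "\<dots> \<le> C' / sqrt L" using C' C(1) L1 by (intro divide_right_mono) auto
      finally have "measure \<nu> (E s) \<le> C' / sqrt L" using mE[of s] s(2) by simp
      then show ?thesis unfolding compl using measure_nonneg[of \<nu> "F (s\<^sup>2)"] by linarith
    qed
    have ln0: "0 \<le> ln s" using s(2) by simp
    have C'1: "0 \<le> 1 - C' / sqrt L" using C'L L1 by simp
    have posint: "ennreal (ln s * (1 - C' / sqrt L)) \<le> (\<integral>\<^sup>+x. e2ennreal (log_abs (dtau \<psi> L x)) \<partial>\<nu>)"
    proof -
      have "ennreal (ln s * (1 - C' / sqrt L)) \<le> ennreal (ln s * (measure \<nu> (F s) + measure \<nu> (F (s\<^sup>2))))"
        using mass ln0 by (intro ennreal_leI mult_left_mono)
      also have "\<dots> = ennreal (ln s) * (emeasure \<nu> (F s) + emeasure \<nu> (F (s\<^sup>2)))"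
        using ln0 by (simp add: \<nu>.emeasure_eq_measure ennreal_mult' ennreal_plus)
      also have "\<dots> = (\<integral>\<^sup>+x. ennreal (ln s) * (indicator (F s) x + indicator (F (s\<^sup>2)) x) \<partial>\<nu>)"
        using Fm by (simp add: nn_integral_cmult nn_integral_add)
      also have "\<dots> \<le> (\<integral>\<^sup>+x. e2ennreal (log_abs (dtau \<psi> L x)) \<partial>\<nu>)"
      proof (rule nn_integral_mono)
        fix x assume "x \<in> space \<nu>"
        then have x: "x \<in> {0..<1}" using space_eq_unit[OF \<nu>(2)] by simp
        have "indicator (F t) x = (indicator {y. t < \<bar>y\<bar>} (dtau \<psi> L x) :: ennreal)" for t
          using x by (auto simp: F_def indicator_def)
        then show "ennreal (ln s) * (indicator (F s) x + indicator (F (s\<^sup>2)) x) \<le> e2ennreal (log_abs (dtau \<psi> L x))"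
          using log_abs_pos_ge[OF s(2), of "dtau \<psi> L x"] by simp
      qed
      finally show ?thesis .
    qed
    \<comment> \<open>Nonnegativity is required because \<open>ennreal\<close> sends negative
      numbers to 0.\<close>
    have p0: "0 \<le> ln s * (1 - C' / sqrt L)" using ln0 C'1 by simp
    have "ereal (ln s * (1 - C' / sqrt L)) \<le> enn2ereal (\<integral>\<^sup>+x. e2ennreal (log_abs (dtau \<psi> L x)) \<partial>\<nu>)"
      using posint p0 by (metis enn2ereal_ennreal less_eq_ennreal.rep_eq)
    moreover have "enn2ereal (\<integral>\<^sup>+x. e2ennreal (- log_abs (dtau \<psi> L x)) \<partial>\<nu>) \<le> ereal C'"
      using neg C'(1) by (metis enn2ereal_ennreal less_eq_ennreal.rep_eq less_imp_le)
    ultimately have "ereal (ln s * (1 - C' / sqrt L)) - ereal C' \<le> lyapunov_exponent \<psi> L \<nu>"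
      unfolding lyapunov_exponent_def by (rule ereal_minus_mono)
    then show ?thesis by simp
  qed
  show ?thesis
    by (intro exI[of _ C'] conjI allI impI C'(1)) (elim conjE, rule bound; assumption)
qed

section \<open>Asymptotic choice of scales\<close>

text \<open>This \<delta> tends to 0, so the excluded parameters become negligible, but so slowly
  that the logarithm of \<open>gap L * sqrt L\<close> is still asymptotic to half of
  \<open>ln L\<close>. The modulus keeps it positive for every \<open>L > 0\<close>.\<close>

definition gap :: "real \<Rightarrow> real" where
  "gap L = 1 / (1 + \<bar>ln L\<bar>)"

lemma gap_pos: "0 < gap L"
  by (simp add: gap_def add_pos_nonneg)

lemma gap_tendsto: "(gap \<longlongrightarrow> 0) at_top"
  unfolding gap_def[abs_def] by real_asymp

lemma eventually_sqrt_ge: "\<forall>\<^sub>F L in at_top. c \<le> sqrt L"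
  using sqrt_at_top by (simp add: filterlim_at_top)

lemma eventually_gap_le: "0 < d \<Longrightarrow> \<forall>\<^sub>F L in at_top. gap L \<le> d"
  using order_tendstoD(2)[OF gap_tendsto] by (rule eventually_mono) auto

lemma eventually_large: "\<forall>\<^sub>F L in at_top. large L"
proof -
  have "\<forall>\<^sub>F L in at_top. c \<le> L * d" if "0 < d" for c d :: real
    using eventually_ge_at_top[of "c / d"] by eventually_elim (use that in \<open>simp add: field_simps\<close>)
  note ev = this
  show ?thesis
    using eventually_ge_at_top[of 1] ev[of "\<kappa> * r" 4] ev[of "\<kappa> * r\<^sup>2" 9] ev[of m 4] ev[of "m * r" 2] pos
    unfolding large_def by (simp add: eventually_conj_iff mult.assoc)
qed

lemma eventually_scales:
  "\<forall>\<^sub>F L in at_top. 0 < gap L \<and> gap L \<le> 1 \<and> 9 / 20 * \<kappa> * gap L \<le> m \<and> gap L \<le> \<kappa> / 5 \<and> 6 * K * gap L \<le> \<kappa>\<^sup>2 / 8 \<and>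
     1 \<le> gap L * sqrt L \<and> gap L * sqrt L + 1 < L * m \<and> 18 \<le> \<kappa> * sqrt L \<and> C \<le> sqrt L"
proof -
  have 1: "\<forall>\<^sub>F L in at_top. 1 \<le> gap L * sqrt L" unfolding gap_def by real_asymp
  \<comment> \<open>Once \<open>gap L \<le> 1\<close> and \<open>sqrt L \<ge> 1\<close>, the left
    side is at most \<open>2 * sqrt L\<close>, and \<open>L * m\<close> is \<open>sqrt L\<close>
    times a factor above 2.\<close>
  have 2: "\<forall>\<^sub>F L in at_top. gap L * sqrt L + 1 < L * m"
    using eventually_gap_le[of 1, OF zero_less_one] eventually_sqrt_ge[of "2 / m + 1"] eventually_ge_at_top[of 1]
  proof eventually_elim
    case (elim L)
    have "gap L * sqrt L \<le> 1 * sqrt L" using elim by (intro mult_right_mono) auto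
    moreover have "1 \<le> sqrt L" using elim by simp
    moreover have "2 < sqrt L * m" using elim pos by (simp add: field_simps)
    then have "sqrt L * 2 < sqrt L * (sqrt L * m)" using elim by (intro mult_strict_left_mono) auto
    moreover have "sqrt L * (sqrt L * m) = L * m" using elim by (simp add: mult.assoc[symmetric])
    ultimately show ?case by linarith
  qed
  have pos': "0 < m / (9 / 20 * \<kappa>)" "0 < \<kappa> / 5" "0 < \<kappa>\<^sup>2 / 8 / (6 * K)" using pos by simp_all
  note 3 = pos'[THEN eventually_gap_le] eventually_gap_le[OF zero_less_one]
  show ?thesis
    using 1 2 3 eventually_sqrt_ge[of "18 / \<kappa>"] eventually_sqrt_ge[of C]
  proof eventually_elim
    case (elim L)
    have "9 / 20 * \<kappa> * gap L \<le> m" using elim(3) pos by (simp add: field_simps)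
    moreover have "6 * K * gap L \<le> \<kappa>\<^sup>2 / 8" using elim(5) pos by (simp add: field_simps)
    moreover have "18 \<le> \<kappa> * sqrt L" using elim(7) pos by (simp add: field_simps)
    ultimately show ?case using elim gap_pos[of L] by blast
  qed
qed

end

section \<open>Parameter sets, measures and the limit inferior\<close>

theorem theorem5:
  fixes \<psi> :: "real \<Rightarrow> real" and N :: nat
  assumes C2: "C2_on_circle \<psi>"
    and N: "0 < N" "finite (critical_points \<psi>)" "card (critical_points \<psi>) = N"
    and nondegenerate: "\<forall>c \<in> critical_points \<psi>. deriv (deriv \<psi>) c \<noteq> 0"
  shows "\<exists>A :: real \<Rightarrow> real set.
    (\<forall>L>0. A L \<subseteq> {0..<1} \<and>
       (\<exists>\<J>. finite \<J> \<and> card \<J> \<le> N\<^sup>2 \<and> (\<forall>J\<in>\<J>. arc_on_circle J) \<and> A L = \<Union>\<J>)) \<and>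
    ((\<lambda>L. measure circle_measure (A L)) \<longlongrightarrow> 1) at_top \<and>
    (\<forall>\<epsilon> :: real \<Rightarrow> real. (\<forall>L>0. \<epsilon> L > b_length \<psi> 2 L / 2) \<longrightarrow>
       (\<exists>\<mu> :: real \<Rightarrow> real \<Rightarrow> real measure.
          (\<forall>\<^sub>F L in at_top. \<forall>a\<in>{0..<1}.
             ergodic_invariant_measure \<psi> L a (\<epsilon> L) (\<mu> L a) \<and>
             (\<forall>\<nu>. ergodic_invariant_measure \<psi> L a (\<epsilon> L) \<nu> \<longrightarrow> \<nu> = \<mu> L a)) \<and>
          Liminf at_top (\<lambda>L. INF a\<in>A L. lyapunov_exponent \<psi> L (\<mu> L a) / ereal (ln L)) \<ge> 1 / 2))"
proof -
  obtain \<kappa> K r m where "morse_circle \<psi> \<kappa> K r m"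
    using morse_circle_exists[OF C2 N(2) _ nondegenerate] N by force
  then interpret morse_circle \<psi> \<kappa> K r m .
  define A where "A L = centres_avoided (gap L) (avoided_parameters L)" for L
  have sub: "A L \<subseteq> {0..<1}" for L by (auto simp: A_def centres_avoided_def)
  have arcs: "\<exists>\<J>. finite \<J> \<and> card \<J> \<le> N\<^sup>2 \<and> (\<forall>J\<in>\<J>. arc_on_circle J) \<and> A L = \<Union>\<J>" for L
    using centres_avoided_arcs[OF avoided_parameters(1,2,3) gap_pos] avoided_parameters(4)[of L] N(3)
    unfolding A_def by (meson le_trans)
  have lim: "((\<lambda>L. measure circle_measure (A L)) \<longlongrightarrow> 1) at_top"
  proof (rule tendsto_sandwich)
    show "\<forall>\<^sub>F L in at_top. 1 - 6 * gap L * real (N\<^sup>2) \<le> measure circle_measure (A L)"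
    proof (rule always_eventually, rule allI)
      fix L
      have "6 * gap L * card (avoided_parameters L) \<le> 6 * gap L * real (N\<^sup>2)"
        using avoided_parameters(4)[of L] N(3) gap_pos[of L] by (intro mult_left_mono) (auto simp flip: of_nat_power)
      then show "1 - 6 * gap L * real (N\<^sup>2) \<le> measure circle_measure (A L)"
        using measure_centres_avoided_ge[OF avoided_parameters(1,3), of "gap L" L] gap_pos[of L]
        unfolding A_def by linarith
    qed
    show "\<forall>\<^sub>F L in at_top. measure circle_measure (A L) \<le> 1" by simp
    have "((\<lambda>L. 1 - 6 * gap L * real (N\<^sup>2)) \<longlongrightarrow> 1 - 6 * 0 * real (N\<^sup>2)) at_top"
      by (intro tendsto_intros gap_tendsto)
    then show "((\<lambda>L. 1 - 6 * gap L * real (N\<^sup>2)) \<longlongrightarrow> 1) at_top" by simp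
  qed simp
  obtain C where C: "C > 0" and bound: "\<And>L a \<epsilon> \<nu> s \<delta>. large L \<Longrightarrow> b_length \<psi> 2 L / 2 < \<epsilon> \<Longrightarrow>
     invariant_measure \<psi> L a \<epsilon> \<nu> \<Longrightarrow> a \<in> centres_avoided \<delta> (avoided_parameters L) \<Longrightarrow>
     0 < \<delta> \<and> \<delta> \<le> 1 \<and> 9 / 20 * \<kappa> * \<delta> \<le> m \<and> \<delta> \<le> \<kappa> / 5 \<and> 6 * K * \<delta> \<le> \<kappa>\<^sup>2 / 8 \<Longrightarrow>
     s = \<delta> * sqrt L \<and> 1 \<le> s \<and> s + 1 < L * m \<and> 18 \<le> \<kappa> * sqrt L \<Longrightarrow> C \<le> sqrt L \<Longrightarrow>
     ereal (ln s * (1 - C / sqrt L) - C) \<le> lyapunov_exponent \<psi> L \<nu>"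
    using lyapunov_bound by blast
  have main: "\<exists>\<mu> :: real \<Rightarrow> real \<Rightarrow> real measure.
          (\<forall>\<^sub>F L in at_top. \<forall>a\<in>{0..<1}.
             ergodic_invariant_measure \<psi> L a (\<epsilon> L) (\<mu> L a) \<and>
             (\<forall>\<nu>. ergodic_invariant_measure \<psi> L a (\<epsilon> L) \<nu> \<longrightarrow> \<nu> = \<mu> L a)) \<and>
          Liminf at_top (\<lambda>L. INF a\<in>A L. lyapunov_exponent \<psi> L (\<mu> L a) / ereal (ln L)) \<ge> 1 / 2"
    if \<epsilon>: "\<forall>L>0. \<epsilon> L > b_length \<psi> 2 L / 2" for \<epsilon> :: "real \<Rightarrow> real"
  proof -
    define good where "good L a \<mu> \<longleftrightarrow> ergodic_invariant_measure \<psi> L a (\<epsilon> L) \<mu> \<and>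
        (\<forall>\<nu>. ergodic_invariant_measure \<psi> L a (\<epsilon> L) \<nu> \<longrightarrow> \<nu> = \<mu>)" for L a \<mu>
    \<comment> \<open>A choice for every \<open>L\<close> and \<open>a\<close>; it is known to be
      meaningful only when \<open>L\<close> is large.\<close>
    define \<mu> where "\<mu> L a = (SOME \<mu>. good L a \<mu>)" for L a
    have good: "good L a (\<mu> L a)" if "large L" for L a
    proof -
      have "b_length \<psi> 2 L / 2 < \<epsilon> L" using that \<epsilon> by (auto simp: large_def)
      then have "\<exists>\<mu>. good L a \<mu>" using unique_ergodic_measure[OF that] by (simp add: good_def)
      then show ?thesis unfolding \<mu>_def by (rule someI_ex)
    qed
    \<comment> \<open>A lower bound for the quotient that does not involve \<open>a\<close>, hence
      also for the infimum over \<open>A L\<close>. Its limit is 1/2.\<close>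
    define h where "h L = (ln (gap L * sqrt L) * (1 - C / sqrt L) - C) / ln L" for L
    have "\<forall>\<^sub>F L in at_top. ereal (h L) \<le> (INF a\<in>A L. lyapunov_exponent \<psi> L (\<mu> L a) / ereal (ln L))"
      using eventually_large eventually_scales[of C] eventually_gt_at_top[of 1]
    proof eventually_elim
      case (elim L)
      show ?case
      proof (rule INF_greatest)
        fix a assume a: "a \<in> A L"
        have "invariant_measure \<psi> L a (\<epsilon> L) (\<mu> L a)"
          using good[OF elim(1), of a] by (simp add: good_def ergodic_invariant_measure_def)
        then have "ereal (ln (gap L * sqrt L) * (1 - C / sqrt L) - C) \<le> lyapunov_exponent \<psi> L (\<mu> L a)"
          using elim a \<epsilon> by (intro bound[where a = a and \<epsilon> = "\<epsilon> L" and \<delta> = "gap L"]) (auto simp: A_def)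
        then have "ereal (ln (gap L * sqrt L) * (1 - C / sqrt L) - C) / ereal (ln L)
            \<le> lyapunov_exponent \<psi> L (\<mu> L a) / ereal (ln L)"
          using elim by (intro ereal_divide_right_mono) auto
        then show "ereal (h L) \<le> lyapunov_exponent \<psi> L (\<mu> L a) / ereal (ln L)"
          using elim by (simp add: h_def)
      qed
    qed
    then have "Liminf at_top (\<lambda>L. ereal (h L))
        \<le> Liminf at_top (\<lambda>L. INF a\<in>A L. lyapunov_exponent \<psi> L (\<mu> L a) / ereal (ln L))"
      by (rule Liminf_mono)
    moreover have "(h \<longlongrightarrow> 1 / 2) at_top"
      unfolding h_def[abs_def] gap_def using C by real_asymp
    then have "Liminf at_top (\<lambda>L. ereal (h L)) = ereal (1 / 2)"
      by (intro lim_imp_Liminf) auto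
    moreover have "ereal (1 / 2) = 1 / 2" by (simp add: one_ereal_def numeral_eq_ereal)
    ultimately have "1 / 2 \<le> Liminf at_top (\<lambda>L. INF a\<in>A L. lyapunov_exponent \<psi> L (\<mu> L a) / ereal (ln L))"
      by simp
    moreover have "\<forall>\<^sub>F L in at_top. \<forall>a\<in>{0..<1}. good L a (\<mu> L a)"
      using eventually_large by eventually_elim (use good in blast)
    ultimately show ?thesis unfolding good_def by blast
  qed
  show ?thesis using sub arcs lim main by (intro exI[of _ A]) blast
qed

end
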